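(* Let $A:\mathbb{R}^2\to\mathbb{C}$ be a continuous function with $\limsup_{|\mathbf{p}|\to\infty}|A(\mathbf{p})|/|\mathbf{p}|^2<1$. Put $\lambda_-(\mathbf{p})=|\mathbf{p}|^2-|A(\mathbf{p})|$, $\kappa=\inf_{\mathbf{p}\in\mathbb{R}^2}\lambda_-(\mathbf{p})$ and $S=\{\mathbf{p}\in\mathbb{R}^2:\lambda_-(\mathbf{p})=\kappa\}$, and assume that $|A|$ is of class $C^2$ in a neighborhood of $S$. Let $V:\mathbb{R}^2\to\mathbb{R}$ belong to $L^1(\mathbb{R}^2)\cap L^r(\mathbb{R}^2)$ for some $r>1$, and let $H=H_0+V$ be the associated self-adjoint operator in $L^2(\mathbb{R}^2)\otimes\mathbb{C}^2$ (defined in the context). Let $N\in\mathbb{N}$, $N\geq 1$, and suppose that there are $N$ points $\mathbf{p}_1,\dots,\mathbf{p}_N\in S$ such that the Hermitian matrix $\big(\widehat V(\mathbf{p}_m-\mathbf{p}_n)\big)_{1\le m,n\le N}$ is negative definite. Then $H$ has at least $N$ eigenvalues, counting multiplicity, below $\kappa$ (i.e. in $(-\infty,\kappa)$).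
   Context: The Hilbert space is $L^2(\mathbb{R}^2)\otimes\mathbb{C}^2$. The Fourier transform is $\widehat f(\mathbf{p})=\frac{1}{2\pi}\int_{\mathbb{R}^2}e^{-i\mathbf{p}\cdot\mathbf{x}}f(\mathbf{x})\,d\mathbf{x}$, extended to a unitary operator $\mathcal{F}$ on $L^2(\mathbb{R}^2)$; put $\mathcal{F}_2=\mathcal{F}\otimes 1_{\mathbb{C}^2}$. $H_0$ is the self-adjoint operator such that $\mathcal{F}_2H_0\mathcal{F}_2^{-1}$ is multiplication by the matrix $$\widehat H_0(\mathbf{p})=\begin{pmatrix}|\mathbf{p}|^2 & A(\mathbf{p})\\ \overline{A(\mathbf{p})} & |\mathbf{p}|^2\end{pmatrix}.$$ Under the growth assumption on $A$, $\kappa$ is finite, $S$ is non-empty and compact, and $\operatorname{spec}H_0=[\kappa,+\infty)$. The scalar potential $V$ acts as $V\otimes I_{\mathbb{C}^2}$. $H=H_0+V$ is the form sum: the self-adjoint operator associated with the closed, lower semibounded quadratic form on the Sobolev space $H^1(\mathbb{R}^2;\mathbb{C}^2)$ given by the quadratic form of $H_0$ plus $\int_{\mathbb{R}^2}V(\mathbf{x})|\Psi(\mathbf{x})|^2\,d\mathbf{x}$ (for $r\ge 2$ it is the operator sum on the domain of $H_0$). One has $\operatorname{spec}_{\mathrm{ess}}H=[\kappa,+\infty)$. A Hermitian $n\times n$ matrix $C$ is negative definite if $\langle\xi|C\xi\rangle<0$ for every non-zero $\xi\in\mathbb{C}^n$. *)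

theory Defs
  imports "HOL-Analysis.Analysis" "HOL-Library.Extended_Nat"
begin

type_synonym plane = "real^2"
type_synonym spinor = "complex^2"

text \<open>
  Elements of the \<open>L\<^sup>2\<close> spaces over the plane are represented by Lebesgue measurable,
  square-integrable functions; two functions that agree almost everywhere stand for the
  same vector. \<open>L\<^sup>2(\<real>\<^sup>2) \<otimes> \<complex>\<^sup>2\<close> is identified with the space of square-integrable spinor fields.
\<close>

definition L2 :: "(plane \<Rightarrow> 'b::euclidean_space) set" where
  "L2 = {f. f \<in> borel_measurable lebesgue \<and> integrable lebesgue (\<lambda>x. (norm (f x))\<^sup>2)}"

definition L2_tendsto ::
    "(nat \<Rightarrow> plane \<Rightarrow> 'b::euclidean_space) \<Rightarrow> (plane \<Rightarrow> 'b) \<Rightarrow> bool" where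
  "L2_tendsto u f \<longleftrightarrow>
     (\<lambda>n. \<integral>\<^sup>+x. ennreal ((norm (u n x - f x))\<^sup>2) \<partial>lebesgue) \<longlonglongrightarrow> 0"

definition cinner :: "complex^'n \<Rightarrow> complex^'n \<Rightarrow> complex" where
  "cinner u v = (\<Sum>i\<in>UNIV. cnj (u $ i) * v $ i)"

definition L2_inner :: "(plane \<Rightarrow> spinor) \<Rightarrow> (plane \<Rightarrow> spinor) \<Rightarrow> complex" where
  "L2_inner \<Phi> \<Psi> = (LINT x|lebesgue. cinner (\<Phi> x) (\<Psi> x))"

definition fourier :: "(plane \<Rightarrow> complex) \<Rightarrow> plane \<Rightarrow> complex" where
  "fourier f p = 1 / (2 * of_real pi) * (LINT x|lebesgue. exp (- \<i> * of_real (p \<bullet> x)) * f x)"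

text \<open>
  The unitary extension to \<open>L\<^sup>2\<close>: the extension by continuity of \<^const>\<open>fourier\<close> from
  \<open>L\<^sup>1 \<inter> L\<^sup>2\<close>. By Plancherel's theorem a function \<open>g\<close> as below exists for every \<open>f\<close> in
  \<open>L\<^sup>2\<close> and is unique up to null sets, so the choice of the representative is immaterial.
\<close>

definition fourier_L2 :: "(plane \<Rightarrow> complex) \<Rightarrow> plane \<Rightarrow> complex" where
  "fourier_L2 f = (SOME g. g \<in> L2 \<and>
     (\<exists>u. (\<forall>n. integrable lebesgue (u n) \<and> u n \<in> L2) \<and>
          L2_tendsto u f \<and> L2_tendsto (\<lambda>n. fourier (u n)) g))"

definition fourier2 :: "(plane \<Rightarrow> spinor) \<Rightarrow> plane \<Rightarrow> spinor" where
  "fourier2 \<Psi> p = (\<chi> i. fourier_L2 (\<lambda>x. \<Psi> x $ i) p)"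

definition lambda_minus :: "(plane \<Rightarrow> complex) \<Rightarrow> plane \<Rightarrow> real" where
  "lambda_minus A p = (norm p)\<^sup>2 - cmod (A p)"

definition kappa :: "(plane \<Rightarrow> complex) \<Rightarrow> real" where
  "kappa A = (INF p. lambda_minus A p)"

definition min_set :: "(plane \<Rightarrow> complex) \<Rightarrow> plane set" where
  "min_set A = {p. lambda_minus A p = kappa A}"

definition H0_symbol :: "(plane \<Rightarrow> complex) \<Rightarrow> plane \<Rightarrow> complex^2^2" where
  "H0_symbol A p = vector [vector [of_real ((norm p)\<^sup>2), A p],
                           vector [cnj (A p), of_real ((norm p)\<^sup>2)]]"

text \<open>The Sobolev space \<open>H\<^sup>1(\<real>\<^sup>2; \<complex>\<^sup>2)\<close>, defined on the Fourier side.\<close>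

definition H1 :: "(plane \<Rightarrow> spinor) set" where
  "H1 = {\<Psi> \<in> L2. integrable lebesgue (\<lambda>p. (1 + (norm p)\<^sup>2) * (norm (fourier2 \<Psi> p))\<^sup>2)}"

text \<open>
  Under \<^const>\<open>fourier2\<close>, \<open>H\<^sub>0\<close> is multiplication by \<^const>\<open>H0_symbol\<close>. Its quadratic form is
  represented by the sesquilinear form, conjugate-linear in the first argument, whose
  diagonal it is.
\<close>

definition H0_form :: "(plane \<Rightarrow> complex) \<Rightarrow> (plane \<Rightarrow> spinor) \<Rightarrow> (plane \<Rightarrow> spinor) \<Rightarrow> complex" where
  "H0_form A \<Phi> \<Psi> = L2_inner (fourier2 \<Phi>) (\<lambda>p. H0_symbol A p *v fourier2 \<Psi> p)"

definition H_form ::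
    "(plane \<Rightarrow> complex) \<Rightarrow> (plane \<Rightarrow> real) \<Rightarrow> (plane \<Rightarrow> spinor) \<Rightarrow> (plane \<Rightarrow> spinor) \<Rightarrow> complex" where
  "H_form A V \<Phi> \<Psi> =
     H0_form A \<Phi> \<Psi> + (LINT x|lebesgue. of_real (V x) * cinner (\<Phi> x) (\<Psi> x))"

text \<open>
  Operators are given by their graphs. The operator associated with a densely defined,
  closed, lower semibounded sesquilinear form \<open>q\<close> (first representation theorem) has
  as its domain all \<open>\<Psi>\<close> in the form domain for which some \<open>\<Phi> \<in> L\<^sup>2\<close> satisfies
  \<open>q(\<Theta>,\<Psi>) = \<langle>\<Theta>,\<Phi>\<rangle>\<close> for all \<open>\<Theta>\<close> in the form domain; it maps \<open>\<Psi>\<close> to this \<open>\<Phi>\<close>, which is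
  unique up to null sets.
\<close>

type_synonym op_graph = "((plane \<Rightarrow> spinor) \<times> (plane \<Rightarrow> spinor)) set"

definition form_operator ::
    "(plane \<Rightarrow> spinor) set \<Rightarrow> ((plane \<Rightarrow> spinor) \<Rightarrow> (plane \<Rightarrow> spinor) \<Rightarrow> complex) \<Rightarrow> op_graph" where
  "form_operator D q =
     {(\<Psi>, \<Phi>). \<Psi> \<in> D \<and> \<Phi> \<in> L2 \<and> (\<forall>\<Theta>\<in>D. q \<Theta> \<Psi> = L2_inner \<Theta> \<Phi>)}"

definition H_op :: "(plane \<Rightarrow> complex) \<Rightarrow> (plane \<Rightarrow> real) \<Rightarrow> op_graph" where
  "H_op A V = form_operator H1 (H_form A V)"

definition eigenspace :: "op_graph \<Rightarrow> real \<Rightarrow> (plane \<Rightarrow> spinor) set" where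
  "eigenspace T E = {\<Psi>. (\<Psi>, \<lambda>x. E *\<^sub>R \<Psi> x) \<in> T}"

text \<open>Linear independence over \<open>\<complex>\<close> of the classes modulo null sets.\<close>

definition L2_independent :: "nat \<Rightarrow> (nat \<Rightarrow> plane \<Rightarrow> spinor) \<Rightarrow> bool" where
  "L2_independent n \<Psi> \<longleftrightarrow>
     (\<forall>c :: nat \<Rightarrow> complex. (AE x in lebesgue. (\<Sum>j<n. c j *s \<Psi> j x) = 0) \<longrightarrow> (\<forall>j<n. c j = 0))"

text \<open>The dimension of the eigenspace; it is \<open>0\<close> if \<open>E\<close> is not an eigenvalue.\<close>

definition eigen_mult :: "op_graph \<Rightarrow> real \<Rightarrow> enat" where
  "eigen_mult T E =
     Sup {enat n | n. \<exists>\<Psi>. (\<forall>j<n. \<Psi> j \<in> eigenspace T E) \<and> L2_independent n \<Psi>}"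

definition eigen_count_below :: "op_graph \<Rightarrow> real \<Rightarrow> enat" where
  "eigen_count_below T b = (SUP F\<in>{F. finite F \<and> F \<subseteq> {..<b}}. \<Sum>E\<in>F. eigen_mult T E)"

definition C2_on :: "'a::real_normed_vector set \<Rightarrow> ('a \<Rightarrow> 'b::real_normed_vector) \<Rightarrow> bool" where
  "C2_on U f \<longleftrightarrow> open U \<and>
     (\<exists>(f' :: 'a \<Rightarrow> 'a \<Rightarrow>\<^sub>L 'b) (f'' :: 'a \<Rightarrow> 'a \<Rightarrow>\<^sub>L ('a \<Rightarrow>\<^sub>L 'b)).
        (\<forall>x\<in>U. (f has_derivative blinfun_apply (f' x)) (at x)) \<and>
        (\<forall>x\<in>U. (f' has_derivative blinfun_apply (f'' x)) (at x)) \<and>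
        continuous_on U f'')"

text \<open>For \<open>N \<times> N\<close> matrices with indices in \<open>{1..N}\<close>; the form of a Hermitian matrix is real.\<close>

definition hermitian_neg_def :: "nat \<Rightarrow> (nat \<Rightarrow> nat \<Rightarrow> complex) \<Rightarrow> bool" where
  "hermitian_neg_def N C \<longleftrightarrow>
     (\<forall>m\<in>{1..N}. \<forall>n\<in>{1..N}. C m n = cnj (C n m)) \<and>
     (\<forall>\<xi> :: nat \<Rightarrow> complex. (\<exists>m\<in>{1..N}. \<xi> m \<noteq> 0) \<longrightarrow>
        Re (\<Sum>m=1..N. \<Sum>n=1..N. cnj (\<xi> m) * C m n * \<xi> n) < 0)"

end

theory Submission
  imports Defs "HOL-Probability.Characteristic_Functions" "HOL-Library.Function_Algebras"
begin

text \<open>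
  The eigenvalues are produced one after the other by minimising the form of \<open>H\<close> on the orthogonal
  complement of the eigenvectors found so far. Below \<open>kappa A\<close> the form is bounded from below by a
  multiple of the squared \<open>H\<^sup>1\<close> norm minus finitely many squares of \<open>L\<^sup>2\<close>-bounded functionals. Along
  a minimising sequence these finitely many functionals converge after passing to a subsequence, and
  the parallelogram law then makes the sequence Cauchy in \<open>H\<^sup>1\<close>; no weak compactness is needed.

  The lower bound comes from a dyadic decomposition in momentum space: a piece of frequency \<open>2 ^ k\<close> has
  a sup norm of order \<open>2 ^ k\<close> times its \<open>L\<^sup>2\<close> norm, so for \<open>V\<close> in \<open>L\<^sup>r\<close> with \<open>r > 1\<close> the potential energies of
  the pieces decay geometrically relative to their \<open>H\<^sup>1\<close> norms, and the remaining low frequencies are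
  controlled by point evaluations on a finite net.

  The trial functions live in momentum space: a logarithmic mollifier around \<open>p m\<close> times the lower
  eigenvector of the symbol. Since \<open>lambda_minus A\<close> grows at most quadratically away from \<open>p m\<close>, their
  kinetic energy above \<open>kappa A\<close> tends to zero, while in position space they converge boundedly to
  plane waves, on which the potential energy is the form of the given negative definite matrix.
\<close>

section \<open>The abstract variational principle\<close>

text \<open>Two obstacles come from dimension two. \<open>H1\<close> does not embed into the bounded
  functions, and a rescaled bump of mass one does not lower the kinetic energy: at scale \<epsilon>
  the integral of \<open>|q|^2 \<phi>^2\<close> is independent of \<epsilon>. The first is met by r
  > 1, which leaves a geometric gain in every dyadic band; the second by spreading the mass equally
  over n + 1 dyadic annuli, which yields 1 / (n + 1).

  Coercivity of \<open>h - E * ip\<close> modulo finitely many bounded functionals, for every E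
  below \<open>kappa A\<close>, plays the part of the essential spectrum: a minimiser exists as soon
  as one admissible vector has its Rayleigh quotient below the threshold. N trial vectors, all of
  whose non-trivial combinations lie below it, provide such a vector under any k < N orthogonality
  constraints.

  One packet index n has to serve all coefficient vectors. Hence the energy estimates are uniform in
  bounded coefficients and the last step is a compactness argument by contradiction. Fields are
  functions, not classes modulo null sets; therefore forms may have null vectors and the Fourier
  transform is handled as a relation.\<close>

lemma bounded_family_convergent_subseq:
  fixes f :: "nat \<Rightarrow> 'j \<Rightarrow> 'a::heine_borel"
  assumes "finite J" and "\<And>j. j \<in> J \<Longrightarrow> bounded (range (\<lambda>n. f n j))"
  shows "\<exists>r l. strict_mono (r :: nat \<Rightarrow> nat) \<and> (\<forall>j\<in>J. (\<lambda>n. f (r n) j) \<longlonglongrightarrow> l j)"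
  using assms
proof (induction J rule: finite_induct)
  case empty
  show ?case by (intro exI[of _ id]) (auto simp: strict_mono_def)
next
  case (insert k J)
  then obtain r l where r: "strict_mono r" and l: "\<And>j. j \<in> J \<Longrightarrow> (\<lambda>n. f (r n) j) \<longlonglongrightarrow> l j"
    by (metis insertI2)
  have "bounded (range (\<lambda>n. f (r n) k))"
    by (rule bounded_subset[OF insert.prems[of k]]) auto
  then obtain a t where t: "strict_mono (t :: nat \<Rightarrow> nat)"
    and a: "((\<lambda>n. f (r n) k) \<circ> t) \<longlonglongrightarrow> a"
    using bounded_imp_convergent_subsequence by blast
  have "(\<lambda>n. f ((r \<circ> t) n) j) \<longlonglongrightarrow> l j" if "j \<in> J" for j
    using LIMSEQ_subseq_LIMSEQ[OF l[OF that] t] by (simp add: o_def)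
  moreover have "(\<lambda>n. f ((r \<circ> t) n) k) \<longlonglongrightarrow> a"
    using a by (simp add: o_def)
  ultimately have "\<forall>j\<in>insert k J. (\<lambda>n. f ((r \<circ> t) n) j) \<longlonglongrightarrow> (l(k := a)) j"
    using insert.hyps by auto
  then show ?case using strict_mono_o[OF r t] by blast
qed

text \<open>Gaussian elimination: an equation with a non-zero coefficient is solved for that
  unknown, which leaves one equation and one unknown less. The lemma supplies a combination of trial
  vectors orthogonal to the eigenvectors already found.\<close>

lemma underdetermined_system:
  fixes a :: "nat \<Rightarrow> 'i \<Rightarrow> 'f::field"
  assumes "finite I" "k < card I"
  shows "\<exists>\<xi>. (\<exists>i\<in>I. \<xi> i \<noteq> 0) \<and> (\<forall>j<k. (\<Sum>i\<in>I. a j i * \<xi> i) = 0)"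
  using assms
proof (induction k arbitrary: I a)
  case 0
  then have "I \<noteq> {}" by auto
  then show ?case by (intro exI[of _ "\<lambda>_. 1"]) auto
next
  case (Suc k)
  show ?case
  proof (cases "\<forall>i\<in>I. a k i = 0")
    case True
    obtain \<xi> where "\<exists>i\<in>I. \<xi> i \<noteq> 0" "\<forall>j<k. (\<Sum>i\<in>I. a j i * \<xi> i) = 0"
      using Suc.IH[of I a] Suc.prems by auto
    then show ?thesis using True by (auto simp: less_Suc_eq)
  next
    case False
    then obtain i0 where i0: "i0 \<in> I" "a k i0 \<noteq> 0" by auto
    define I' where "I' = I - {i0}"
    have fI': "finite I'" and cI': "k < card I'"
      using Suc.prems i0 by (auto simp: I'_def)
    obtain \<xi> where nz: "\<exists>i\<in>I'. \<xi> i \<noteq> 0"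
      and eq: "\<And>j. j < k \<Longrightarrow> (\<Sum>i\<in>I'. (a j i - a j i0 * a k i / a k i0) * \<xi> i) = 0"
      using Suc.IH[OF fI' cI', of "\<lambda>j i. a j i - a j i0 * a k i / a k i0"] by auto
    define t where "t = - (\<Sum>i\<in>I'. a k i * \<xi> i) / a k i0"
    have split: "(\<Sum>i\<in>I. a j i * (\<xi>(i0 := t)) i) = a j i0 * t + (\<Sum>i\<in>I'. a j i * \<xi> i)" for j
    proof -
      have "(\<Sum>i\<in>I. a j i * (\<xi>(i0 := t)) i)
          = a j i0 * (\<xi>(i0 := t)) i0 + (\<Sum>i\<in>I'. a j i * (\<xi>(i0 := t)) i)"
        unfolding I'_def using Suc.prems i0 by (intro sum.remove) auto
      also have "(\<Sum>i\<in>I'. a j i * (\<xi>(i0 := t)) i) = (\<Sum>i\<in>I'. a j i * \<xi> i)"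
        by (intro sum.cong) (auto simp: I'_def)
      finally show ?thesis by simp
    qed
    have "(\<Sum>i\<in>I. a j i * (\<xi>(i0 := t)) i) = 0" if "j < Suc k" for j
    proof (cases "j = k")
      case True
      show ?thesis unfolding split unfolding t_def True using i0 by simp
    next
      case False
      then have "j < k" using that by simp
      from eq[OF this] have "(\<Sum>i\<in>I'. a j i * \<xi> i) - a j i0 / a k i0 * (\<Sum>i\<in>I'. a k i * \<xi> i) = 0"
        by (simp add: left_diff_distrib sum_subtractf sum_distrib_left mult.assoc)
      then show ?thesis unfolding split unfolding t_def by (simp add: field_simps)
    qed
    moreover have "\<exists>i\<in>I. (\<xi>(i0 := t)) i \<noteq> 0"
      using nz by (auto simp: I'_def)
    ultimately show ?thesis by blast
  qed
qed

section \<open>Hermitian forms on a complex vector space\<close>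

locale complex_vector_space = vector_space scale
  for scale :: "complex \<Rightarrow> 'v::ab_group_add \<Rightarrow> 'v" (infixr "*c" 75)
begin

text \<open>Sesquilinearity is encoded as linearity in the second argument plus conjugate symmetry.
  Definiteness is left out: the vectors will be functions, so that even the inner product vanishes
  on some non-zero vectors, and the form of the Hamiltonian has no sign.\<close>

definition hermitian_on :: "'v set \<Rightarrow> ('v \<Rightarrow> 'v \<Rightarrow> complex) \<Rightarrow> bool" where
  "hermitian_on D q \<longleftrightarrow>
     (\<forall>x\<in>D. \<forall>y\<in>D. \<forall>z\<in>D. \<forall>c. q x (c *c y + z) = c * q x y + q x z) \<and>
     (\<forall>x\<in>D. \<forall>y\<in>D. q y x = cnj (q x y))"

lemma hermitian_on_subset: "hermitian_on D q \<Longrightarrow> M \<subseteq> D \<Longrightarrow> hermitian_on M q"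
  unfolding hermitian_on_def by blast

text \<open>Meant for \<open>h - E * ip\<close>; the value \<open>E = - 1\<close> later yields the
  sum of two Hermitian forms.\<close>

lemma hermitian_on_shift:
  assumes "hermitian_on D q" "hermitian_on D q'"
  shows "hermitian_on D (\<lambda>x y. q x y - of_real E * q' x y)"
  unfolding hermitian_on_def
proof (intro conjI ballI allI)
  fix x y z c assume D: "x \<in> D" "y \<in> D" "z \<in> D"
  have "q x (c *c y + z) = c * q x y + q x z" "q' x (c *c y + z) = c * q' x y + q' x z"
    using assms D unfolding hermitian_on_def by blast+
  then show "q x (c *c y + z) - of_real E * q' x (c *c y + z)
      = c * (q x y - of_real E * q' x y) + (q x z - of_real E * q' x z)"
    by (simp only:) (simp add: algebra_simps)
next
  fix x y assume D: "x \<in> D" "y \<in> D"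
  have "q y x = cnj (q x y)" "q' y x = cnj (q' x y)"
    using assms D unfolding hermitian_on_def by blast+
  then show "q y x - of_real E * q' y x = cnj (q x y - of_real E * q' x y)" by simp
qed

context
  fixes D q assumes D: "subspace D" and q: "hermitian_on D q"
begin

lemma herm_sym: "x \<in> D \<Longrightarrow> y \<in> D \<Longrightarrow> q y x = cnj (q x y)"
  using q unfolding hermitian_on_def by blast

lemma herm_add: "x \<in> D \<Longrightarrow> y \<in> D \<Longrightarrow> z \<in> D \<Longrightarrow> q x (y + z) = q x y + q x z"
  using q unfolding hermitian_on_def by (metis mult_1 scale_one)

lemma herm_zero: "x \<in> D \<Longrightarrow> q x 0 = 0"
  using herm_add[of x 0 0] subspace_0[OF D] by simp

lemma herm_scale: "x \<in> D \<Longrightarrow> y \<in> D \<Longrightarrow> q x (c *c y) = c * q x y"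
  using q herm_zero subspace_0[OF D] unfolding hermitian_on_def by (metis add.right_neutral)

lemma herm_add_left: "x \<in> D \<Longrightarrow> y \<in> D \<Longrightarrow> z \<in> D \<Longrightarrow> q (y + z) x = q y x + q z x"
  using herm_sym herm_add subspace_add[OF D] by (metis complex_cnj_add)

lemma herm_scale_left: "x \<in> D \<Longrightarrow> y \<in> D \<Longrightarrow> q (c *c y) x = cnj c * q y x"
  using herm_sym herm_scale subspace_scale[OF D] by (metis complex_cnj_mult)

lemma herm_minus: "x \<in> D \<Longrightarrow> y \<in> D \<Longrightarrow> q x (- y) = - q x y"
  using herm_scale[of x y "-1"] by simp

lemma herm_diff: "x \<in> D \<Longrightarrow> y \<in> D \<Longrightarrow> z \<in> D \<Longrightarrow> q x (y - z) = q x y - q x z"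
  using herm_add[of x y "- z"] herm_minus[of x z] subspace_neg[OF D] by simp

lemma herm_sum:
  assumes "finite I" "x \<in> D" "\<And>i. i \<in> I \<Longrightarrow> y i \<in> D"
  shows "q x (\<Sum>i\<in>I. y i) = (\<Sum>i\<in>I. q x (y i))"
  using assms(1,3)
proof (induction I rule: finite_induct)
  case empty
  then show ?case using herm_zero assms(2) by simp
next
  case (insert i I)
  then have "(\<Sum>i\<in>I. y i) \<in> D" by (intro subspace_sum[OF D]) auto
  then show ?case using insert herm_add assms(2) by simp
qed

lemma herm_real: "x \<in> D \<Longrightarrow> q x x = of_real (Re (q x x))"
  using herm_sym[of x x] by (simp add: complex_eq_iff)

lemma herm_expand:
  assumes "x \<in> D" "y \<in> D"
  shows "Re (q (x + c *c y) (x + c *c y))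
       = Re (q x x) + 2 * Re (c * q x y) + (cmod c)\<^sup>2 * Re (q y y)"
proof -
  have cy: "c *c y \<in> D" "x + c *c y \<in> D"
    using assms D by (auto intro!: subspace_add subspace_scale)
  have "q (x + c *c y) (x + c *c y) = q x x + c * q x y + cnj c * q y x + (cnj c * c) * q y y"
    using assms cy by (simp add: herm_add herm_add_left herm_scale herm_scale_left algebra_simps)
  also have "q y x = cnj (q x y)" by (rule herm_sym[OF assms])
  also have "cnj c * c = of_real ((cmod c)\<^sup>2)" by (metis complex_norm_square mult.commute)
  finally show ?thesis by simp
qed

lemma herm_scale_scale:
  assumes "x \<in> D" shows "Re (q (c *c x) (c *c x)) = (cmod c)\<^sup>2 * Re (q x x)"
  using herm_expand[OF subspace_0[OF D] assms, of c] herm_zero[OF subspace_0[OF D]]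
    herm_sym[OF subspace_0[OF D] assms] herm_zero[OF assms]
  by simp

lemma herm_parallelogram:
  assumes "x \<in> D" "y \<in> D"
  shows "Re (q (x + y) (x + y)) + Re (q (x - y) (x - y)) = 2 * Re (q x x) + 2 * Re (q y y)"
  using herm_expand[OF assms, of 1] herm_expand[OF assms, of "-1"] by simp

context
  assumes psd: "\<And>x. x \<in> D \<Longrightarrow> 0 \<le> Re (q x x)"
begin

lemma herm_diff_le:
  assumes "x \<in> D" "y \<in> D"
  shows "Re (q (x - y) (x - y)) \<le> 2 * Re (q x x) + 2 * Re (q y y)"
  using herm_parallelogram[OF assms] psd[of "x + y"] subspace_add[OF D assms] by simp

lemma herm_Cauchy_Schwarz:
  assumes x: "x \<in> D" and y: "y \<in> D"
  shows "(cmod (q x y))\<^sup>2 \<le> Re (q x x) * Re (q y y)"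
proof -
  define z where "z = q x y"
  have *: "0 \<le> Re (q x x) - 2 * t * (cmod z)\<^sup>2 + t\<^sup>2 * (cmod z)\<^sup>2 * Re (q y y)" for t :: real
  proof -
    \<comment> \<open>The phase makes \<open>c * q x y\<close> real and equal to \<open>- t\<close>
      times its squared modulus, so that only a real parameter remains.\<close>
    define c where "c = - of_real t * cnj z"
    have "Re (c * z) = - t * (cmod z)\<^sup>2"
    proof -
      have "c * z = - of_real t * of_real ((cmod z)\<^sup>2)"
        unfolding c_def by (simp add: complex_norm_square mult.commute mult.assoc del: of_real_power)
      then show ?thesis by simp
    qed
    moreover have "(cmod c)\<^sup>2 = t\<^sup>2 * (cmod z)\<^sup>2"
      by (simp add: c_def norm_mult power_mult_distrib)
    moreover have "x + c *c y \<in> D" using x y D by (auto intro!: subspace_add subspace_scale)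
    ultimately show ?thesis
      using psd[of "x + c *c y"] herm_expand[OF x y, of c] by (simp add: z_def)
  qed
  show ?thesis
  proof (cases "Re (q y y) = 0")
    case True
    have "(cmod z)\<^sup>2 = 0"
    proof (rule ccontr)
      assume "(cmod z)\<^sup>2 \<noteq> 0"
      then have "z \<noteq> 0" by simp
      then show False
        using *[of "(Re (q x x) + 1) / (2 * (cmod z)\<^sup>2)"] True psd[OF x] by simp
    qed
    then show ?thesis using True by (simp add: z_def)
  next
    case False
    then have pos: "Re (q y y) > 0" using psd[OF y] by simp
    have "0 \<le> Re (q x x) - (cmod z)\<^sup>2 / Re (q y y)"
      using *[of "1 / Re (q y y)"] pos by (simp add: power2_eq_square field_simps)
    then show ?thesis using pos by (simp add: z_def field_simps)
  qed
qed

end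
end
end

text \<open>\<open>D\<close> is the form domain, complete for the squared norm \<open>s\<close>,
  with the form \<open>h\<close> and the inner product \<open>ip\<close>. \<open>ip_null\<close>
  reflects that a field vanishing almost everywhere is null for both norms. \<open>coercive\<close>
  carries the spectral information below \<kappa>: up to finitely many functionals bounded by
  \<open>ip\<close>, the form \<open>h - E * ip\<close> controls \<open>s\<close>.\<close>

locale variational = complex_vector_space scale
  for scale :: "complex \<Rightarrow> 'v::ab_group_add \<Rightarrow> 'v" (infixr "*c" 75) +
  fixes D :: "'v set" and h ip :: "'v \<Rightarrow> 'v \<Rightarrow> complex" and s :: "'v \<Rightarrow> real"
    and C \<kappa> :: real
  assumes D: "subspace D"
    and h: "hermitian_on D h" and ip: "hermitian_on D ip"
    and ip_nonneg: "x \<in> D \<Longrightarrow> 0 \<le> Re (ip x x)"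
    and ip_le: "x \<in> D \<Longrightarrow> Re (ip x x) \<le> s x"
    and ip_null: "x \<in> D \<Longrightarrow> Re (ip x x) = 0 \<Longrightarrow> s x = 0"
    and h_le: "x \<in> D \<Longrightarrow> \<bar>Re (h x x)\<bar> \<le> C * s x"
    and complete: "(\<And>n. u n \<in> D) \<Longrightarrow> (\<And>\<epsilon>. \<epsilon> > 0 \<Longrightarrow> \<exists>n0. \<forall>m\<ge>n0. \<forall>n\<ge>n0. s (u m - u n) < \<epsilon>)
      \<Longrightarrow> \<exists>x\<in>D. (\<lambda>n::nat. s (u n - x)) \<longlonglongrightarrow> 0"
    and coercive: "E < \<kappa> \<Longrightarrow> \<exists>c>0. \<exists>(m::nat) (l :: nat \<Rightarrow> 'v \<Rightarrow> complex) B.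
      (\<forall>j<m. \<forall>x\<in>D. \<forall>y\<in>D. l j (x - y) = l j x - l j y) \<and>
      (\<forall>j<m. \<forall>x\<in>D. (cmod (l j x))\<^sup>2 \<le> B * Re (ip x x)) \<and>
      (\<forall>x\<in>D. c * s x - (\<Sum>j<m. (cmod (l j x))\<^sup>2) \<le> Re (h x x) - E * Re (ip x x))"
begin

lemma s_nonneg: "x \<in> D \<Longrightarrow> 0 \<le> s x"
  using ip_nonneg ip_le by fastforce

text \<open>The direct method on the subspace \<open>M\<close> of constrained vectors. The vector
  \<phi> puts the infimum \<open>E\<close> of the Rayleigh quotient below \<kappa>, where coercivity
  is available, and \<open>q = h - E * ip\<close> is then non-negative on \<open>M\<close>. A
  minimiser is a null vector of \<open>q\<close>, so Cauchy-Schwarz for \<open>q\<close> gives its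
  Euler-Lagrange equation, tested against constrained vectors only.\<close>

lemma minimizer_exists:
  fixes \<psi> :: "nat \<Rightarrow> 'v"
  assumes \<psi>: "\<And>j. j < k \<Longrightarrow> \<psi> j \<in> D"
    and \<phi>: "\<phi> \<in> D" "\<And>j. j < k \<Longrightarrow> ip (\<psi> j) \<phi> = 0" "Re (h \<phi> \<phi>) < \<kappa> * Re (ip \<phi> \<phi>)"
  shows "\<exists>E<\<kappa>. \<exists>u\<in>D. (\<forall>j<k. ip (\<psi> j) u = 0) \<and> Re (ip u u) = 1 \<and>
           (\<forall>\<theta>\<in>D. (\<forall>j<k. ip (\<psi> j) \<theta> = 0) \<longrightarrow> h \<theta> u = of_real E * ip \<theta> u)"
proof -
  define M where "M = {x\<in>D. \<forall>j<k. ip (\<psi> j) x = 0}"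
  have MD: "M \<subseteq> D" by (auto simp: M_def)
  have M: "subspace M"
    unfolding M_def using D \<psi>
    by (intro subspaceI)
      (auto simp: subspace_0 subspace_add subspace_scale herm_zero[OF D ip] herm_add[OF D ip] herm_scale[OF D ip])
  note hM = hermitian_on_subset[OF h MD] and ipM = hermitian_on_subset[OF ip MD]
  define X where "X = {Re (h x x) |x. x \<in> M \<and> Re (ip x x) = 1}"
  \<comment> \<open>One scaling factor serves every Hermitian form at once, so that \<open>h\<close>
    and \<open>ip\<close> are normalised together.\<close>
  have norm1: "\<exists>t. t > 0 \<and> (\<forall>f. hermitian_on M f \<longrightarrow> Re (f (of_real t *c x) (of_real t *c x)) = Re (f x x) / Re (ip x x)) \<and>
       Re (ip (of_real t *c x) (of_real t *c x)) = 1"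
    if "x \<in> M" "Re (ip x x) > 0" for x
  proof (intro exI conjI allI impI)
    let ?t = "1 / sqrt (Re (ip x x))"
    show "0 < ?t" using that by simp
    have *: "Re (f (of_real ?t *c x) (of_real ?t *c x)) = Re (f x x) / Re (ip x x)" if "hermitian_on M f" for f
      using herm_scale_scale[OF M that \<open>x \<in> M\<close>, of "of_real ?t"] \<open>Re (ip x x) > 0\<close>
      by (simp add: norm_divide power_divide)
    then show "hermitian_on M f \<Longrightarrow> Re (f (of_real ?t *c x) (of_real ?t *c x)) = Re (f x x) / Re (ip x x)" for f .
    show "Re (ip (of_real ?t *c x) (of_real ?t *c x)) = 1" using *[OF ipM] that by simp
  qed
  have \<phi>M: "\<phi> \<in> M" using \<phi> by (auto simp: M_def)
  \<comment> \<open>A null \<phi> would have \<open>s \<phi> = 0\<close>, hence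
    \<open>h \<phi> \<phi>\<close> with real part 0, which contradicts the strict
    inequality.\<close>
  have \<phi>pos: "Re (ip \<phi> \<phi>) > 0"
  proof (rule ccontr)
    assume "\<not> ?thesis"
    then have z: "Re (ip \<phi> \<phi>) = 0" using ip_nonneg[OF \<phi>(1)] by simp
    then have "s \<phi> = 0" using ip_null \<phi> by simp
    then show False using h_le[OF \<phi>(1)] \<phi>(3) z by simp
  qed
  obtain t where t: "Re (h (of_real t *c \<phi>) (of_real t *c \<phi>)) = Re (h \<phi> \<phi>) / Re (ip \<phi> \<phi>)"
    "Re (ip (of_real t *c \<phi>) (of_real t *c \<phi>)) = 1"
    using norm1[OF \<phi>M \<phi>pos] hM by blast
  then have tX: "Re (h \<phi> \<phi>) / Re (ip \<phi> \<phi>) \<in> X"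
    unfolding X_def using subspace_scale[OF M \<phi>M, of "of_real t"] by force
  \<comment> \<open>Coercivity is used twice, at different levels. Here some fixed level below
    \<kappa> has to do, because \<open>E\<close> is known to be a genuine infimum only after this
    bound; the level \<open>E\<close> itself follows for the minimising sequence.\<close>
  have bdd: "bdd_below X"
  proof -
    obtain c B and m :: nat and l where c: "c > 0"
      and l': "\<forall>j<m. \<forall>x\<in>D. (cmod (l j x))\<^sup>2 \<le> B * Re (ip x x)"
      and co': "\<forall>x\<in>D. c * s x - (\<Sum>j<m. (cmod (l j x))\<^sup>2) \<le> Re (h x x) - (\<kappa> - 1) * Re (ip x x)"
      using coercive[of "\<kappa> - 1"] by auto
    note l = l'[rule_format] and co = co'[rule_format]
    have "(\<kappa> - 1) - m * B \<le> Re (h x x)" if "x \<in> M" "Re (ip x x) = 1" for x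
    proof -
      have x: "x \<in> D" using that MD by auto
      have "(\<Sum>j<m. (cmod (l j x))\<^sup>2) \<le> (\<Sum>j<m. B)"
        using l[OF _ x] that by (intro sum_mono) auto
      moreover have "0 \<le> c * s x" using c s_nonneg[OF x] by simp
      ultimately show ?thesis using co[OF x] that by simp
    qed
    then show ?thesis unfolding X_def by (intro bdd_belowI[of _ "(\<kappa> - 1) - m * B"]) auto
  qed
  define E where "E = Inf X"
  have "E \<le> Re (h \<phi> \<phi>) / Re (ip \<phi> \<phi>)" unfolding E_def by (rule cInf_lower[OF tX bdd])
  also have "\<dots> < \<kappa>" using \<phi>(3) \<phi>pos by (simp add: field_simps)
  finally have E: "E < \<kappa>" .
  define q where "q = (\<lambda>x y. h x y - of_real E * ip x y)"
  have q: "hermitian_on M q" unfolding q_def by (rule hermitian_on_shift[OF hM ipM])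
  have Re_q: "Re (q x x) = Re (h x x) - E * Re (ip x x)" for x by (simp add: q_def)
  have q_pos: "0 \<le> Re (q x x)" if xM: "x \<in> M" for x
  proof (cases "Re (ip x x) = 0")
    case True
    then have "s x = 0" using ip_null xM MD by auto
    then show ?thesis using h_le[of x] xM MD True by (auto simp: Re_q)
  next
    case False
    then have pos: "Re (ip x x) > 0" using ip_nonneg xM MD by fastforce
    obtain t where t: "Re (h (of_real t *c x) (of_real t *c x)) = Re (h x x) / Re (ip x x)"
      "Re (ip (of_real t *c x) (of_real t *c x)) = 1"
      using norm1[OF xM pos] hM by blast
    then have "Re (h x x) / Re (ip x x) \<in> X"
      unfolding X_def using subspace_scale[OF M xM, of "of_real t"] by force
    then have "E \<le> Re (h x x) / Re (ip x x)" unfolding E_def by (rule cInf_lower[OF _ bdd])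
    then show ?thesis using pos by (simp add: Re_q field_simps)
  qed
  have "\<exists>x\<in>M. Re (ip x x) = 1 \<and> Re (q x x) < 1 / real (Suc n)" for n
  proof -
    have "\<exists>v\<in>X. v < E + 1 / real (Suc n)"
      using cInf_lessD[of X "E + 1 / real (Suc n)"] tX by (auto simp: E_def)
    then show ?thesis unfolding X_def by (auto simp: Re_q)
  qed
  then obtain v where v: "\<And>n. v n \<in> M" "\<And>n. Re (ip (v n) (v n)) = 1"
    "\<And>n. Re (q (v n) (v n)) < 1 / real (Suc n)" by metis
  have qv: "(\<lambda>n. Re (q (v n) (v n))) \<longlonglongrightarrow> 0"
  proof (rule tendsto_sandwich[where f = "\<lambda>_. 0" and h = "\<lambda>n. 1 / real (Suc n)"])
    show "(\<lambda>n. 1 / real (Suc n)) \<longlonglongrightarrow> 0" by (rule LIMSEQ_Suc[OF lim_const_over_n[of 1]])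
  qed (use v q_pos[OF v(1)] in \<open>auto intro!: always_eventually less_imp_le\<close>)
  obtain c B and m :: nat and l where c: "c > 0"
    and ldiff': "\<forall>j<m. \<forall>x\<in>D. \<forall>y\<in>D. l j (x - y) = l j x - l j y"
    and l': "\<forall>j<m. \<forall>x\<in>D. (cmod (l j x))\<^sup>2 \<le> B * Re (ip x x)"
    and co': "\<forall>x\<in>D. c * s x - (\<Sum>j<m. (cmod (l j x))\<^sup>2) \<le> Re (q x x)"
    using coercive[OF E] unfolding Re_q by auto
  note ldiff = ldiff'[rule_format] and l = l'[rule_format] and co = co'[rule_format]
  have "bounded (range (\<lambda>n. l j (v n)))" if "j \<in> {..<m}" for j
  proof (rule boundedI)
    fix z assume "z \<in> range (\<lambda>n. l j (v n))"
    then obtain n where "z = l j (v n)" by auto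
    then have "(cmod z)\<^sup>2 \<le> B" using l[of j "v n"] that v MD by auto
    then show "norm z \<le> sqrt B" by (rule real_le_rsqrt)
  qed
  then obtain r a where r: "strict_mono (r :: nat \<Rightarrow> nat)"
    and a: "\<And>j. j < m \<Longrightarrow> (\<lambda>n. l j (v (r n))) \<longlonglongrightarrow> a j"
    using bounded_family_convergent_subseq[of "{..<m}" "\<lambda>n j. l j (v n)"] by auto
  define w where "w n = v (r n)" for n
  have w: "w n \<in> M" "w n \<in> D" "Re (ip (w n) (w n)) = 1" for n
    using v MD by (auto simp: w_def)
  have qw: "(\<lambda>n. Re (q (w n) (w n))) \<longlonglongrightarrow> 0"
    using LIMSEQ_subseq_LIMSEQ[OF qv r] by (simp add: o_def w_def)
  \<comment> \<open>Everything that tends to zero along the sequence: the form values, and the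
    distances of the functionals from their limits. The factors 2 come from comparing two members of
    the sequence through the common limits \<open>a j\<close>.\<close>
  define g where "g n = 2 * Re (q (w n) (w n)) + (\<Sum>j<m. 2 * (cmod (l j (w n) - a j))\<^sup>2)" for n
  have "(\<lambda>n. (cmod (l j (w n) - a j))\<^sup>2) \<longlonglongrightarrow> 0" if "j < m" for j
  proof -
    have "(\<lambda>n. l j (w n) - a j) \<longlonglongrightarrow> a j - a j"
      unfolding w_def by (intro tendsto_diff a[OF that] tendsto_const)
    from tendsto_power[OF tendsto_norm[OF this], of 2] show ?thesis by simp
  qed
  then have "g \<longlonglongrightarrow> 2 * 0 + (\<Sum>j<m. 2 * 0)"
    unfolding g_def[abs_def] by (intro tendsto_intros qw) auto
  then have g: "g \<longlonglongrightarrow> 0" by simp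
  have cauchy: "c * s (w i - w n) \<le> g i + g n" for i n
  proof -
    have d: "w i - w n \<in> D" using w D by (auto intro: subspace_diff)
    have "(cmod (l j (w i - w n)))\<^sup>2 \<le> 2 * (cmod (l j (w i) - a j))\<^sup>2 + 2 * (cmod (l j (w n) - a j))\<^sup>2"
      if "j < m" for j
    proof -
      have "cmod (l j (w i - w n)) \<le> cmod (l j (w i) - a j) + cmod (l j (w n) - a j)"
        using norm_triangle_ineq4[of "l j (w i) - a j" "l j (w n) - a j"] ldiff[OF that w(2) w(2)]
        by simp
      then have "(cmod (l j (w i - w n)))\<^sup>2 \<le> (cmod (l j (w i) - a j) + cmod (l j (w n) - a j))\<^sup>2"
        by (intro power_mono) auto
      also have "\<dots> \<le> 2 * (cmod (l j (w i) - a j))\<^sup>2 + 2 * (cmod (l j (w n) - a j))\<^sup>2"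
        using sum_squares_bound[of "cmod (l j (w i) - a j)" "cmod (l j (w n) - a j)"]
        by (simp add: power2_sum)
      finally show ?thesis .
    qed
    then have "(\<Sum>j<m. (cmod (l j (w i - w n)))\<^sup>2)
        \<le> (\<Sum>j<m. 2 * (cmod (l j (w i) - a j))\<^sup>2 + 2 * (cmod (l j (w n) - a j))\<^sup>2)"
      by (intro sum_mono) auto
    then show ?thesis
      using co[OF d] herm_diff_le[OF M q q_pos w(1) w(1), of i n]
      unfolding g_def by (simp add: sum.distrib)
  qed
  have "\<exists>n0. \<forall>i\<ge>n0. \<forall>n\<ge>n0. s (w i - w n) < \<epsilon>" if "\<epsilon> > 0" for \<epsilon>
  proof -
    have "\<forall>\<^sub>F n in sequentially. g n < c * \<epsilon> / 2"
      using order_tendstoD(2)[OF g, of "c * \<epsilon> / 2"] c that by simp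
    then obtain n0 where n0: "\<And>n. n \<ge> n0 \<Longrightarrow> g n < c * \<epsilon> / 2"
      by (auto simp: eventually_sequentially)
    have "s (w i - w n) < \<epsilon>" if "i \<ge> n0" "n \<ge> n0" for i n
    proof -
      have "c * s (w i - w n) < c * \<epsilon>" using cauchy[of i n] n0[OF that(1)] n0[OF that(2)] by simp
      then show ?thesis using c by simp
    qed
    then show ?thesis by blast
  qed
  then obtain u where u: "u \<in> D" "(\<lambda>n. s (w n - u)) \<longlonglongrightarrow> 0"
    using complete[of w] w by blast
  have wu: "w n - u \<in> D" for n using w u D by (auto intro: subspace_diff)
  have ipwu: "(\<lambda>n. Re (ip (w n - u) (w n - u))) \<longlonglongrightarrow> 0"
    by (rule tendsto_sandwich[OF _ _ tendsto_const u(2)]) (simp_all add: ip_nonneg[OF wu] ip_le[OF wu])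
  have uM: "u \<in> M"
  proof -
    have "ip (\<psi> j) u = 0" if "j < k" for j
    proof -
      have "(cmod (ip (\<psi> j) u))\<^sup>2 \<le> Re (ip (\<psi> j) (\<psi> j)) * Re (ip (w n - u) (w n - u))" for n
      proof -
        have "ip (\<psi> j) (w n - u) = - ip (\<psi> j) u"
          using herm_diff[OF D ip \<psi>[OF that] w(2) u(1)] w(1)[of n] that by (auto simp: M_def)
        then show ?thesis
          using herm_Cauchy_Schwarz[OF D ip ip_nonneg \<psi>[OF that] wu, of n] by simp
      qed
      moreover have "(\<lambda>n. Re (ip (\<psi> j) (\<psi> j)) * Re (ip (w n - u) (w n - u))) \<longlonglongrightarrow> Re (ip (\<psi> j) (\<psi> j)) * 0"
        by (intro tendsto_intros ipwu)
      ultimately have "(cmod (ip (\<psi> j) u))\<^sup>2 \<le> 0"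
        by (intro LIMSEQ_le_const[where X = "\<lambda>n. Re (ip (\<psi> j) (\<psi> j)) * Re (ip (w n - u) (w n - u))"]) auto
      then show ?thesis by simp
    qed
    then show ?thesis using u by (auto simp: M_def)
  qed
  \<comment> \<open>In place of continuity of \<open>q\<close>: u is written as
    \<open>w n - (w n - u)\<close>, and \<open>herm_diff_le\<close> bounds its form value by two
    terms that tend to zero.\<close>
  have qu: "Re (q u u) = 0"
  proof -
    have le: "Re (q u u) \<le> 2 * Re (q (w n) (w n)) + 2 * (C + \<bar>E\<bar>) * s (w n - u)" for n
    proof -
      have wuM: "w n - u \<in> M" using w uM M by (auto intro: subspace_diff)
      have "Re (q u u) \<le> 2 * Re (q (w n) (w n)) + 2 * Re (q (w n - u) (w n - u))"
        using herm_diff_le[OF M q q_pos w(1) wuM, of n] by simp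
      moreover have "Re (q (w n - u) (w n - u)) \<le> (C + \<bar>E\<bar>) * s (w n - u)"
      proof -
        have "- E * Re (ip (w n - u) (w n - u)) \<le> \<bar>E\<bar> * Re (ip (w n - u) (w n - u))"
          by (intro mult_right_mono ip_nonneg[OF wu]) auto
        also have "\<dots> \<le> \<bar>E\<bar> * s (w n - u)"
          by (intro mult_left_mono ip_le[OF wu]) auto
        finally show ?thesis using h_le[OF wu, of n] by (simp add: Re_q algebra_simps)
      qed
      ultimately show ?thesis unfolding mult.assoc by linarith
    qed
    have "(\<lambda>n. 2 * Re (q (w n) (w n)) + 2 * (C + \<bar>E\<bar>) * s (w n - u)) \<longlonglongrightarrow> 2 * 0 + 2 * (C + \<bar>E\<bar>) * 0"
      by (intro tendsto_intros qw u)
    then have "Re (q u u) \<le> 0"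
      using le by (intro LIMSEQ_le_const[where X = "\<lambda>n. 2 * Re (q (w n) (w n)) + 2 * (C + \<bar>E\<bar>) * s (w n - u)"]) auto
    then show ?thesis using q_pos[OF uM] by simp
  qed
  \<comment> \<open>The norm does not get lost in the limit: a null u would force
    \<open>1 = Re (ip (w n) (w n))\<close> below twice a null sequence.\<close>
  have upos: "Re (ip u u) > 0"
  proof (rule ccontr)
    assume "\<not> ?thesis"
    then have z: "Re (ip u u) = 0" using ip_nonneg[OF u(1)] by simp
    have "1 \<le> 2 * Re (ip (w n - u) (w n - u))" for n
    proof -
      have m: "- u \<in> D" using D u by (auto intro: subspace_neg)
      have "Re (ip (- u) (- u)) = Re (ip u u)"
        using herm_scale_scale[OF D ip u(1), of "-1"] by simp
      then show ?thesis
        using herm_diff_le[OF D ip ip_nonneg wu m, of n] w(3)[of n] z by simp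
    qed
    then have "1 \<le> 2 * (0::real)"
      by (intro LIMSEQ_le_const[OF tendsto_mult[OF tendsto_const ipwu]]) blast
    then show False by simp
  qed
  \<comment> \<open>The limit is rescaled to norm one; nullity for \<open>q\<close> and the
    constraints are preserved by scaling.\<close>
  obtain t where t: "t > 0" "Re (ip (of_real t *c u) (of_real t *c u)) = 1"
    using norm1[OF uM upos] by blast
  let ?u = "of_real t *c u"
  have uM': "?u \<in> M" using M uM by (rule subspace_scale)
  have EL: "h \<theta> ?u = of_real E * ip \<theta> ?u" if "\<theta> \<in> M" for \<theta>
  proof -
    have "Re (q ?u ?u) = 0" using herm_scale_scale[OF M q uM, of "of_real t"] qu by simp
    then have "(cmod (q \<theta> ?u))\<^sup>2 \<le> 0"
      using herm_Cauchy_Schwarz[OF M q q_pos that uM'] by simp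
    then show ?thesis by (simp add: q_def)
  qed
  show ?thesis
    using E t uM' EL unfolding M_def by blast
qed

text \<open>With k eigenvectors at hand, the k orthogonality conditions on a combination of more
  than k trial vectors have a non-trivial solution, and \<open>neg\<close> makes this combination
  admissible for the next minimisation.\<close>

lemma orthonormal_eigenvectors:
  assumes \<phi>: "\<And>m. m \<in> I \<Longrightarrow> \<phi> m \<in> D" and I: "finite I"
    and neg: "\<And>\<xi>. (\<exists>m\<in>I. \<xi> m \<noteq> 0) \<Longrightarrow>
       Re (h (\<Sum>m\<in>I. \<xi> m *c \<phi> m) (\<Sum>m\<in>I. \<xi> m *c \<phi> m))
         < \<kappa> * Re (ip (\<Sum>m\<in>I. \<xi> m *c \<phi> m) (\<Sum>m\<in>I. \<xi> m *c \<phi> m))"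
    and k: "k \<le> card I"
  shows "\<exists>\<psi> E. (\<forall>j<k. \<psi> j \<in> D \<and> E j < \<kappa> \<and> (\<forall>\<theta>\<in>D. h \<theta> (\<psi> j) = of_real (E j) * ip \<theta> (\<psi> j))) \<and>
      (\<forall>i<k. \<forall>j<k. ip (\<psi> i) (\<psi> j) = (if i = j then 1 else 0))"
  using k
proof (induction k)
  case 0
  show ?case by simp
next
  case (Suc k)
  then obtain \<psi> E where IH: "\<forall>j<k. \<psi> j \<in> D \<and> E j < \<kappa> \<and> (\<forall>\<theta>\<in>D. h \<theta> (\<psi> j) = of_real (E j) * ip \<theta> (\<psi> j))"
    and on': "\<forall>i<k. \<forall>j<k. ip (\<psi> i) (\<psi> j) = (if i = j then 1 else 0)"
    by auto
  have \<psi>: "\<And>j. j < k \<Longrightarrow> \<psi> j \<in> D" "\<And>j. j < k \<Longrightarrow> E j < \<kappa>"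
    and eig: "\<And>j \<theta>. j < k \<Longrightarrow> \<theta> \<in> D \<Longrightarrow> h \<theta> (\<psi> j) = of_real (E j) * ip \<theta> (\<psi> j)"
    using IH by blast+
  note on = on'[rule_format]
  obtain \<xi> where \<xi>: "\<exists>i\<in>I. \<xi> i \<noteq> 0" "\<And>j. j < k \<Longrightarrow> (\<Sum>i\<in>I. ip (\<psi> j) (\<phi> i) * \<xi> i) = 0"
    using underdetermined_system[OF I, of k "\<lambda>j i. ip (\<psi> j) (\<phi> i)"] Suc.prems by auto
  let ?x = "\<Sum>m\<in>I. \<xi> m *c \<phi> m"
  have xD: "?x \<in> D" by (intro subspace_sum[OF D] subspace_scale[OF D] \<phi>)
  have "ip (\<psi> j) ?x = 0" if "j < k" for j
  proof -
    have "ip (\<psi> j) ?x = (\<Sum>m\<in>I. ip (\<psi> j) (\<xi> m *c \<phi> m))"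
      by (rule herm_sum[OF D ip I \<psi>(1)[OF that]]) (auto intro: subspace_scale[OF D] \<phi>)
    also have "\<dots> = (\<Sum>m\<in>I. ip (\<psi> j) (\<phi> m) * \<xi> m)"
      by (intro sum.cong) (auto simp: herm_scale[OF D ip \<psi>(1)[OF that]] \<phi>)
    finally show ?thesis using \<xi>(2)[OF that] by simp
  qed
  from minimizer_exists[of k \<psi> ?x, OF \<psi>(1) xD this neg[OF \<xi>(1)]]
  obtain E' u where u: "E' < \<kappa>" "u \<in> D" "\<And>j. j < k \<Longrightarrow> ip (\<psi> j) u = 0" "Re (ip u u) = 1"
    and EL: "\<And>\<theta>. \<theta> \<in> D \<Longrightarrow> (\<And>j. j < k \<Longrightarrow> ip (\<psi> j) \<theta> = 0) \<Longrightarrow> h \<theta> u = of_real E' * ip \<theta> u"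
    by blast
  have u1: "ip u u = 1" using herm_real[OF D ip u(2)] u(4) by simp
  have u0: "ip u (\<psi> j) = 0" if "j < k" for j
    using herm_sym[OF D ip \<psi>(1)[OF that] u(2)] u(3)[OF that] by simp
  have u0h: "h (\<psi> j) u = 0" if "j < k" for j
    using herm_sym[OF D h u(2) \<psi>(1)[OF that]] eig[OF that u(2)] u0[OF that] by simp
  \<comment> \<open>\<open>EL\<close> covers only vectors orthogonal to the earlier \<psi>. A
    general \<theta> differs from such a vector by its projection \<open>?p\<close>, and
    \<open>?p\<close> is invisible to u in both forms: for \<open>ip\<close> by orthogonality, for
    \<open>h\<close> because each \<open>\<psi> j\<close> is an eigenvector orthogonal to u.\<close>
  have eig': "h \<theta> u = of_real E' * ip \<theta> u" if \<theta>: "\<theta> \<in> D" for \<theta>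
  proof -
    let ?p = "\<Sum>j<k. ip (\<psi> j) \<theta> *c \<psi> j"
    have pD: "?p \<in> D" by (intro subspace_sum[OF D] subspace_scale[OF D] \<psi>) auto
    have "ip (\<psi> i) (\<theta> - ?p) = 0" if i: "i < k" for i
    proof -
      have "ip (\<psi> i) ?p = (\<Sum>j<k. ip (\<psi> i) (ip (\<psi> j) \<theta> *c \<psi> j))"
        by (rule herm_sum[OF D ip _ \<psi>(1)[OF i]]) (auto intro: subspace_scale[OF D] \<psi>)
      also have "\<dots> = (\<Sum>j<k. ip (\<psi> j) \<theta> * (if i = j then 1 else 0))"
        by (intro sum.cong) (auto simp: herm_scale[OF D ip \<psi>(1)[OF i]] \<psi> on i)
      also have "\<dots> = ip (\<psi> i) \<theta>" using i by (simp add: if_distrib cong: if_cong)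
      finally show ?thesis using herm_diff[OF D ip \<psi>(1)[OF i] \<theta> pD] by simp
    qed
    then have 1: "h (\<theta> - ?p) u = of_real E' * ip (\<theta> - ?p) u"
      using subspace_diff[OF D \<theta> pD] by (intro EL) auto
    have 2: "f ?p u = 0" if f: "hermitian_on D f" and z: "\<And>j. j < k \<Longrightarrow> f (\<psi> j) u = 0" for f
    proof -
      have "f u ?p = (\<Sum>j<k. f u (ip (\<psi> j) \<theta> *c \<psi> j))"
        by (rule herm_sum[OF D f _ u(2)]) (auto intro: subspace_scale[OF D] \<psi>)
      also have "\<dots> = 0"
        using herm_sym[OF D f \<psi>(1) u(2)] z by (intro sum.neutral) (auto simp: herm_scale[OF D f u(2)] \<psi>)
      finally show ?thesis using herm_sym[OF D f u(2) pD] by simp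
    qed
    have 3: "f (\<theta> - ?p) u = f \<theta> u" if f: "hermitian_on D f" and z: "\<And>j. j < k \<Longrightarrow> f (\<psi> j) u = 0" for f
      using herm_add_left[OF D f u(2) subspace_diff[OF D \<theta> pD] pD] 2[OF that] by simp
    show ?thesis using 1 3[OF h u0h] 3[OF ip u(3)] by simp
  qed
  have new: "(\<psi>(k := u)) j \<in> D \<and> (E(k := E')) j < \<kappa> \<and>
      (\<forall>\<theta>\<in>D. h \<theta> ((\<psi>(k := u)) j) = of_real ((E(k := E')) j) * ip \<theta> ((\<psi>(k := u)) j))"
    if "j < Suc k" for j
    using \<psi>[of j] u(1,2) eig[of j] eig' that by (cases "j = k") simp_all
  have "ip ((\<psi>(k := u)) i) ((\<psi>(k := u)) j) = (if i = j then 1 else 0)"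
    if "i < Suc k" "j < Suc k" for i j
    using on[of i j] u(3)[of i] u0[of j] u1 that by (cases "i = k"; cases "j = k") simp_all
  then show ?case using new by blast
qed

end

text \<open>The count sums multiplicities over distinct values, whereas the \<psi> are listed with
  repeated values of \<open>E\<close>. The list is therefore cut into the fibres of
  \<open>E\<close>: each fibre is an independent family in one eigenspace, and the fibre sizes add
  up to N.\<close>

lemma orthonormal_eigen_count:
  fixes \<psi> :: "nat \<Rightarrow> plane \<Rightarrow> spinor" and E :: "nat \<Rightarrow> real"
  assumes mem: "\<And>j. j < N \<Longrightarrow> \<psi> j \<in> eigenspace T (E j)" and E: "\<And>j. j < N \<Longrightarrow> E j < b"
    and indep: "L2_independent N \<psi>"
  shows "enat N \<le> eigen_count_below T b"
proof -
  define F where "F = E ` {..<N}"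
  have mult: "enat (card {j. j < N \<and> E j = e}) \<le> eigen_mult T e" for e
  proof -
    define J where "J = {j. j < N \<and> E j = e}"
    have fJ: "finite J" by (auto simp: J_def)
    obtain f where f: "bij_betw f {..<card J} J"
      using ex_bij_betw_nat_finite[OF fJ] by (auto simp: lessThan_atLeast0)
    have fJ': "f i < N" "E (f i) = e" if "i < card J" for i
      using bij_betwE[OF f] that by (auto simp: J_def)
    have "L2_independent (card J) (\<lambda>i. \<psi> (f i))"
      unfolding L2_independent_def
    proof (intro allI impI)
      fix c :: "nat \<Rightarrow> complex" and i
      assume ae: "AE x in lebesgue. (\<Sum>j<card J. c j *s \<psi> (f j) x) = 0" and i: "i < card J"
      \<comment> \<open>A linear relation on one fibre becomes a relation on the whole list after
        extension by zero.\<close>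
      define g where "g = inv_into {..<card J} f"
      define d where "d j = (if j \<in> J then c (g j) else 0)" for j
      have gf: "g (f i) = i" if "i < card J" for i
        unfolding g_def using f that by (auto simp: bij_betw_def intro: inv_into_f_f)
      have "(\<Sum>j<N. d j *s \<psi> j x) = (\<Sum>j<card J. c j *s \<psi> (f j) x)" for x
      proof -
        have "(\<Sum>j<N. d j *s \<psi> j x) = (\<Sum>j\<in>J. d j *s \<psi> j x)"
          by (intro sum.mono_neutral_right) (auto simp: J_def d_def)
        also have "\<dots> = (\<Sum>i<card J. d (f i) *s \<psi> (f i) x)"
          by (rule sum.reindex_bij_betw[OF f, symmetric])
        also have "\<dots> = (\<Sum>i<card J. c i *s \<psi> (f i) x)"
          using bij_betwE[OF f] by (intro sum.cong) (auto simp: d_def gf)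
        finally show ?thesis .
      qed
      then have "\<forall>j<N. d j = 0" using indep ae unfolding L2_independent_def by simp
      then have "d (f i) = 0" using fJ'[OF i] by simp
      then show "c i = 0" using bij_betwE[OF f] i by (auto simp: d_def gf)
    qed
    moreover have "\<forall>i<card J. \<psi> (f i) \<in> eigenspace T e"
      using mem fJ' by metis
    ultimately have "enat (card J) \<in> {enat n |n. \<exists>\<psi>. (\<forall>j<n. \<psi> j \<in> eigenspace T e) \<and> L2_independent n \<psi>}"
      by (intro CollectI exI[of _ "card J"] conjI refl exI[of _ "\<lambda>i. \<psi> (f i)"])
    then show ?thesis
      unfolding eigen_mult_def J_def[symmetric] by (rule Sup_upper)
  qed
  have "N = card (\<Union>e\<in>F. {j. j < N \<and> E j = e})"
  proof -
    have "(\<Union>e\<in>F. {j. j < N \<and> E j = e}) = {..<N}" by (auto simp: F_def)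
    then show ?thesis by (simp only: card_lessThan)
  qed
  also have "\<dots> = (\<Sum>e\<in>F. card {j. j < N \<and> E j = e})"
    by (rule card_UN_disjoint) (auto simp: F_def)
  finally have "N = (\<Sum>e\<in>F. card {j. j < N \<and> E j = e})" .
  then have "enat N = (\<Sum>e\<in>F. enat (card {j. j < N \<and> E j = e}))"
    by (simp only: of_nat_eq_enat[symmetric] of_nat_sum[symmetric])
  also have "\<dots> \<le> (\<Sum>e\<in>F. eigen_mult T e)"
    by (intro sum_mono mult)
  also have "\<dots> \<le> eigen_count_below T b"
    unfolding eigen_count_below_def using E by (intro SUP_upper) (auto simp: F_def)
  finally show ?thesis .
qed

section \<open>Square-integrable functions\<close>

text \<open>Meaningful on \<open>L2\<close> only: the integral of a function that is not integrable
  has the default value 0, so that smallness of \<open>l2sq\<close> says nothing without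
  membership.\<close>

definition l2sq :: "(plane \<Rightarrow> 'b::euclidean_space) \<Rightarrow> real" where
  "l2sq f = (LINT x|lebesgue. (norm (f x))\<^sup>2)"

lemma L2_measurable: "f \<in> L2 \<Longrightarrow> f \<in> borel_measurable lebesgue"
  unfolding L2_def by blast

lemma L2_integrable: "f \<in> L2 \<Longrightarrow> integrable lebesgue (\<lambda>x. (norm (f x))\<^sup>2)"
  unfolding L2_def by blast

lemma borel_imp_lebesgue_measurable:
  "f \<in> borel_measurable borel \<Longrightarrow> f \<in> borel_measurable lebesgue"
  by (rule measurable_completion) (simp only: measurable_lborel2)

lemma continuous_imp_lebesgue_measurable:
  "continuous_on UNIV f \<Longrightarrow> f \<in> borel_measurable lebesgue"
  by (intro borel_imp_lebesgue_measurable borel_measurable_continuous_onI)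

lemma norm_add_sq_le: "(norm (a + b))\<^sup>2 \<le> 2 * (norm a)\<^sup>2 + 2 * (norm (b::'b::real_normed_vector))\<^sup>2"
proof -
  have "(norm (a + b))\<^sup>2 \<le> (norm a + norm b)\<^sup>2"
    by (intro power_mono norm_triangle_ineq) auto
  also have "\<dots> \<le> 2 * (norm a)\<^sup>2 + 2 * (norm b)\<^sup>2"
    using sum_squares_bound[of "norm a" "norm b"] by (simp add: power2_sum)
  finally show ?thesis .
qed

lemma L2I:
  assumes "f \<in> borel_measurable lebesgue" "integrable lebesgue w" "AE x in lebesgue. (norm (f x))\<^sup>2 \<le> w x"
  shows "f \<in> L2"
proof -
  have "integrable lebesgue (\<lambda>x. (norm (f x))\<^sup>2)"
    using assms by (intro Bochner_Integration.integrable_bound[OF assms(2)]) auto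
  then show ?thesis using assms by (simp add: L2_def)
qed

lemma L2_add:
  assumes f: "f \<in> L2" and g: "g \<in> L2" shows "(\<lambda>x. f x + g x) \<in> L2"
proof (rule L2I[where w = "\<lambda>x. 2 * (norm (f x))\<^sup>2 + 2 * (norm (g x))\<^sup>2"])
  note [measurable] = L2_measurable[OF f] L2_measurable[OF g]
  show "(\<lambda>x. f x + g x) \<in> borel_measurable lebesgue" by measurable
  show "integrable lebesgue (\<lambda>x. 2 * (norm (f x))\<^sup>2 + 2 * (norm (g x))\<^sup>2)"
    using f g by (simp add: L2_integrable)
qed (simp add: norm_add_sq_le)

lemma l2sq_add_le:
  assumes f: "f \<in> L2" and g: "g \<in> L2"
  shows "l2sq (\<lambda>x. f x + g x) \<le> 2 * l2sq f + 2 * l2sq g"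
proof -
  have "l2sq (\<lambda>x. f x + g x) \<le> (LINT x|lebesgue. 2 * (norm (f x))\<^sup>2 + 2 * (norm (g x))\<^sup>2)"
    unfolding l2sq_def using f g L2_add[OF f g]
    by (intro integral_mono norm_add_sq_le) (simp_all add: L2_integrable)
  then show ?thesis using L2_integrable[OF f] L2_integrable[OF g] by (simp add: l2sq_def)
qed

lemma L2_minus: "f \<in> L2 \<Longrightarrow> (\<lambda>x. - f x) \<in> L2"
  by (auto simp: L2_def)

lemma l2sq_commute: "l2sq (\<lambda>x. f x - g x) = l2sq (\<lambda>x. g x - f x)"
  by (simp add: l2sq_def norm_minus_commute)

lemma L2_diff: "f \<in> L2 \<Longrightarrow> g \<in> L2 \<Longrightarrow> (\<lambda>x. f x - g x) \<in> L2"
  using L2_add[OF _ L2_minus, of f g] by simp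

lemma l2sq_triangle:
  assumes "f \<in> L2" "g \<in> L2" "h \<in> L2"
  shows "l2sq (\<lambda>x. f x - h x) \<le> 2 * l2sq (\<lambda>x. f x - g x) + 2 * l2sq (\<lambda>x. g x - h x)"
  using l2sq_add_le[OF L2_diff[OF assms(1,2)] L2_diff[OF assms(2,3)]] by simp

lemma L2_mult: "f \<in> L2 \<Longrightarrow> (\<lambda>x. c * f x :: complex) \<in> L2"
  by (auto simp: L2_def norm_mult power_mult_distrib)

lemma l2sq_mult: "l2sq (\<lambda>x. c * f x :: complex) = (cmod c)\<^sup>2 * l2sq f"
  by (simp add: l2sq_def norm_mult power_mult_distrib)

lemma L2_zero: "(\<lambda>x. 0) \<in> L2" by (simp add: L2_def)

lemma L2_cong_AE:
  assumes "f \<in> L2" "AE x in lebesgue. f x = g x" shows "g \<in> L2"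
proof -
  have g: "g \<in> borel_measurable lebesgue"
    using borel_measurable_AE[OF L2_measurable[OF assms(1)] assms(2)] .
  show ?thesis
    by (rule L2I[OF g L2_integrable[OF assms(1)]]) (use assms(2) in auto)
qed

lemma l2sq_nonneg: "0 \<le> l2sq f" by (simp add: l2sq_def)

lemma l2sq_cong_AE:
  assumes "f \<in> L2" "AE x in lebesgue. f x = g x" shows "l2sq f = l2sq g"
  unfolding l2sq_def
  by (rule integral_cong_AE) (use assms L2_cong_AE[OF assms] in \<open>auto dest: L2_measurable\<close>)

lemma l2sq_eq_0_iff:
  assumes "f \<in> L2" shows "l2sq f = 0 \<longleftrightarrow> (AE x in lebesgue. f x = 0)"
  unfolding l2sq_def
  using integral_nonneg_eq_0_iff_AE[OF L2_integrable[OF assms]] by simp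

lemma nn_integral_l2sq:
  assumes "f \<in> L2" shows "(\<integral>\<^sup>+x. ennreal ((norm (f x))\<^sup>2) \<partial>lebesgue) = ennreal (l2sq f)"
  unfolding l2sq_def by (rule nn_integral_eq_integral[OF L2_integrable[OF assms]]) auto

lemma L2_tendsto_iff:
  assumes "\<And>n. u n \<in> L2" "f \<in> L2"
  shows "L2_tendsto u f \<longleftrightarrow> (\<lambda>n. l2sq (\<lambda>x. u n x - f x)) \<longlonglongrightarrow> 0"
  unfolding L2_tendsto_def
proof (subst nn_integral_l2sq[OF L2_diff[OF assms]])
  have "\<forall>\<^sub>F n in sequentially. 0 \<le> l2sq (\<lambda>x. u n x - f x)" by (simp add: l2sq_nonneg)
  from tendsto_ennreal_iff[OF this order_refl]
  show "(\<lambda>n. ennreal (l2sq (\<lambda>x. u n x - f x))) \<longlonglongrightarrow> 0 \<longleftrightarrow> (\<lambda>n. l2sq (\<lambda>x. u n x - f x)) \<longlonglongrightarrow> 0"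
    by simp
qed

lemma L2_product_integrable:
  fixes f g :: "plane \<Rightarrow> 'b::euclidean_space"
  assumes f: "f \<in> L2" and g: "g \<in> L2"
  shows "integrable lebesgue (\<lambda>x. norm (f x) * norm (g x))"
proof (rule Bochner_Integration.integrable_bound)
  note [measurable] = L2_measurable[OF f] L2_measurable[OF g]
  show "integrable lebesgue (\<lambda>x. (norm (f x))\<^sup>2 + (norm (g x))\<^sup>2)"
    using f g by (simp add: L2_integrable)
  show "(\<lambda>x. norm (f x) * norm (g x)) \<in> borel_measurable lebesgue" by measurable
  show "AE x in lebesgue. norm (norm (f x) * norm (g x)) \<le> norm ((norm (f x))\<^sup>2 + (norm (g x))\<^sup>2)"
  proof (intro AE_I2)
    fix x
    have "2 * (norm (f x) * norm (g x)) \<le> (norm (f x))\<^sup>2 + (norm (g x))\<^sup>2"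
      using sum_squares_bound[of "norm (f x)" "norm (g x)"] by simp
    moreover have "0 \<le> norm (f x) * norm (g x)" by simp
    ultimately have "norm (f x) * norm (g x) \<le> (norm (f x))\<^sup>2 + (norm (g x))\<^sup>2" by linarith
    then show "norm (norm (f x) * norm (g x)) \<le> norm ((norm (f x))\<^sup>2 + (norm (g x))\<^sup>2)" by simp
  qed
qed

lemma L2_Cauchy_Schwarz:
  fixes f g :: "plane \<Rightarrow> 'b::euclidean_space"
  assumes f: "f \<in> L2" and g: "g \<in> L2"
  shows "(LINT x|lebesgue. norm (f x) * norm (g x))\<^sup>2 \<le> l2sq f * l2sq g"
proof -
  define P where "P = (LINT x|lebesgue. norm (f x) * norm (g x))"
  have quad: "0 \<le> l2sq f - 2 * t * P + t\<^sup>2 * l2sq g" for t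
  proof -
    have "0 \<le> (LINT x|lebesgue. (norm (f x) - t * norm (g x))\<^sup>2)" by simp
    also have "\<dots> = (LINT x|lebesgue. ((norm (f x))\<^sup>2 - 2 * t * (norm (f x) * norm (g x))) + t\<^sup>2 * (norm (g x))\<^sup>2)"
      by (intro Bochner_Integration.integral_cong) (auto simp: power2_diff power_mult_distrib)
    also have "\<dots> = l2sq f - 2 * t * P + t\<^sup>2 * l2sq g"
      using L2_integrable[OF f] L2_integrable[OF g] L2_product_integrable[OF f g]
      by (simp add: l2sq_def P_def)
    finally show ?thesis .
  qed
  show ?thesis
  proof (cases "l2sq g = 0")
    case True
    have "P = 0"
    proof (rule ccontr)
      assume "P \<noteq> 0"
      then show False using quad[of "(l2sq f + 1) / (2 * P)"] True by simp
    qed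
    then show ?thesis using True by (simp add: P_def)
  next
    case False
    then have pos: "l2sq g > 0" using l2sq_nonneg[of g] by simp
    have "0 \<le> l2sq f - P\<^sup>2 / l2sq g"
      using quad[of "P / l2sq g"] pos by (simp add: power2_eq_square field_simps)
    then show ?thesis using pos by (simp add: P_def field_simps)
  qed
qed

lemma L2_CS_sqrt:
  fixes f g :: "plane \<Rightarrow> 'b::euclidean_space"
  assumes f: "f \<in> L2" and g: "g \<in> L2"
  shows "(LINT x|lebesgue. norm (f x) * norm (g x)) \<le> sqrt (l2sq f) * sqrt (l2sq g)"
  using real_le_rsqrt[OF L2_Cauchy_Schwarz[OF assms]] by (simp add: real_sqrt_mult)

section \<open>The complex inner product of scalar functions\<close>

definition ip2 :: "(plane \<Rightarrow> complex) \<Rightarrow> (plane \<Rightarrow> complex) \<Rightarrow> complex" where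
  "ip2 f g = (LINT x|lebesgue. cnj (f x) * g x)"

lemma measurable_cnj[measurable]: "f \<in> borel_measurable M \<Longrightarrow> (\<lambda>x. cnj (f x)) \<in> borel_measurable M"
  by (rule borel_measurable_continuous_on[OF continuous_on_cnj[OF continuous_on_id]])

lemma ip2_integrable:
  assumes f: "f \<in> L2" and g: "g \<in> L2" shows "integrable lebesgue (\<lambda>x. cnj (f x) * g x)"
proof (rule Bochner_Integration.integrable_bound[OF L2_product_integrable[OF assms]])
  note [measurable] = L2_measurable[OF f] L2_measurable[OF g]
  show "(\<lambda>x. cnj (f x) * g x) \<in> borel_measurable lebesgue" by measurable
qed (simp add: norm_mult)

lemma ip2_le: 
  assumes f: "f \<in> L2" and g: "g \<in> L2" shows "cmod (ip2 f g) \<le> sqrt (l2sq f) * sqrt (l2sq g)"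
proof -
  have "cmod (ip2 f g) \<le> (LINT x|lebesgue. norm (f x) * norm (g x))"
    unfolding ip2_def
    by (rule order.trans[OF integral_norm_bound]) (simp add: norm_mult)
  then show ?thesis using L2_CS_sqrt[OF assms] by simp
qed

lemma ip2_self: "f \<in> L2 \<Longrightarrow> ip2 f f = of_real (l2sq f)"
proof -
  have "(\<lambda>x. cnj (f x) * f x) = (\<lambda>x. of_real ((cmod (f x))\<^sup>2))"
    by (simp only: complex_norm_square) (simp add: mult.commute)
  then show ?thesis unfolding ip2_def l2sq_def by (simp only: integral_complex_of_real)
qed

lemma ip2_commute: "f \<in> L2 \<Longrightarrow> g \<in> L2 \<Longrightarrow> ip2 g f = cnj (ip2 f g)"
proof -
  assume "f \<in> L2" "g \<in> L2"
  then have "cnj (ip2 f g) = (LINT x|lebesgue. cnj (cnj (f x) * g x))"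
    unfolding ip2_def by (intro integral_bounded_linear[OF bounded_linear_cnj, symmetric] ip2_integrable)
  then show ?thesis by (simp add: ip2_def mult.commute)
qed

lemma ip2_diff_right: "f \<in> L2 \<Longrightarrow> g \<in> L2 \<Longrightarrow> h \<in> L2 \<Longrightarrow> ip2 f (\<lambda>x. g x - h x) = ip2 f g - ip2 f h"
  using Bochner_Integration.integral_diff[OF ip2_integrable[of f g] ip2_integrable[of f h]]
  by (simp add: ip2_def right_diff_distrib)

lemma ip2_diff_left: "f \<in> L2 \<Longrightarrow> g \<in> L2 \<Longrightarrow> h \<in> L2 \<Longrightarrow> ip2 (\<lambda>x. g x - h x) f = ip2 g f - ip2 h f"
  using Bochner_Integration.integral_diff[OF ip2_integrable[of g f] ip2_integrable[of h f]]
  by (simp add: ip2_def left_diff_distrib)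

lemma l2sq_diff_expand:
  assumes f: "f \<in> L2" and g: "g \<in> L2"
  shows "l2sq (\<lambda>x. f x - g x :: complex) = l2sq f + l2sq g - 2 * Re (ip2 f g)"
proof -
  have d: "(\<lambda>x. f x - g x) \<in> L2" by (rule L2_diff[OF assms])
  have "complex_of_real (l2sq (\<lambda>x. f x - g x)) = ip2 f f - ip2 g f - (ip2 f g - ip2 g g)"
    using assms d by (simp add: ip2_self[symmetric] ip2_diff_left ip2_diff_right)
  then have "complex_of_real (l2sq (\<lambda>x. f x - g x)) = of_real (l2sq f) + of_real (l2sq g) - (ip2 f g + cnj (ip2 f g))"
    using assms by (simp add: ip2_self ip2_commute[OF f g])
  then show ?thesis by (simp add: complex_eq_iff)
qed

lemma ip2_tendsto:
  assumes u: "\<And>n. u n \<in> L2" and f: "f \<in> L2" and v: "\<And>n. v n \<in> L2" and g: "g \<in> L2"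
    and uf: "(\<lambda>n. l2sq (\<lambda>x. u n x - f x)) \<longlonglongrightarrow> 0"
    and vg: "(\<lambda>n. l2sq (\<lambda>x. v n x - g x)) \<longlonglongrightarrow> 0"
  shows "(\<lambda>n. ip2 (u n) (v n)) \<longlonglongrightarrow> ip2 f g"
proof -
  let ?a = "\<lambda>n. sqrt (l2sq (\<lambda>x. u n x - f x))" and ?b = "\<lambda>n. sqrt (l2sq (\<lambda>x. v n x - g x))"
  have le: "cmod (ip2 (u n) (v n) - ip2 f g) \<le> ?a n * ?b n + ?a n * sqrt (l2sq g) + sqrt (l2sq f) * ?b n" for n
  proof -
    note du = L2_diff[OF u[of n] f] and dv = L2_diff[OF v[of n] g]
    have eq: "ip2 (u n) (v n) - ip2 f g =
        ip2 (\<lambda>x. u n x - f x) (\<lambda>x. v n x - g x) + ip2 (\<lambda>x. u n x - f x) g + ip2 f (\<lambda>x. v n x - g x)"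
      using u[of n] v[of n] f g du dv by (simp add: ip2_diff_left ip2_diff_right)
    show ?thesis unfolding eq
      using norm_triangle_ineq[of "ip2 (\<lambda>x. u n x - f x) (\<lambda>x. v n x - g x) + ip2 (\<lambda>x. u n x - f x) g" "ip2 f (\<lambda>x. v n x - g x)"]
        norm_triangle_ineq[of "ip2 (\<lambda>x. u n x - f x) (\<lambda>x. v n x - g x)" "ip2 (\<lambda>x. u n x - f x) g"]
        ip2_le[OF du dv] ip2_le[OF du g] ip2_le[OF f dv]
      by linarith
  qed
  have "(\<lambda>n. ?a n * ?b n + ?a n * sqrt (l2sq g) + sqrt (l2sq f) * ?b n)
      \<longlonglongrightarrow> sqrt 0 * sqrt 0 + sqrt 0 * sqrt (l2sq g) + sqrt (l2sq f) * sqrt 0"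
    by (intro tendsto_intros uf vg)
  then have "(\<lambda>n. ?a n * ?b n + ?a n * sqrt (l2sq g) + sqrt (l2sq f) * ?b n) \<longlonglongrightarrow> 0" by simp
  then have "(\<lambda>n. ip2 (u n) (v n) - ip2 f g) \<longlonglongrightarrow> 0"
    by (rule Lim_null_comparison[rotated]) (use le in auto)
  then show ?thesis by (simp add: LIM_zero_iff)
qed

lemma l2sq_tendsto:
  fixes u :: "nat \<Rightarrow> plane \<Rightarrow> complex"
  assumes u: "\<And>n. u n \<in> L2" and f: "f \<in> L2"
    and uf: "(\<lambda>n. l2sq (\<lambda>x. u n x - f x)) \<longlonglongrightarrow> 0"
  shows "(\<lambda>n. l2sq (u n)) \<longlonglongrightarrow> l2sq f"
  using tendsto_Re[OF ip2_tendsto[OF u f u f uf uf]] u f by (simp add: ip2_self)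

text \<open>Along a subsequence the weighted series of squared increments has finite integral, so
  the increments are almost everywhere dominated by a geometric series.\<close>

lemma L2_complete:
  fixes u :: "nat \<Rightarrow> plane \<Rightarrow> 'b::euclidean_space"
  assumes u: "\<And>n. u n \<in> L2"
    and cau: "\<And>\<epsilon>. \<epsilon> > 0 \<Longrightarrow> \<exists>n0. \<forall>m\<ge>n0. \<forall>n\<ge>n0. l2sq (\<lambda>x. u m x - u n x) < \<epsilon>"
  shows "\<exists>f\<in>L2. (\<lambda>n. l2sq (\<lambda>x. u n x - f x)) \<longlonglongrightarrow> 0"
proof -
  have "\<exists>n0. \<forall>m\<ge>n0. \<forall>n\<ge>n0. l2sq (\<lambda>x. u m x - u n x) < (1/4) ^ k" for k :: nat
    by (rule cau) simp
  then obtain n0 where n0: "\<And>k m n. m \<ge> n0 k \<Longrightarrow> n \<ge> n0 k \<Longrightarrow> l2sq (\<lambda>x. u m x - u n x) < (1/4) ^ k"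
    by metis
  \<comment> \<open>The sum makes \<open>r\<close> monotone and at least \<open>n0 k\<close>; the
    summand k makes it tend to infinity.\<close>
  define r where "r k = k + (\<Sum>i\<le>k. n0 i)" for k
  have r_ge: "n0 k \<le> r k" for k
    unfolding r_def using member_le_sum[of k "{..k}" n0] by simp
  have r_mono: "r k \<le> r (Suc k)" for k by (simp add: r_def)
  have r_id: "k \<le> r k" for k by (simp add: r_def)
  define d where "d k x = u (r (Suc k)) x - u (r k) x" for k x
  have dL2: "d k \<in> L2" for k unfolding d_def by (intro L2_diff u)
  have dm[measurable]: "d k \<in> borel_measurable lebesgue" for k by (rule L2_measurable[OF dL2])
  have um[measurable]: "u k \<in> borel_measurable lebesgue" for k by (rule L2_measurable[OF u])
  have d_le: "l2sq (d k) \<le> (1/4) ^ k" for k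
    unfolding d_def using n0[of k "r (Suc k)" "r k"] r_ge[of k] r_mono[of k] by fastforce
  have "(\<integral>\<^sup>+x. (\<Sum>k. ennreal (2 ^ k * (norm (d k x))\<^sup>2)) \<partial>lebesgue)
      = (\<Sum>k. \<integral>\<^sup>+x. ennreal (2 ^ k * (norm (d k x))\<^sup>2) \<partial>lebesgue)"
    by (rule nn_integral_suminf) measurable
  also have "\<dots> \<le> (\<Sum>k. ennreal ((1/2) ^ k))"
  proof (intro suminf_le)
    fix k
    have "(\<integral>\<^sup>+x. ennreal (2 ^ k * (norm (d k x))\<^sup>2) \<partial>lebesgue) = ennreal (2 ^ k * l2sq (d k))"
      by (simp add: ennreal_mult nn_integral_cmult nn_integral_l2sq[OF dL2] l2sq_nonneg)
    also have "\<dots> \<le> ennreal (2 ^ k * (1/4) ^ k)"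
      by (intro ennreal_leI mult_left_mono d_le) auto
    also have "2 ^ k * (1/4) ^ k = (1/2 :: real) ^ k"
      by (simp add: power_mult_distrib[symmetric])
    finally show "(\<integral>\<^sup>+x. ennreal (2 ^ k * (norm (d k x))\<^sup>2) \<partial>lebesgue) \<le> ennreal ((1/2) ^ k)" .
  qed auto
  also have "\<dots> = ennreal (\<Sum>k. (1/2) ^ k)"
    by (rule suminf_ennreal2) (auto intro: summable_geometric)
  also have "\<dots> < \<infinity>" by simp
  finally have fin: "(\<integral>\<^sup>+x. (\<Sum>k. ennreal (2 ^ k * (norm (d k x))\<^sup>2)) \<partial>lebesgue) \<noteq> \<infinity>" by simp
  have "(\<lambda>x. \<Sum>k. ennreal (2 ^ k * (norm (d k x))\<^sup>2)) \<in> borel_measurable lebesgue" by measurable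
  from nn_integral_PInf_AE[OF this fin]
  have conv: "AE x in lebesgue. convergent (\<lambda>k. u (r k) x)"
  proof (eventually_elim)
    case (elim x)
    define T where "T = (\<Sum>k. ennreal (2 ^ k * (norm (d k x))\<^sup>2))"
    have "T \<noteq> \<infinity>" using elim unfolding T_def .
    then obtain B where B': "T = ennreal B" "0 \<le> B" by (cases T) auto
    note B = B'[unfolded T_def]
    have bd: "norm (d k x) \<le> sqrt B * (1 / sqrt 2) ^ k" for k
    proof -
      have "ennreal (2 ^ k * (norm (d k x))\<^sup>2) \<le> ennreal B"
        using sum_le_suminf[of "\<lambda>k. ennreal (2 ^ k * (norm (d k x))\<^sup>2)" "{k}"]
        unfolding B(1) by (simp only: summableI finite.intros sum.insert sum.empty simp_thms add_0_right empty_iff zero_le not_False_eq_True)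
      then have "2 ^ k * (norm (d k x))\<^sup>2 \<le> B" using B by simp
      then have "(norm (d k x))\<^sup>2 \<le> B * (1/2) ^ k" by (simp add: field_simps power_one_over)
      then have "norm (d k x) \<le> sqrt (B * (1/2) ^ k)" by (rule real_le_rsqrt)
      also have "\<dots> = sqrt B * (1 / sqrt 2) ^ k"
        by (simp add: real_sqrt_mult real_sqrt_power real_sqrt_divide power_one_over)
      finally show ?thesis .
    qed
    have "summable (\<lambda>k. sqrt B * (1 / sqrt 2) ^ k)"
      by (intro summable_mult summable_geometric) (simp add: real_less_rsqrt)
    then have "summable (\<lambda>k. d k x)"
      by (rule summable_comparison_test[rotated]) (use bd in auto)
    then have "convergent (\<lambda>n. \<Sum>k<n. d k x)" by (simp add: summable_iff_convergent)
    moreover have "(\<Sum>k<n. d k x) = u (r n) x - u (r 0) x" for n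
      unfolding d_def by (induction n) auto
    ultimately have "convergent (\<lambda>n. u (r n) x - u (r 0) x)" by simp
    then show ?case by (simp add: convergent_diff_const_right_iff)
  qed
  define f where "f x = lim (\<lambda>k. u (r k) x)" for x
  have f[measurable]: "f \<in> borel_measurable lebesgue"
    unfolding f_def[abs_def] by (rule borel_measurable_lim_metric) measurable
  \<comment> \<open>Fatou's lemma along the subsequence \<open>r\<close>, but for every index n of
    the original sequence. It serves twice: for membership of the limit in \<open>L2\<close> and for
    convergence of the whole sequence.\<close>
  have key: "(\<integral>\<^sup>+x. ennreal ((norm (u n x - f x))\<^sup>2) \<partial>lebesgue) \<le> ennreal \<epsilon>"
    if "\<And>m. m \<ge> M \<Longrightarrow> l2sq (\<lambda>x. u n x - u m x) \<le> \<epsilon>" for n M \<epsilon>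
  proof -
    have "(\<integral>\<^sup>+x. ennreal ((norm (u n x - f x))\<^sup>2) \<partial>lebesgue)
        \<le> (\<integral>\<^sup>+x. liminf (\<lambda>k. ennreal ((norm (u n x - u (r k) x))\<^sup>2)) \<partial>lebesgue)"
    proof (rule nn_integral_mono_AE)
      show "AE x in lebesgue. ennreal ((norm (u n x - f x))\<^sup>2) \<le> liminf (\<lambda>k. ennreal ((norm (u n x - u (r k) x))\<^sup>2))"
        using conv
      proof eventually_elim
        case (elim x)
        then have "(\<lambda>k. u (r k) x) \<longlonglongrightarrow> f x" by (simp add: f_def convergent_LIMSEQ_iff)
        then have "(\<lambda>k. ennreal ((norm (u n x - u (r k) x))\<^sup>2)) \<longlonglongrightarrow> ennreal ((norm (u n x - f x))\<^sup>2)"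
          by (intro tendsto_intros)
        from lim_imp_Liminf[OF trivial_limit_sequentially this]
        show ?case by (simp only: order_refl)
      qed
    qed
    also have "\<dots> \<le> liminf (\<lambda>k. \<integral>\<^sup>+x. ennreal ((norm (u n x - u (r k) x))\<^sup>2) \<partial>lebesgue)"
      by (rule nn_integral_liminf) measurable
    also have "\<dots> \<le> ennreal \<epsilon>"
    proof (rule Liminf_le)
      show "\<forall>\<^sub>F k in sequentially. (\<integral>\<^sup>+x. ennreal ((norm (u n x - u (r k) x))\<^sup>2) \<partial>lebesgue) \<le> ennreal \<epsilon>"
        using eventually_ge_at_top[of M]
      proof eventually_elim
        case (elim k)
        then have "M \<le> r k" using r_id[of k] by simp
        then show ?case using nn_integral_l2sq[OF L2_diff[OF u u], of n "r k"] that by (simp add: ennreal_leI)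
      qed
    qed simp
    finally show ?thesis .
  qed
  obtain n1 where n1: "\<And>m n. m \<ge> n1 \<Longrightarrow> n \<ge> n1 \<Longrightarrow> l2sq (\<lambda>x. u m x - u n x) < 1"
    using cau[of 1] by auto
  have "(\<integral>\<^sup>+x. ennreal ((norm (u n1 x - f x))\<^sup>2) \<partial>lebesgue) \<le> ennreal 1"
    by (rule key[of n1]) (use n1 in \<open>auto intro: less_imp_le\<close>)
  then have fin1: "(\<integral>\<^sup>+x. ennreal ((norm (u n1 x - f x))\<^sup>2) \<partial>lebesgue) < \<infinity>"
    by (rule order_le_less_trans) simp
  have "integrable lebesgue (\<lambda>x. (norm (u n1 x - f x))\<^sup>2)"
  proof (rule integrableI_bounded)
    show "(\<lambda>x. (norm (u n1 x - f x))\<^sup>2) \<in> borel_measurable lebesgue" by measurable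
    show "(\<integral>\<^sup>+x. ennreal (norm ((norm (u n1 x - f x))\<^sup>2)) \<partial>lebesgue) < \<infinity>"
      using fin1 by (simp only: real_norm_def abs_of_nonneg zero_le_power2)
  qed
  moreover have "(\<lambda>x. u n1 x - f x) \<in> borel_measurable lebesgue" by measurable
  ultimately have "(\<lambda>x. u n1 x - f x) \<in> L2"
    unfolding L2_def by blast
  from L2_diff[OF u[of n1] this] have fL2: "f \<in> L2" by simp
  have "(\<lambda>n. l2sq (\<lambda>x. u n x - f x)) \<longlonglongrightarrow> 0"
  proof (rule LIMSEQ_I)
    fix e :: real assume e: "0 < e"
    obtain N where N: "\<And>m n. m \<ge> N \<Longrightarrow> n \<ge> N \<Longrightarrow> l2sq (\<lambda>x. u m x - u n x) < e / 2"
      using cau[of "e/2"] e by auto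
    have le: "l2sq (\<lambda>x. u n x - f x) \<le> e / 2" if n: "n \<ge> N" for n
    proof -
      have "(\<integral>\<^sup>+x. ennreal ((norm (u n x - f x))\<^sup>2) \<partial>lebesgue) \<le> ennreal (e / 2)"
        by (rule key[of N]) (rule less_imp_le[OF N[OF n]])
      then have "ennreal (l2sq (\<lambda>x. u n x - f x)) \<le> ennreal (e / 2)"
        by (simp only: nn_integral_l2sq[OF L2_diff[OF u fL2]])
      then show ?thesis using e by (simp only: ennreal_le_iff)
    qed
    have "norm (l2sq (\<lambda>x. u n x - f x) - 0) < e" if "n \<ge> N" for n
      using le[OF that] e l2sq_nonneg[of "\<lambda>x. u n x - f x"] by simp
    then show "\<exists>no. \<forall>n\<ge>no. norm (l2sq (\<lambda>x. u n x - f x) - 0) < e" by blast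
  qed
  then show ?thesis using fL2 by blast
qed

text \<open>How an isometry known on approximants only is extended to the limit: equality of mutual
  distances turns convergence of \<open>u\<close> into the Cauchy property of
  \<open>v\<close>.\<close>

lemma L2_limit_transfer:
  fixes u :: "nat \<Rightarrow> plane \<Rightarrow> 'b::euclidean_space" and v :: "nat \<Rightarrow> plane \<Rightarrow> 'c::euclidean_space"
  assumes u: "\<And>n. u n \<in> L2" and f: "f \<in> L2" and v: "\<And>n. v n \<in> L2"
    and iso: "\<And>m n. l2sq (\<lambda>x. v m x - v n x) = l2sq (\<lambda>x. u m x - u n x)"
    and lim: "(\<lambda>n. l2sq (\<lambda>x. u n x - f x)) \<longlonglongrightarrow> 0"
  shows "\<exists>g\<in>L2. (\<lambda>n. l2sq (\<lambda>x. v n x - g x)) \<longlonglongrightarrow> 0"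
proof (rule L2_complete[OF v])
  fix e :: real assume "e > 0"
  then have "\<forall>\<^sub>F n in sequentially. l2sq (\<lambda>x. u n x - f x) < e / 4"
    using order_tendstoD(2)[OF lim, of "e / 4"] by simp
  then obtain n0 where n0: "\<And>n. n \<ge> n0 \<Longrightarrow> l2sq (\<lambda>x. u n x - f x) < e / 4"
    by (auto simp: eventually_sequentially)
  have "l2sq (\<lambda>x. u m x - u n x) < e" if "m \<ge> n0" "n \<ge> n0" for m n
    using l2sq_triangle[OF u f u, of m n] n0[OF that(1)] n0[OF that(2)] l2sq_commute[of f "u n"] by simp
  then show "\<exists>n0. \<forall>m\<ge>n0. \<forall>n\<ge>n0. l2sq (\<lambda>x. v m x - v n x) < e" unfolding iso by blast
qed

lemma L2_limit_unique:
  fixes u :: "nat \<Rightarrow> plane \<Rightarrow> 'b::euclidean_space"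
  assumes u: "\<And>n. u n \<in> L2" and f: "f \<in> L2" and g: "g \<in> L2"
    and "(\<lambda>n. l2sq (\<lambda>x. u n x - f x)) \<longlonglongrightarrow> 0" "(\<lambda>n. l2sq (\<lambda>x. u n x - g x)) \<longlonglongrightarrow> 0"
  shows "AE x in lebesgue. f x = g x"
proof -
  have "l2sq (\<lambda>x. f x - g x) \<le> 2 * l2sq (\<lambda>x. u n x - f x) + 2 * l2sq (\<lambda>x. u n x - g x)" for n
    using l2sq_triangle[OF f u[of n] g] by (simp add: l2sq_commute)
  moreover have "(\<lambda>n. 2 * l2sq (\<lambda>x. u n x - f x) + 2 * l2sq (\<lambda>x. u n x - g x)) \<longlonglongrightarrow> 2 * 0 + 2 * 0"
    by (intro tendsto_intros assms)
  ultimately have "l2sq (\<lambda>x. f x - g x) \<le> 0"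
    by (intro LIMSEQ_le_const[where X="\<lambda>n. 2 * l2sq (\<lambda>x. u n x - f x) + 2 * l2sq (\<lambda>x. u n x - g x)"]) auto
  then have "l2sq (\<lambda>x. f x - g x) = 0" using l2sq_nonneg[of "\<lambda>x. f x - g x"] by simp
  then show ?thesis using l2sq_eq_0_iff[OF L2_diff[OF f g]] by simp
qed

text \<open>The link between limits in \<open>L2\<close> and pointwise statements: it identifies a
  limit in \<open>L2\<close> with a pointwise limit and prepares an application of Fatou's
  lemma.\<close>

lemma L2_subseq_AE:
  fixes u :: "nat \<Rightarrow> plane \<Rightarrow> 'b::euclidean_space"
  assumes u: "\<And>n. u n \<in> L2" and f: "f \<in> L2"
    and lim: "(\<lambda>n. l2sq (\<lambda>x. u n x - f x)) \<longlonglongrightarrow> 0"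
  shows "\<exists>r. strict_mono (r :: nat \<Rightarrow> nat) \<and> (AE x in lebesgue. (\<lambda>n. u (r n) x) \<longlonglongrightarrow> f x)"
proof -
  have "\<exists>r. strict_mono (r :: nat \<Rightarrow> nat) \<and> (AE x in lebesgue. (\<lambda>n. (norm (u (r n) x - f x))\<^sup>2) \<longlonglongrightarrow> 0)"
    by (rule tendsto_L1_AE_subseq) (use lim L2_integrable[OF L2_diff[OF u f]] in \<open>auto simp: l2sq_def\<close>)
  then obtain r where r: "strict_mono r" and "AE x in lebesgue. (\<lambda>n. (norm (u (r n) x - f x))\<^sup>2) \<longlonglongrightarrow> 0"
    by blast
  from this(2) have "AE x in lebesgue. (\<lambda>n. u (r n) x) \<longlonglongrightarrow> f x"
  proof eventually_elim
    case (elim x)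
    from tendsto_real_sqrt[OF this] have "(\<lambda>n. norm (u (r n) x - f x)) \<longlonglongrightarrow> 0" by simp
    then have "(\<lambda>n. u (r n) x - f x) \<longlonglongrightarrow> 0" by (rule tendsto_norm_zero_cancel)
    then show ?case by (simp add: LIM_zero_iff)
  qed
  then show ?thesis using r by blast
qed

section \<open>The Fourier transform of integrable functions\<close>

text \<open>The factor \<open>c\<^sup>2\<close> is the Jacobian of a dilation of the plane. Scaling
  of Gaussians, translation and the reflection \<open>c = - 1\<close> are all instances.\<close>

lemma lebesgue_integral_affine:
  fixes F :: "plane \<Rightarrow> 'b::{banach, second_countable_topology}"
  assumes F: "F \<in> borel_measurable lebesgue" and c: "c \<noteq> 0"
  shows "integrable lebesgue (\<lambda>x. F (t + c *\<^sub>R x)) \<longleftrightarrow> integrable lebesgue F" (is ?A)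
    and "(LINT x|lebesgue. F x) = c\<^sup>2 *\<^sub>R (LINT x|lebesgue. F (t + c *\<^sub>R x))" (is ?B)
proof -
  have e: "(\<Sum>j\<in>Basis. (c * (x \<bullet> j)) *\<^sub>R j) = c *\<^sub>R x" for x :: plane
    using euclidean_representation[of x]
    by (simp only: scaleR_scaleR[symmetric] scaleR_sum_right[symmetric])
  let ?T = "\<lambda>x::plane. t + c *\<^sub>R x"
  have L: "lebesgue = density (distr lebesgue lebesgue ?T) (\<lambda>_. ennreal (c\<^sup>2))"
    using lebesgue_affine_euclidean[of "\<lambda>_. c" t] c by (simp add: e power2_abs)
  have T: "?T \<in> lebesgue \<rightarrow>\<^sub>M lebesgue"
    using lebesgue_affine_measurable[of "\<lambda>_. c" t] c by (simp add: e)
  have F': "F \<in> borel_measurable (distr lebesgue lebesgue ?T)"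
    using F by simp
  have "integrable (density (distr lebesgue lebesgue ?T) (\<lambda>_. ennreal (c\<^sup>2))) F
      \<longleftrightarrow> integrable (distr lebesgue lebesgue ?T) (\<lambda>x. c\<^sup>2 *\<^sub>R F x)"
    by (rule integrable_density) (use F' in auto)
  also have "\<dots> \<longleftrightarrow> integrable lebesgue (\<lambda>x. c\<^sup>2 *\<^sub>R F (?T x))"
    by (rule integrable_distr_eq[OF T]) (use F in auto)
  also have "\<dots> \<longleftrightarrow> integrable lebesgue (\<lambda>x. F (?T x))"
  proof
    assume "integrable lebesgue (\<lambda>x. c\<^sup>2 *\<^sub>R F (?T x))"
    from integrable_scaleR_right[OF this, of "1 / c\<^sup>2"]
    show "integrable lebesgue (\<lambda>x. F (?T x))" using c by simp
  qed simp
  finally show ?A unfolding L[symmetric] by simp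
  have "integral\<^sup>L (density (distr lebesgue lebesgue ?T) (\<lambda>_. ennreal (c\<^sup>2))) F
      = integral\<^sup>L (distr lebesgue lebesgue ?T) (\<lambda>x. c\<^sup>2 *\<^sub>R F x)"
    by (rule integral_density) (use F' in auto)
  also have "\<dots> = integral\<^sup>L lebesgue (\<lambda>x. c\<^sup>2 *\<^sub>R F (?T x))"
    by (rule integral_distr[OF T]) (use F in auto)
  finally show ?B unfolding L[symmetric] by simp
qed

text \<open>Fubini for products of functions of one coordinate: Lebesgue measure is by construction
  the image of the product measure over the basis.\<close>

lemma lborel_integral_prod_Basis:
  fixes F :: "'a::euclidean_space \<Rightarrow> real \<Rightarrow> complex"
  assumes F: "\<And>b. b \<in> Basis \<Longrightarrow> integrable lborel (F b)"
  shows "integrable lborel (\<lambda>x. \<Prod>b\<in>Basis. F b (x \<bullet> b))"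
    and "(LINT x|lborel. (\<Prod>b\<in>Basis. F b (x \<bullet> b))) = (\<Prod>b\<in>Basis. LINT t|lborel. F b t)"
proof -
  interpret product_sigma_finite "\<lambda>_::'a. lborel :: real measure" by standard
  have [measurable]: "F b \<in> borel_measurable borel" if "b \<in> Basis" for b
    using borel_measurable_integrable[OF F[OF that]] by simp
  let ?S = "\<lambda>f. \<Sum>b\<in>Basis. f b *\<^sub>R (b::'a)"
  have L: "lborel = distr (Pi\<^sub>M Basis (\<lambda>b::'a. lborel)) borel ?S"
    by (simp only: lborel_def[where 'a='a] lborel_eq_real)
  have S: "?S \<in> Pi\<^sub>M Basis (\<lambda>b::'a. lborel :: real measure) \<rightarrow>\<^sub>M borel" by measurable
  have m: "(\<lambda>x. \<Prod>b\<in>Basis. F b (x \<bullet> b)) \<in> borel_measurable borel" by measurable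
  have Sb: "(\<Prod>b\<in>Basis. F b (?S f \<bullet> b)) = (\<Prod>b\<in>Basis. F b (f b))" for f
    by (intro prod.cong) auto
  have "integrable (distr (Pi\<^sub>M Basis (\<lambda>b::'a. lborel)) borel ?S) (\<lambda>x. \<Prod>b\<in>Basis. F b (x \<bullet> b))"
    unfolding integrable_distr_eq[OF S m] Sb
    by (rule product_integrable_prod) (use F in auto)
  then show "integrable lborel (\<lambda>x. \<Prod>b\<in>Basis. F b (x \<bullet> b))" unfolding L[symmetric] .
  have "integral\<^sup>L (distr (Pi\<^sub>M Basis (\<lambda>b::'a. lborel)) borel ?S) (\<lambda>x. \<Prod>b\<in>Basis. F b (x \<bullet> b))
     = (\<Prod>b\<in>Basis. LINT t|lborel. F b t)"
    unfolding integral_distr[OF S m] Sb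
    by (rule product_integral_prod) (use F in auto)
  then show "(LINT x|lborel. (\<Prod>b\<in>Basis. F b (x \<bullet> b))) = (\<Prod>b\<in>Basis. LINT t|lborel. F b t)"
    unfolding L[symmetric] .
qed

text \<open>The width is the one fixed by \<open>fourier\<close>. Its transform comes from the
  characteristic function of the standard normal distribution in each coordinate.\<close>

definition gauss :: "plane \<Rightarrow> real" where "gauss x = exp (- (norm x)\<^sup>2 / 2)"

lemma gauss_1d:
  fixes s :: real
  defines "f \<equiv> \<lambda>t. exp (\<i> * complex_of_real (t * s)) * complex_of_real (exp (- t\<^sup>2 / 2))"
  shows "integrable lborel f" "(LINT t|lborel. f t) = complex_of_real (sqrt (2 * pi) * exp (- s\<^sup>2 / 2))"
proof -
  have f_eq: "f t = sqrt (2 * pi) *\<^sub>R (std_normal_density t *\<^sub>R iexp (s * t))" for t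
    by (simp add: f_def std_normal_density_def scaleR_conv_of_real mult_ac)
  have i: "integrable lborel (\<lambda>t. std_normal_density t *\<^sub>R iexp (s * t))"
    by (rule Bochner_Integration.integrable_bound[OF integrable_normal_density[of 1 0]])
       (auto simp: norm_mult)
  then show "integrable lborel f" unfolding f_eq[abs_def] by (rule integrable_scaleR_right)
  have "(LINT t|lborel. std_normal_density t *\<^sub>R iexp (s * t)) = char std_normal_distribution s"
    unfolding char_def by (subst integral_density) auto
  then show "(LINT t|lborel. f t) = complex_of_real (sqrt (2 * pi) * exp (- s\<^sup>2 / 2))"
    unfolding f_eq[abs_def] by (simp add: char_std_normal_distribution scaleR_conv_of_real)
qed

lemma gauss_measurable[measurable]: "gauss \<in> borel_measurable borel"
  unfolding gauss_def by measurable

lemma gauss_fourier: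
  fixes y :: plane
  shows "integrable lebesgue (\<lambda>p. exp (\<i> * complex_of_real (p \<bullet> y)) * complex_of_real (gauss p))"
    and "(LINT p|lebesgue. exp (\<i> * complex_of_real (p \<bullet> y)) * complex_of_real (gauss p))
       = complex_of_real (2 * pi * gauss y)"
proof -
  let ?F = "\<lambda>b::plane. \<lambda>t. exp (\<i> * complex_of_real (t * (y \<bullet> b))) * complex_of_real (exp (- t\<^sup>2 / 2))"
  have sq: "(norm x)\<^sup>2 = (\<Sum>b\<in>Basis. (x \<bullet> b)\<^sup>2)" for x :: plane
    unfolding power2_norm_eq_inner by (subst euclidean_inner) (simp add: power2_eq_square)
  have g: "gauss x = (\<Prod>b\<in>Basis. exp (- (x \<bullet> b)\<^sup>2 / 2))" for x
    by (simp add: gauss_def sq exp_sum[symmetric] sum_negf sum_divide_distrib)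
  have e: "exp (\<i> * complex_of_real (p \<bullet> y)) = (\<Prod>b\<in>Basis. exp (\<i> * complex_of_real ((p \<bullet> b) * (y \<bullet> b))))" for p
    by (subst euclidean_inner) (simp add: exp_sum[symmetric] sum_distrib_left)
  have P: "exp (\<i> * complex_of_real (p \<bullet> y)) * complex_of_real (gauss p) = (\<Prod>b\<in>Basis. ?F b (p \<bullet> b))" for p
    by (simp add: g e prod.distrib)
  have m: "(\<lambda>p. exp (\<i> * complex_of_real (p \<bullet> y)) * complex_of_real (gauss p)) \<in> borel_measurable lborel"
    by measurable
  note I = lborel_integral_prod_Basis[of ?F, OF gauss_1d(1)]
  show "integrable lebesgue (\<lambda>p. exp (\<i> * complex_of_real (p \<bullet> y)) * complex_of_real (gauss p))"
    unfolding integrable_completion[OF m] unfolding P by (rule I(1))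
  have "(LINT p|lebesgue. exp (\<i> * complex_of_real (p \<bullet> y)) * complex_of_real (gauss p))
      = (\<Prod>b\<in>(Basis::plane set). complex_of_real (sqrt (2 * pi) * exp (- (y \<bullet> b)\<^sup>2 / 2)))"
    unfolding integral_completion[OF m] unfolding P I(2) gauss_1d(2) ..
  also have "\<dots> = complex_of_real (2 * pi * gauss y)"
  proof -
    have "(complex_of_real (sqrt (2 * pi)))\<^sup>2 = complex_of_real ((sqrt (2 * pi))\<^sup>2)"
      by (rule of_real_power[symmetric])
    then have "(complex_of_real (sqrt (2 * pi)))\<^sup>2 = 2 * complex_of_real pi" by simp
    then show ?thesis by (simp add: prod.distrib g)
  qed
  finally show "(LINT p|lebesgue. exp (\<i> * complex_of_real (p \<bullet> y)) * complex_of_real (gauss p))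
       = complex_of_real (2 * pi * gauss y)" .
qed

lemma gauss_borel_lebesgue[measurable]: "gauss \<in> borel_measurable lebesgue"
  by (rule borel_imp_lebesgue_measurable) measurable

lemma gauss_scaled:
  assumes "\<epsilon> > 0"
  shows "integrable lebesgue (\<lambda>p. exp (\<i> * complex_of_real (p \<bullet> z)) * complex_of_real (gauss (\<epsilon> *\<^sub>R p)))"
    and "(LINT p|lebesgue. exp (\<i> * complex_of_real (p \<bullet> z)) * complex_of_real (gauss (\<epsilon> *\<^sub>R p)))
       = complex_of_real (2 * pi / \<epsilon>\<^sup>2 * gauss ((1 / \<epsilon>) *\<^sub>R z))"
proof -
  let ?F = "\<lambda>p. exp (\<i> * complex_of_real (p \<bullet> ((1 / \<epsilon>) *\<^sub>R z))) * complex_of_real (gauss p)"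
  have m: "?F \<in> borel_measurable lebesgue"
    by (rule borel_measurable_integrable[OF gauss_fourier(1)])
  have e: "?F (0 + \<epsilon> *\<^sub>R p) = exp (\<i> * complex_of_real (p \<bullet> z)) * complex_of_real (gauss (\<epsilon> *\<^sub>R p))" for p
    using assms by simp
  show "integrable lebesgue (\<lambda>p. exp (\<i> * complex_of_real (p \<bullet> z)) * complex_of_real (gauss (\<epsilon> *\<^sub>R p)))"
    using lebesgue_integral_affine(1)[OF m, of \<epsilon> 0] gauss_fourier(1) assms unfolding e by blast
  have "complex_of_real (2 * pi * gauss ((1 / \<epsilon>) *\<^sub>R z)) = \<epsilon>\<^sup>2 *\<^sub>R
     (LINT p|lebesgue. exp (\<i> * complex_of_real (p \<bullet> z)) * complex_of_real (gauss (\<epsilon> *\<^sub>R p)))"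
    using lebesgue_integral_affine(2)[OF m, of \<epsilon> 0] assms unfolding e gauss_fourier(2) by blast
  then show "(LINT p|lebesgue. exp (\<i> * complex_of_real (p \<bullet> z)) * complex_of_real (gauss (\<epsilon> *\<^sub>R p)))
       = complex_of_real (2 * pi / \<epsilon>\<^sup>2 * gauss ((1 / \<epsilon>) *\<^sub>R z))"
    using assms by (simp add: scaleR_conv_of_real field_simps)
qed

text \<open>The transforms are integrals over the completed measure, and Fubini's theorem is applied
  to it directly; an exhaustion for \<open>lborel\<close> also serves its completion.\<close>

lemma sigma_finite_lebesgue: "sigma_finite_measure (lebesgue :: 'a::euclidean_space measure)"
proof
  obtain A :: "'a set set" where A: "countable A" "A \<subseteq> sets lborel" "\<Union>A = space lborel"
    "\<forall>a\<in>A. emeasure lborel a \<noteq> \<infinity>"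
    using sigma_finite_measure.sigma_finite_countable[OF sigma_finite_lborel] by blast
  then show "\<exists>A. countable A \<and> A \<subseteq> sets (lebesgue :: 'a measure) \<and> \<Union>A = space lebesgue \<and>
      (\<forall>a\<in>A. emeasure lebesgue a \<noteq> \<infinity>)"
    by (intro exI[of _ A]) (auto simp: emeasure_completion)
qed

interpretation lebesgue_pair: pair_sigma_finite "lebesgue :: plane measure" "lebesgue :: plane measure"
  by (intro pair_sigma_finite.intro sigma_finite_lebesgue)

text \<open>The inverse transform of an integrable function, written as a reflection so that bounds
  and linearity carry over from \<open>fourier\<close>.\<close>

definition ifourier :: "(plane \<Rightarrow> complex) \<Rightarrow> plane \<Rightarrow> complex" where
  "ifourier f x = fourier f (- x)"

lemma ifourier_alt: "ifourier f x = 1 / (2 * of_real pi) * (LINT p|lebesgue. exp (\<i> * of_real (x \<bullet> p)) * f p)"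
  by (simp add: ifourier_def fourier_def)

lemma wave_measurable_pair:
  "(\<lambda>z. exp (c * complex_of_real (fst z \<bullet> snd z))) \<in> borel_measurable ((lebesgue :: plane measure) \<Otimes>\<^sub>M lebesgue)"
proof -
  have id: "(\<lambda>x. x) \<in> borel_measurable (lebesgue :: plane measure)"
    by (rule borel_imp_lebesgue_measurable) simp
  have [measurable]: "fst \<in> borel_measurable ((lebesgue :: plane measure) \<Otimes>\<^sub>M (lebesgue :: plane measure))"
    "snd \<in> borel_measurable ((lebesgue :: plane measure) \<Otimes>\<^sub>M (lebesgue :: plane measure))"
    using measurable_compose[OF measurable_fst id] measurable_compose[OF measurable_snd id] by auto
  show ?thesis by measurable
qed

lemma wave_measurable: "(\<lambda>x. exp (c * complex_of_real (p \<bullet> x))) \<in> borel_measurable lebesgue"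
  by (rule borel_imp_lebesgue_measurable) measurable

lemma wave_mult_integrable:
  assumes "integrable lebesgue f"
  shows "integrable lebesgue (\<lambda>x::plane. exp (- \<i> * complex_of_real (p \<bullet> x)) * f x)"
    and "integrable lebesgue (\<lambda>x::plane. exp (\<i> * complex_of_real (p \<bullet> x)) * f x)"
proof -
  note [measurable] = borel_measurable_integrable[OF assms] wave_measurable
  show "integrable lebesgue (\<lambda>x::plane. exp (- \<i> * complex_of_real (p \<bullet> x)) * f x)"
    by (rule Bochner_Integration.integrable_bound[OF assms]) (measurable, simp add: norm_mult)
  show "integrable lebesgue (\<lambda>x::plane. exp (\<i> * complex_of_real (p \<bullet> x)) * f x)"
    by (rule Bochner_Integration.integrable_bound[OF assms]) (measurable, simp add: norm_mult)
qed

lemma fourier_measurable: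
  assumes "integrable lebesgue f" shows "fourier f \<in> borel_measurable lebesgue"
proof -
  note [measurable] = borel_measurable_integrable[OF assms] wave_measurable_pair
  have "(\<lambda>z. exp (- \<i> * complex_of_real (fst z \<bullet> snd z)) * f (snd z))
      \<in> borel_measurable ((lebesgue :: plane measure) \<Otimes>\<^sub>M lebesgue)" by measurable
  then have "(\<lambda>p. LINT x|lebesgue. exp (- \<i> * complex_of_real (p \<bullet> x)) * f x) \<in> borel_measurable (lebesgue :: plane measure)"
    by (intro sigma_finite_measure.borel_measurable_lebesgue_integral[OF sigma_finite_lebesgue]) (simp add: case_prod_beta)
  then show ?thesis unfolding fourier_def by measurable
qed

lemma fourier_bound:
  assumes "integrable lebesgue f"
  shows "cmod (fourier f p) \<le> (LINT x|lebesgue. cmod (f x)) / (2 * pi)"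
proof -
  have "cmod (LINT x|lebesgue. exp (- \<i> * complex_of_real (p \<bullet> x)) * f x)
      \<le> (LINT x|lebesgue. cmod (exp (- \<i> * complex_of_real (p \<bullet> x)) * f x))"
    by (rule integral_norm_bound)
  also have "\<dots> = (LINT x|lebesgue. cmod (f x))" by (simp add: norm_mult)
  finally show ?thesis by (simp add: fourier_def norm_mult norm_divide divide_right_mono)
qed

lemma fourier_add:
  assumes "integrable lebesgue f" "integrable lebesgue g"
  shows "fourier (\<lambda>x. f x + g x) p = fourier f p + fourier g p"
  using wave_mult_integrable[OF assms(1)] wave_mult_integrable[OF assms(2)]
  by (simp add: fourier_def distrib_left)

lemma fourier_mult:
  assumes "integrable lebesgue f" shows "fourier (\<lambda>x. c * f x) p = c * fourier f p"
  using wave_mult_integrable[OF assms] by (simp add: fourier_def mult.left_commute[of _ c])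

lemma fourier_diff:
  assumes "integrable lebesgue f" "integrable lebesgue g"
  shows "fourier (\<lambda>x. f x - g x) p = fourier f p - fourier g p"
  using wave_mult_integrable[OF assms(1)] wave_mult_integrable[OF assms(2)]
  by (simp add: fourier_def right_diff_distrib)

text \<open>Fubini's theorem for a kernel of modulus \<open>cmod (f x) * cmod (k p)\<close>. Both
  Plancherel's formula and the inversion of the transform are extracted from this exchange of
  integrals.\<close>

lemma fourier_adjoint:
  assumes f: "integrable lebesgue f" and k: "integrable lebesgue k"
  shows "(LINT p|lebesgue. cnj (fourier f p) * k p) = (LINT x|lebesgue. cnj (f x) * ifourier k x)"
proof -
  note [measurable] = borel_measurable_integrable[OF f] borel_measurable_integrable[OF k] wave_measurable_pair
  define H where "H p x = exp (\<i> * complex_of_real (p \<bullet> x)) * cnj (f x) * k p" for p x :: plane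
  have m: "(\<lambda>z. H (fst z) (snd z)) \<in> borel_measurable (lebesgue \<Otimes>\<^sub>M lebesgue)"
    unfolding H_def by measurable
  have nH: "norm (H p x) = cmod (f x) * cmod (k p)" for p x by (simp add: H_def norm_mult)
  have fc: "integrable lebesgue (\<lambda>x. cnj (f x))" using f by simp
  have "integrable (lebesgue \<Otimes>\<^sub>M lebesgue) (\<lambda>z. H (fst z) (snd z))"
  proof (rule lebesgue_pair.Fubini_integrable[OF m])
    show "integrable lebesgue (\<lambda>p. LINT x|lebesgue. norm (H (fst (p, x)) (snd (p, x))))"
      using f k by (simp add: nH)
    show "AE p in lebesgue. integrable lebesgue (\<lambda>x. H (fst (p, x)) (snd (p, x)))"
      unfolding H_def fst_conv snd_conv
      by (intro AE_I2 integrable_mult_left wave_mult_integrable(2)[OF fc])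
  qed
  then have "integrable (lebesgue \<Otimes>\<^sub>M lebesgue) (\<lambda>(p, x). H p x)" by (simp add: case_prod_beta')
  from lebesgue_pair.Fubini_integral[OF this]
  have sw: "(LINT x|lebesgue. LINT p|lebesgue. H p x) = (LINT p|lebesgue. LINT x|lebesgue. H p x)" .
  have "cnj (fourier f p) * k p = 1 / (2 * of_real pi) * (LINT x|lebesgue. H p x)" for p
  proof -
    have "cnj (LINT x|lebesgue. exp (- \<i> * complex_of_real (p \<bullet> x)) * f x)
        = (LINT x|lebesgue. cnj (exp (- \<i> * complex_of_real (p \<bullet> x)) * f x))"
      by (rule integral_bounded_linear[OF bounded_linear_cnj wave_mult_integrable(1)[OF f], symmetric])
    also have "\<dots> = (LINT x|lebesgue. exp (\<i> * complex_of_real (p \<bullet> x)) * cnj (f x))"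
      by (simp add: exp_cnj)
    finally show ?thesis
      using wave_mult_integrable(2)[OF fc] by (simp add: fourier_def H_def)
  qed
  moreover have "cnj (f x) * ifourier k x = 1 / (2 * of_real pi) * (LINT p|lebesgue. H p x)" for x
    using wave_mult_integrable(2)[OF k] by (simp add: ifourier_alt H_def inner_commute mult.assoc mult.left_commute)
  ultimately show ?thesis using sw by simp
qed


section \<open>Approximation by continuous functions of bounded support\<close>

definition Cc :: "(plane \<Rightarrow> complex) set" where
  "Cc = {g. continuous_on UNIV g \<and> (\<exists>R. \<forall>x. norm x > R \<longrightarrow> g x = 0)}"

lemma Cc_bounded: assumes "g \<in> Cc" shows "\<exists>B>0. \<forall>x. cmod (g x) \<le> B"
proof -
  obtain R where R: "\<And>x. norm x > R \<Longrightarrow> g x = 0" and c: "continuous_on UNIV g"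
    using assms by (auto simp: Cc_def)
  have "compact (g ` cball 0 R)"
    by (intro compact_continuous_image continuous_on_subset[OF c]) auto
  from compact_imp_bounded[OF this] obtain B where "\<forall>y\<in>g ` cball 0 R. cmod y \<le> B"
    unfolding bounded_iff by blast
  then have B: "\<And>x. x \<in> cball 0 R \<Longrightarrow> cmod (g x) \<le> B" by blast
  have "cmod (g x) \<le> max B 1" for x
    using B[of x] R[of x] by (cases "norm x \<le> R") auto
  then show ?thesis by (intro exI[of _ "max B 1"]) auto
qed

lemma Cc_diff: assumes "f \<in> Cc" "g \<in> Cc" shows "(\<lambda>x. f x - g x) \<in> Cc"
proof -
  obtain R S where "\<And>x. norm x > R \<Longrightarrow> f x = 0" "\<And>x. norm x > S \<Longrightarrow> g x = 0"
    using assms by (auto simp: Cc_def)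
  then have "\<exists>R. \<forall>x. norm x > R \<longrightarrow> f x - g x = 0"
    by (intro exI[of _ "max R S"]) auto
  then show ?thesis using assms by (auto simp: Cc_def intro!: continuous_on_diff)
qed

lemma lebesgue_indicator_cball_integrable: "integrable lebesgue (\<lambda>x::plane. B * indicator (cball 0 R) x :: real)"
  using lmeasurable_cball[of "0::plane" R]
  by (intro integrable_mult_right integrable_real_indicator) (auto simp: fmeasurable_def)

lemma bounded_support_integrable:
  fixes g :: "plane \<Rightarrow> 'b::euclidean_space"
  assumes "g \<in> borel_measurable lebesgue" "\<And>x. norm (g x) \<le> B" "\<And>x. norm x > R \<Longrightarrow> g x = 0"
  shows "integrable lebesgue g" "g \<in> L2"
proof -
  show "integrable lebesgue g"
    by (rule Bochner_Integration.integrable_bound[OF lebesgue_indicator_cball_integrable[of B R] assms(1)])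
       (use assms in \<open>auto intro!: AE_I2 order.trans[OF _ abs_ge_self] simp: indicator_def not_le\<close>)
  show "g \<in> L2"
    by (rule L2I[OF assms(1) lebesgue_indicator_cball_integrable[of "B\<^sup>2" R]])
       (use assms in \<open>auto intro!: AE_I2 power_mono simp: indicator_def not_le\<close>)
qed

lemma Cc_integrable: assumes "g \<in> Cc" shows "integrable lebesgue g" "g \<in> L2"
proof -
  obtain R where R: "\<And>x. norm x > R \<Longrightarrow> g x = 0" and c: "continuous_on UNIV g"
    using assms by (auto simp: Cc_def)
  obtain B where B: "\<And>x. cmod (g x) \<le> B" using Cc_bounded[OF assms] by auto
  show "integrable lebesgue g" "g \<in> L2"
    using bounded_support_integrable[OF continuous_imp_lebesgue_measurable[OF c] B R] by auto
qed

text \<open>For positive \<open>B\<close> the radial retraction of the complex plane onto the disc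
  of radius \<open>B\<close>.\<close>

definition clip :: "real \<Rightarrow> complex \<Rightarrow> complex" where
  "clip B z = z * of_real (B / max B (cmod z))"

lemma clip_continuous:
  assumes "0 < B"
  shows "continuous_on UNIV (clip B)" "cmod (clip B z) \<le> B" "cmod z \<le> B \<Longrightarrow> clip B z = z"
proof -
  show "continuous_on UNIV (clip B)" unfolding clip_def using assms
    by (intro continuous_intros) (auto simp: max_def)
  show "cmod (clip B z) \<le> B"
    using assms by (simp add: clip_def norm_mult norm_divide field_simps max_def)
  show "cmod z \<le> B \<Longrightarrow> clip B z = z" using assms by (simp add: clip_def max_def)
qed

text \<open>A measurable function is almost everywhere a limit of continuous functions. Clipping
  their values and multiplying by a bump gives a common majorant, a multiple of the indicator of a
  disc, so that dominated convergence yields both norms at once.\<close>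

lemma Cc_approx_bounded:
  fixes f :: "plane \<Rightarrow> complex"
  assumes f: "f \<in> borel_measurable lebesgue" and B: "\<And>x. cmod (f x) \<le> B" and R: "\<And>x. norm x > R \<Longrightarrow> f x = 0"
  shows "\<exists>g. (\<forall>n. g n \<in> Cc) \<and> (\<lambda>n. LINT x|lebesgue. cmod (f x - g n x)) \<longlonglongrightarrow> 0 \<and>
      (\<lambda>n. l2sq (\<lambda>x. f x - g n x)) \<longlonglongrightarrow> 0"
proof -
  obtain N h where N: "negligible N" and h: "\<And>n. continuous_on UNIV (h n)"
    and lim: "\<And>x. x \<notin> N \<Longrightarrow> (\<lambda>n. h n x) \<longlonglongrightarrow> f x"
    using lebesgue_measurable_imp_measurable_on[OF f, of UNIV] by (auto simp: measurable_on_def)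
  define B' where "B' = max B 1"
  have B': "B' > 0" "\<And>x. cmod (f x) \<le> B'" using B by (auto simp: B'_def intro: max.coboundedI1)
  note clip = clip_continuous[OF B'(1)]
  define bump where "bump x = max 0 (min 1 (R + 1 - norm x))" for x :: plane
  have bump: "continuous_on UNIV bump" "0 \<le> bump x" "bump x \<le> 1" "norm x \<le> R \<Longrightarrow> bump x = 1" "norm x > R + 1 \<Longrightarrow> bump x = 0" for x
    unfolding bump_def by (auto intro!: continuous_intros)
  define g where "g n x = of_real (bump x) * clip B' (h n x)" for n x
  have gc: "continuous_on UNIV (g n)" for n
    unfolding g_def
    by (intro continuous_intros bump continuous_on_compose2[OF clip(1) h]) auto
  have gs: "g n x = 0" if "norm x > R + 1" for n x using bump(5)[OF that] by (simp add: g_def)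
  have gCc: "g n \<in> Cc" for n using gc gs by (auto simp: Cc_def)
  have gb: "cmod (g n x) \<le> B'" for n x
  proof -
    have "cmod (g n x) = bump x * cmod (clip B' (h n x))" using bump(2) by (simp add: g_def norm_mult)
    also have "\<dots> \<le> 1 * B'" using bump(2,3) clip(2) B'(1) by (intro mult_mono) auto
    finally show ?thesis by simp
  qed
  have gl: "(\<lambda>n. g n x) \<longlonglongrightarrow> f x" if "x \<notin> N" for x
  proof -
    have "(\<lambda>n. clip B' (h n x)) \<longlonglongrightarrow> clip B' (f x)"
      using clip(1) lim[OF that] by (intro continuous_on_tendsto_compose[OF clip(1)]) auto
    then have "(\<lambda>n. g n x) \<longlonglongrightarrow> of_real (bump x) * f x"
      unfolding g_def clip(3)[OF B'(2)] by (intro tendsto_intros)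
    moreover have "of_real (bump x) * f x = f x" using R[of x] bump(4)[of x] by (cases "norm x \<le> R") auto
    ultimately show ?thesis by simp
  qed
  note [measurable] = f continuous_imp_lebesgue_measurable[OF gc]
  have dom: "cmod (f x - g n x) \<le> 2 * B' * indicator (cball 0 (R + 1)) x" for n x
  proof (cases "norm x \<le> R + 1")
    case True
    then show ?thesis using norm_triangle_ineq4[of "f x" "g n x"] gb[of n x] B'(2)[of x] by simp
  next
    case False
    then show ?thesis using gs[of x n] R[of x] by simp
  qed
  have AEl: "AE x in lebesgue. x \<notin> N" using N by (simp add: negligible_iff_null_sets AE_not_in)
  have d0: "AE x in lebesgue. (\<lambda>n. cmod (f x - g n x)) \<longlonglongrightarrow> 0"
    using AEl
  proof eventually_elim
    case (elim x)
    have "(\<lambda>n. cmod (f x - g n x)) \<longlonglongrightarrow> cmod (f x - f x)" by (intro tendsto_intros gl elim)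
    then show ?case by simp
  qed
  have 1: "(\<lambda>n. LINT x|lebesgue. cmod (f x - g n x)) \<longlonglongrightarrow> (LINT x::plane|lebesgue. 0)"
    by (rule integral_dominated_convergence[OF _ _ lebesgue_indicator_cball_integrable[of "2 * B'" "R + 1"] d0])
       (measurable, use dom in auto)
  have d1: "AE x in lebesgue. (\<lambda>n. (cmod (f x - g n x))\<^sup>2) \<longlonglongrightarrow> 0"
    using d0 by eventually_elim (use tendsto_power[where n=2] in fastforce)
  have 2: "(\<lambda>n. LINT x|lebesgue. (cmod (f x - g n x))\<^sup>2) \<longlonglongrightarrow> (LINT x::plane|lebesgue. 0)"
  proof (rule integral_dominated_convergence[OF _ _ lebesgue_indicator_cball_integrable[of "(2 * B')\<^sup>2" "R + 1"] d1])
    show "AE x in lebesgue. norm ((cmod (f x - g n x))\<^sup>2) \<le> (2 * B')\<^sup>2 * indicator (cball 0 (R + 1)) x" for n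
    proof (rule AE_I2)
      fix x
      have "(cmod (f x - g n x))\<^sup>2 \<le> (2 * B' * indicator (cball 0 (R + 1)) x)\<^sup>2"
        by (intro power_mono dom) auto
      also have "\<dots> = (2 * B')\<^sup>2 * indicator (cball 0 (R + 1)) x"
        by (auto simp: indicator_def power_mult_distrib)
      finally show "norm ((cmod (f x - g n x))\<^sup>2) \<le> (2 * B')\<^sup>2 * indicator (cball 0 (R + 1)) x" by simp
    qed
  qed measurable
  show ?thesis using gCc 1 2 unfolding l2sq_def by auto
qed

text \<open>Domain and range are cut off together: the result is integrable as well as
  square-integrable, as the approximants that define the transform on \<open>L2\<close> have to
  be.\<close>

definition trunc :: "(plane \<Rightarrow> complex) \<Rightarrow> nat \<Rightarrow> plane \<Rightarrow> complex" where
  "trunc f n x = (if norm x \<le> real n \<and> cmod (f x) \<le> real n then f x else 0)"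

lemma truncation:
  fixes f :: "plane \<Rightarrow> complex"
  assumes f: "f \<in> L2"
  shows "trunc f n \<in> borel_measurable lebesgue" "integrable lebesgue (trunc f n)" "trunc f n \<in> L2"
    "(\<lambda>n. l2sq (\<lambda>x. trunc f n x - f x)) \<longlonglongrightarrow> 0"
    "integrable lebesgue f \<Longrightarrow> (\<lambda>n. LINT x|lebesgue. cmod (f x - trunc f n x)) \<longlonglongrightarrow> 0"
proof -
  note [measurable] = L2_measurable[OF f]
  have [measurable]: "norm \<in> borel_measurable (lebesgue :: plane measure)"
    by (rule borel_imp_lebesgue_measurable) measurable
  show m[measurable]: "trunc f n \<in> borel_measurable lebesgue" for n unfolding trunc_def by measurable
  have b: "cmod (trunc f n x) \<le> real n" "norm x > real n \<Longrightarrow> trunc f n x = 0" for n x by (auto simp: trunc_def)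
  show "integrable lebesgue (trunc f n)" "trunc f n \<in> L2" using bounded_support_integrable[OF m b] by auto
  have l: "(\<lambda>n. cmod (trunc f n x - f x)) \<longlonglongrightarrow> 0" for x
  proof -
    obtain k :: nat where k: "max (norm x) (cmod (f x)) \<le> real k" using real_arch_simple by blast
    have "\<forall>\<^sub>F n in sequentially. cmod (trunc f n x - f x) = 0"
      using eventually_ge_at_top[of k]
    proof eventually_elim
      case (elim n)
      then have "real k \<le> real n" by simp
      then show ?case using k by (simp add: trunc_def)
    qed
    then show ?thesis by (rule tendsto_eventually)
  qed
  have le: "cmod (trunc f n x - f x) \<le> cmod (f x)" for n x by (simp add: trunc_def)
  have "(\<lambda>n. LINT x|lebesgue. (cmod (trunc f n x - f x))\<^sup>2) \<longlonglongrightarrow> (LINT x::plane|lebesgue. 0)"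
  proof (rule integral_dominated_convergence[OF _ _ L2_integrable[OF f]])
    show "AE x in lebesgue. (\<lambda>n. (cmod (trunc f n x - f x))\<^sup>2) \<longlonglongrightarrow> 0"
      using tendsto_power[OF l, of _ 2] by simp
    show "AE x in lebesgue. norm ((cmod (trunc f n x - f x))\<^sup>2) \<le> (cmod (f x))\<^sup>2" for n
      using le by (intro AE_I2) (simp add: power_mono)
  qed measurable
  then show "(\<lambda>n. l2sq (\<lambda>x. trunc f n x - f x)) \<longlonglongrightarrow> 0" by (simp add: l2sq_def)
  assume fi: "integrable lebesgue f"
  have "(\<lambda>n. LINT x|lebesgue. cmod (f x - trunc f n x)) \<longlonglongrightarrow> (LINT x::plane|lebesgue. 0)"
  proof (rule integral_dominated_convergence[OF _ _ integrable_norm[OF fi]])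
    show "AE x in lebesgue. (\<lambda>n. cmod (f x - trunc f n x)) \<longlonglongrightarrow> 0"
      using l by (simp add: norm_minus_commute)
    show "AE x in lebesgue. norm (cmod (f x - trunc f n x)) \<le> norm (f x)" for n
      using le by (intro AE_I2) (simp add: norm_minus_commute)
  qed measurable
  then show "(\<lambda>n. LINT x|lebesgue. cmod (f x - trunc f n x)) \<longlonglongrightarrow> 0" by simp
qed

text \<open>Both distances are wanted for the same approximant: the L1 distance gives uniform
  convergence of the transforms, the \<open>L2\<close> distance gives their limit in
  \<open>L2\<close>.\<close>

lemma Cc_dense:
  fixes f :: "plane \<Rightarrow> complex"
  assumes f: "f \<in> L2" and fi: "integrable lebesgue f" and \<delta>: "\<delta> > 0"
  shows "\<exists>g\<in>Cc. l2sq (\<lambda>x. f x - g x) < \<delta> \<and> (LINT x|lebesgue. cmod (f x - g x)) < \<delta>"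
proof -
  note T = truncation[OF f]
  have "\<forall>\<^sub>F n in sequentially. l2sq (\<lambda>x. trunc f n x - f x) < \<delta> / 4 \<and> (LINT x|lebesgue. cmod (f x - trunc f n x)) < \<delta> / 2"
    using \<delta> by (intro eventually_conj order_tendstoD(2)[OF T(4)] order_tendstoD(2)[OF T(5)[OF fi]]) auto
  then obtain n where n: "l2sq (\<lambda>x. trunc f n x - f x) < \<delta> / 4" "(LINT x|lebesgue. cmod (f x - trunc f n x)) < \<delta> / 2"
    by (auto simp: eventually_sequentially)
  have b: "cmod (trunc f n x) \<le> real n" "norm x > real n \<Longrightarrow> trunc f n x = 0" for x by (auto simp: trunc_def)
  obtain g where g: "\<And>k. g k \<in> Cc" and lim: "(\<lambda>k. LINT x|lebesgue. cmod (trunc f n x - g k x)) \<longlonglongrightarrow> 0"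
      "(\<lambda>k. l2sq (\<lambda>x. trunc f n x - g k x)) \<longlonglongrightarrow> 0"
    using Cc_approx_bounded[OF T(1) b] by blast
  have "\<forall>\<^sub>F k in sequentially. l2sq (\<lambda>x. trunc f n x - g k x) < \<delta> / 4 \<and> (LINT x|lebesgue. cmod (trunc f n x - g k x)) < \<delta> / 2"
    using \<delta> by (intro eventually_conj order_tendstoD(2)[OF lim(2)] order_tendstoD(2)[OF lim(1)]) auto
  then obtain k where k: "l2sq (\<lambda>x. trunc f n x - g k x) < \<delta> / 4" "(LINT x|lebesgue. cmod (trunc f n x - g k x)) < \<delta> / 2"
    by (auto simp: eventually_sequentially)
  have "l2sq (\<lambda>x. f x - g k x) \<le> 2 * l2sq (\<lambda>x. trunc f n x - f x) + 2 * l2sq (\<lambda>x. trunc f n x - g k x)"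
    using l2sq_triangle[OF f T(3)[of n] Cc_integrable(2)[OF g[of k]]] l2sq_commute[of f "trunc f n"] by simp
  then have 1: "l2sq (\<lambda>x. f x - g k x) < \<delta>" using n k by simp
  note gi = Cc_integrable(1)[OF g[of k]]
  have "(LINT x|lebesgue. cmod (f x - g k x)) \<le> (LINT x|lebesgue. cmod (f x - trunc f n x) + cmod (trunc f n x - g k x))"
    using fi T(2)[of n] gi by (intro integral_mono) (auto intro: norm_triangle_sub order.trans[OF _ norm_triangle_ineq])
  also have "\<dots> = (LINT x|lebesgue. cmod (f x - trunc f n x)) + (LINT x|lebesgue. cmod (trunc f n x - g k x))"
    using fi T(2)[of n] gi by (intro Bochner_Integration.integral_add) auto
  finally have "(LINT x|lebesgue. cmod (f x - g k x)) < \<delta>" using n k by simp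
  then show ?thesis using 1 g[of k] by blast
qed

section \<open>Plancherel's theorem\<close>

text \<open>Gaussian regularisation of \<open>\<integral> |fourier g|\<^sup>2\<close> turns it into the pairing of \<open>g\<close> with an
  approximate identity applied to \<open>g\<close>.\<close>

lemma regularised_Plancherel:
  assumes g: "integrable lebesgue g" and \<epsilon>: "\<epsilon> > 0"
  shows "integrable lebesgue (\<lambda>p. (cmod (fourier g p))\<^sup>2 * gauss (\<epsilon> *\<^sub>R p))"
    and "complex_of_real (LINT p|lebesgue. (cmod (fourier g p))\<^sup>2 * gauss (\<epsilon> *\<^sub>R p))
       = (LINT x|lebesgue. cnj (g x) * (1 / (2 * of_real pi) * (LINT z|lebesgue. of_real (gauss z) * g (x + \<epsilon> *\<^sub>R z))))"
proof -
  note [measurable] = borel_measurable_integrable[OF g] fourier_measurable[OF g]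
  have gI: "integrable lebesgue (\<lambda>p. complex_of_real (gauss (\<epsilon> *\<^sub>R p)))"
    using gauss_scaled(1)[OF \<epsilon>, of 0] by simp
  have gIr: "integrable lebesgue (\<lambda>p. gauss (\<epsilon> *\<^sub>R p))"
    using integrable_Re[OF gI] by simp
  have [measurable]: "(\<lambda>p. gauss (\<epsilon> *\<^sub>R p)) \<in> borel_measurable lebesgue"
    by (rule borel_measurable_integrable[OF gIr])
  have gpos: "0 \<le> gauss p" for p by (simp add: gauss_def)
  define M where "M = (LINT x|lebesgue. cmod (g x)) / (2 * pi)"
  have M: "cmod (fourier g p) \<le> M" for p unfolding M_def by (rule fourier_bound[OF g])
  have M0: "0 \<le> M" using M[of 0] norm_ge_zero order.trans by blast
  define k where "k p = fourier g p * complex_of_real (gauss (\<epsilon> *\<^sub>R p))" for p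
  have km[measurable]: "k \<in> borel_measurable lebesgue" unfolding k_def by measurable
  have k: "integrable lebesgue k"
  proof (rule Bochner_Integration.integrable_bound[OF integrable_mult_right[OF gIr, of M] km])
    show "AE p in lebesgue. norm (k p) \<le> norm (M * gauss (\<epsilon> *\<^sub>R p))"
      using M gpos M0 by (intro AE_I2) (simp add: k_def norm_mult mult_right_mono)
  qed
  show "integrable lebesgue (\<lambda>p. (cmod (fourier g p))\<^sup>2 * gauss (\<epsilon> *\<^sub>R p))"
  proof (rule Bochner_Integration.integrable_bound[OF integrable_mult_right[OF gIr, of "M\<^sup>2"]])
    show "AE p in lebesgue. norm ((cmod (fourier g p))\<^sup>2 * gauss (\<epsilon> *\<^sub>R p)) \<le> norm (M\<^sup>2 * gauss (\<epsilon> *\<^sub>R p))"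
      using M gpos by (intro AE_I2) (simp add: norm_mult mult_right_mono power_mono)
  qed measurable
  have "complex_of_real (LINT p|lebesgue. (cmod (fourier g p))\<^sup>2 * gauss (\<epsilon> *\<^sub>R p))
      = (LINT p|lebesgue. complex_of_real ((cmod (fourier g p))\<^sup>2 * gauss (\<epsilon> *\<^sub>R p)))"
    by (rule integral_complex_of_real[symmetric])
  also have "\<dots> = (LINT p|lebesgue. cnj (fourier g p) * k p)"
    by (intro Bochner_Integration.integral_cong refl)
       (simp only: k_def of_real_mult complex_norm_square, simp)
  also have "\<dots> = (LINT x|lebesgue. cnj (g x) * ifourier k x)"
    by (rule fourier_adjoint[OF g k])
  also have "\<dots> = (LINT x|lebesgue. cnj (g x) * (1 / (2 * of_real pi) * (LINT z|lebesgue. of_real (gauss z) * g (x + \<epsilon> *\<^sub>R z))))"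
  proof (intro Bochner_Integration.integral_cong refl arg_cong2[where f = "(*)"])
    fix x :: plane
    \<comment> \<open>The value of \<open>ifourier k\<close> at x is computed by a second use of the
      adjoint identity, now with the Gaussian modulated by the wave at x; the inverse transform of
      \<open>k'\<close> is a Gaussian centred at x.\<close>
    define k' where "k' p = exp (- \<i> * complex_of_real (x \<bullet> p)) * complex_of_real (gauss (\<epsilon> *\<^sub>R p))" for p
    have k': "integrable lebesgue k'" unfolding k'_def by (rule wave_mult_integrable(1)[OF gI])
    have "ifourier k' y = complex_of_real (1 / \<epsilon>\<^sup>2 * gauss ((1 / \<epsilon>) *\<^sub>R (y - x)))" for y
    proof -
      have "exp (\<i> * of_real (y \<bullet> p)) * k' p = exp (\<i> * complex_of_real (p \<bullet> (y - x))) * complex_of_real (gauss (\<epsilon> *\<^sub>R p))" for p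
        by (simp add: k'_def inner_diff_right inner_commute right_diff_distrib mult.assoc[symmetric] exp_add[symmetric])
      then show ?thesis unfolding ifourier_alt by (simp only: gauss_scaled(2)[OF \<epsilon>]) simp
    qed
    then have A: "(LINT p|lebesgue. cnj (fourier g p) * k' p)
        = (LINT y|lebesgue. cnj (g y) * complex_of_real (1 / \<epsilon>\<^sup>2 * gauss ((1 / \<epsilon>) *\<^sub>R (y - x))))"
      using fourier_adjoint[OF g k'] by simp
    have cI: "integrable lebesgue (\<lambda>p. cnj (fourier g p) * k' p)"
    proof (rule Bochner_Integration.integrable_bound[OF integrable_mult_right[OF gIr, of M]])
      note [measurable] = borel_measurable_integrable[OF k']
      show "(\<lambda>p. cnj (fourier g p) * k' p) \<in> borel_measurable lebesgue" by measurable
      show "AE p in lebesgue. norm (cnj (fourier g p) * k' p) \<le> norm (M * gauss (\<epsilon> *\<^sub>R p))"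
        using M gpos M0 by (intro AE_I2) (simp add: k'_def norm_mult mult_right_mono)
    qed
    have "(LINT p|lebesgue. exp (\<i> * of_real (x \<bullet> p)) * k p) = (LINT p|lebesgue. cnj (cnj (fourier g p) * k' p))"
      by (intro Bochner_Integration.integral_cong refl) (simp add: k_def k'_def exp_cnj)
    also have "\<dots> = cnj (LINT p|lebesgue. cnj (fourier g p) * k' p)"
      by (rule integral_bounded_linear[OF bounded_linear_cnj cI])
    also have "\<dots> = cnj (\<epsilon>\<^sup>2 *\<^sub>R (LINT z|lebesgue. cnj (g (x + \<epsilon> *\<^sub>R z)) * complex_of_real (1 / \<epsilon>\<^sup>2 * gauss z)))"
    proof -
      have m: "(\<lambda>y. cnj (g y) * complex_of_real (1 / \<epsilon>\<^sup>2 * gauss ((1 / \<epsilon>) *\<^sub>R (y - x)))) \<in> borel_measurable lebesgue"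
      proof -
        have [measurable]: "(\<lambda>y. gauss ((1 / \<epsilon>) *\<^sub>R (y - x))) \<in> borel_measurable lebesgue"
          by (rule borel_imp_lebesgue_measurable) measurable
        show ?thesis by measurable
      qed
      show ?thesis unfolding A
        by (subst lebesgue_integral_affine(2)[OF m, of \<epsilon> x]) (use \<epsilon> in auto)
    qed
    also have "\<dots> = (LINT z|lebesgue. of_real (gauss z) * g (x + \<epsilon> *\<^sub>R z))"
    proof -
      have gx: "integrable lebesgue (\<lambda>z. g (x + \<epsilon> *\<^sub>R z))"
        using lebesgue_integral_affine(1)[of g \<epsilon> x] g \<epsilon> by simp
      note [measurable] = borel_measurable_integrable[OF gx]
      have i: "integrable lebesgue (\<lambda>z. cnj (g (x + \<epsilon> *\<^sub>R z)) * complex_of_real (1 / \<epsilon>\<^sup>2 * gauss z))"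
        by (rule Bochner_Integration.integrable_bound[OF integrable_mult_right[OF gx, of "complex_of_real (1 / \<epsilon>\<^sup>2)"]])
           (measurable, simp add: norm_mult norm_divide gauss_def mult_left_le divide_right_mono)
      have "cnj (\<epsilon>\<^sup>2 *\<^sub>R (LINT z|lebesgue. cnj (g (x + \<epsilon> *\<^sub>R z)) * complex_of_real (1 / \<epsilon>\<^sup>2 * gauss z)))
         = \<epsilon>\<^sup>2 *\<^sub>R (LINT z|lebesgue. cnj (cnj (g (x + \<epsilon> *\<^sub>R z)) * complex_of_real (1 / \<epsilon>\<^sup>2 * gauss z)))"
        unfolding integral_bounded_linear[OF bounded_linear_cnj i]
        by (simp add: scaleR_conv_of_real)
      also have "\<dots> = (LINT z|lebesgue. \<epsilon>\<^sup>2 *\<^sub>R cnj (cnj (g (x + \<epsilon> *\<^sub>R z)) * complex_of_real (1 / \<epsilon>\<^sup>2 * gauss z)))"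
        by (rule integral_scaleR_right[symmetric])
      also have "\<dots> = (LINT z|lebesgue. of_real (gauss z) * g (x + \<epsilon> *\<^sub>R z))"
        using \<epsilon> by (intro Bochner_Integration.integral_cong refl) (simp add: scaleR_conv_of_real field_simps)
      finally show ?thesis .
    qed
    finally show "ifourier k x = 1 / (2 * of_real pi) * (LINT z|lebesgue. of_real (gauss z) * g (x + \<epsilon> *\<^sub>R z))"
      by (simp add: ifourier_alt)
  qed
  finally show "complex_of_real (LINT p|lebesgue. (cmod (fourier g p))\<^sup>2 * gauss (\<epsilon> *\<^sub>R p))
       = (LINT x|lebesgue. cnj (g x) * (1 / (2 * of_real pi) * (LINT z|lebesgue. of_real (gauss z) * g (x + \<epsilon> *\<^sub>R z))))" .
qed

text \<open>The regularised identity as \<epsilon> tends to 0. On the side of g, continuity and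
  boundedness allow dominated convergence; on the side of the transform, the Gaussian weights
  increase to 1, and monotone convergence gives integrability together with the value.\<close>

lemma Plancherel_Cc:
  assumes "g \<in> Cc" shows "fourier g \<in> L2" "l2sq (fourier g) = l2sq g"
proof -
  have gI: "integrable lebesgue g" and gL2: "g \<in> L2" using Cc_integrable[OF assms] by auto
  have gc: "continuous_on UNIV g" using assms by (simp add: Cc_def)
  obtain B where B: "\<And>x. cmod (g x) \<le> B" "B > 0" using Cc_bounded[OF assms] by auto
  define \<epsilon> where "\<epsilon> n = 1 / real (Suc n)" for n
  have \<epsilon>: "\<epsilon> n > 0" for n by (simp add: \<epsilon>_def)
  have \<epsilon>0: "\<epsilon> \<longlonglongrightarrow> 0" unfolding \<epsilon>_def by (rule LIMSEQ_Suc[OF lim_const_over_n[of 1]])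
  have gaI: "integrable lebesgue (\<lambda>z. complex_of_real (gauss z))"
    and ga: "(LINT z|lebesgue. complex_of_real (gauss z)) = 2 * of_real pi"
    using gauss_fourier[of 0] by (simp_all add: gauss_def)
  have gaIr: "integrable lebesgue gauss" using integrable_Re[OF gaI] by simp
  have gpos: "0 \<le> gauss p" for p by (simp add: gauss_def)
  define S where "S n x = 1 / (2 * of_real pi) * (LINT z|lebesgue. of_real (gauss z) * g (x + \<epsilon> n *\<^sub>R z))" for n x
  have gm[measurable]: "(\<lambda>z. g (x + e *\<^sub>R z)) \<in> borel_measurable lebesgue" for x e
    by (intro continuous_imp_lebesgue_measurable continuous_on_compose2[OF gc] continuous_intros) auto
  have dom: "norm (of_real (gauss z) * g (x + e *\<^sub>R z)) \<le> B * gauss z" for x z e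
    using mult_left_mono[OF B(1)[of "x + e *\<^sub>R z"] gpos[of z]] gpos[of z]
    by (simp add: norm_mult mult.commute)
  have Sl: "(\<lambda>n. S n x) \<longlonglongrightarrow> g x" for x
  proof -
    have "(\<lambda>n. LINT z|lebesgue. of_real (gauss z) * g (x + \<epsilon> n *\<^sub>R z)) \<longlonglongrightarrow> (LINT z|lebesgue. of_real (gauss z) * g x)"
    proof (rule integral_dominated_convergence[OF _ _ integrable_mult_right[OF gaIr, of B]])
      show "AE z in lebesgue. (\<lambda>n. of_real (gauss z) * g (x + \<epsilon> n *\<^sub>R z)) \<longlonglongrightarrow> of_real (gauss z) * g x"
      proof (rule AE_I2)
        fix z
        have "(\<lambda>n. x + \<epsilon> n *\<^sub>R z) \<longlonglongrightarrow> x + 0 *\<^sub>R z" by (intro tendsto_intros \<epsilon>0)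
        then have "(\<lambda>n. g (x + \<epsilon> n *\<^sub>R z)) \<longlonglongrightarrow> g x"
          by (intro continuous_on_tendsto_compose[OF gc]) auto
        then show "(\<lambda>n. of_real (gauss z) * g (x + \<epsilon> n *\<^sub>R z)) \<longlonglongrightarrow> of_real (gauss z) * g x"
          by (intro tendsto_intros)
      qed
      show "AE z in lebesgue. norm (of_real (gauss z) * g (x + \<epsilon> n *\<^sub>R z)) \<le> B * gauss z" for n
        using dom by simp
    qed measurable
    also have "(LINT z|lebesgue. of_real (gauss z) * g x) = 2 * of_real pi * g x" using gaI ga by simp
    finally have "(\<lambda>n. S n x) \<longlonglongrightarrow> 1 / (2 * of_real pi) * (2 * of_real pi * g x)"
      unfolding S_def by (intro tendsto_mult tendsto_const)
    then show ?thesis by simp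
  qed
  have Sb: "cmod (S n x) \<le> B" for n x
  proof -
    have "cmod (LINT z|lebesgue. of_real (gauss z) * g (x + \<epsilon> n *\<^sub>R z))
        \<le> (LINT z|lebesgue. cmod (of_real (gauss z) * g (x + \<epsilon> n *\<^sub>R z)))" by (rule integral_norm_bound)
    also have "\<dots> \<le> (LINT z|lebesgue. B * gauss z)"
      by (rule integral_mono_AE'[OF integrable_mult_right[OF gaIr]]) (use dom B gpos in auto)
    also have "\<dots> = B * (2 * pi)"
    proof -
      have "complex_of_real (LINT z|lebesgue. gauss z) = complex_of_real (2 * pi)"
        using ga by (simp only: integral_complex_of_real) simp
      then show ?thesis by (simp only: of_real_eq_iff) simp
    qed
    finally show ?thesis by (simp add: S_def norm_mult norm_divide field_simps)
  qed
  define I where "I n = (LINT p|lebesgue. (cmod (fourier g p))\<^sup>2 * gauss (\<epsilon> n *\<^sub>R p))" for n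
  note reg = regularised_Plancherel[OF gI \<epsilon>]
  have Ieq: "complex_of_real (I n) = (LINT x|lebesgue. cnj (g x) * S n x)" for n
    unfolding I_def S_def by (rule reg(2))
  have "(\<lambda>n. LINT x|lebesgue. cnj (g x) * S n x) \<longlonglongrightarrow> (LINT x|lebesgue. cnj (g x) * g x)"
  proof (rule integral_dominated_convergence[OF _ _ integrable_mult_right[OF integrable_norm[OF gI], of B]])
    \<comment> \<open>Measurability of the inner integral is taken from the Borel side: g is
      continuous, so the integrand is Borel measurable in both variables jointly.\<close>
    show "(\<lambda>x. cnj (g x) * S n x) \<in> borel_measurable lebesgue" for n
    proof -
      have [measurable]: "g \<in> borel_measurable borel" by (rule borel_measurable_continuous_onI[OF gc])
      have "(\<lambda>z. of_real (gauss (snd z)) * g (fst z + \<epsilon> n *\<^sub>R snd z)) \<in> borel_measurable ((borel :: plane measure) \<Otimes>\<^sub>M (borel :: plane measure))"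
        by measurable
      then have "(\<lambda>x. LINT z|lborel. of_real (gauss z) * g (x + \<epsilon> n *\<^sub>R z)) \<in> borel_measurable (borel :: plane measure)"
        by (intro lborel.borel_measurable_lebesgue_integral) (simp add: case_prod_beta')
      moreover have "(LINT z|lebesgue. of_real (gauss z) * g (x + \<epsilon> n *\<^sub>R z)) = (LINT z|lborel. of_real (gauss z) * g (x + \<epsilon> n *\<^sub>R z))" for x
        by (rule integral_completion) measurable
      ultimately have "S n \<in> borel_measurable borel" unfolding S_def by simp
      from borel_imp_lebesgue_measurable[OF this] L2_measurable[OF gL2] show ?thesis by measurable
    qed
    show "(\<lambda>x. cnj (g x) * g x) \<in> borel_measurable lebesgue" by (rule borel_measurable_integrable[OF ip2_integrable[OF gL2 gL2]])
    show "AE x in lebesgue. (\<lambda>n. cnj (g x) * S n x) \<longlonglongrightarrow> cnj (g x) * g x"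
      by (intro AE_I2 tendsto_intros Sl)
    show "AE x in lebesgue. norm (cnj (g x) * S n x) \<le> B * norm (g x)" for n
      using mult_right_mono[OF Sb norm_ge_zero] by (intro AE_I2) (simp add: norm_mult mult.commute)
  qed
  then have "(\<lambda>n. complex_of_real (I n)) \<longlonglongrightarrow> complex_of_real (l2sq g)"
    unfolding Ieq using ip2_self[OF gL2] by (simp add: ip2_def)
  then have Il: "I \<longlonglongrightarrow> l2sq g" by (simp only: tendsto_of_real_iff)
  have mono: "AE p in lebesgue. mono (\<lambda>n. (cmod (fourier g p))\<^sup>2 * gauss (\<epsilon> n *\<^sub>R p))"
  proof (intro AE_I2 monoI mult_left_mono)
    fix p :: plane and m n :: nat assume "m \<le> n"
    then have "\<epsilon> n \<le> \<epsilon> m" by (simp add: \<epsilon>_def frac_le)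
    then have "(\<epsilon> n * norm p)\<^sup>2 \<le> (\<epsilon> m * norm p)\<^sup>2"
      using \<epsilon>[of n] by (intro power_mono mult_right_mono) auto
    then show "gauss (\<epsilon> m *\<^sub>R p) \<le> gauss (\<epsilon> n *\<^sub>R p)"
      using \<epsilon>[of n] \<epsilon>[of m] by (simp add: gauss_def)
  qed simp
  have lim: "AE p in lebesgue. (\<lambda>n. (cmod (fourier g p))\<^sup>2 * gauss (\<epsilon> n *\<^sub>R p)) \<longlonglongrightarrow> (cmod (fourier g p))\<^sup>2"
  proof (rule AE_I2)
    fix p
    have "(\<lambda>n. (cmod (fourier g p))\<^sup>2 * exp (- (\<bar>\<epsilon> n\<bar> * norm p)\<^sup>2 / 2)) \<longlonglongrightarrow> (cmod (fourier g p))\<^sup>2 * exp (- (\<bar>0\<bar> * norm p)\<^sup>2 / 2)"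
      by (intro tendsto_intros \<epsilon>0) auto
    then show "(\<lambda>n. (cmod (fourier g p))\<^sup>2 * gauss (\<epsilon> n *\<^sub>R p)) \<longlonglongrightarrow> (cmod (fourier g p))\<^sup>2"
      by (simp add: gauss_def)
  qed
  have fm[measurable]: "fourier g \<in> borel_measurable lebesgue" by (rule fourier_measurable[OF gI])
  have sm: "(\<lambda>p. (cmod (fourier g p))\<^sup>2) \<in> borel_measurable lebesgue" by measurable
  have "integrable lebesgue (\<lambda>p. (cmod (fourier g p))\<^sup>2)"
    by (rule integrable_monotone_convergence[OF reg(1) mono lim Il[unfolded I_def[abs_def]] sm])
  then show "fourier g \<in> L2" using fm by (simp add: L2_def)
  show "l2sq (fourier g) = l2sq g" unfolding l2sq_def[of "fourier g"]
    by (rule integral_monotone_convergence[OF reg(1) mono lim Il[unfolded I_def[abs_def]] sm])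
qed

text \<open>Approximants from \<open>Cc\<close> converge to f in L1 and in \<open>L2\<close>. The
  first makes their transforms converge pointwise to \<open>fourier f\<close>, the second makes them
  converge in \<open>L2\<close> to some \<open>G\<close>; a subsequence shows that the two limits
  agree almost everywhere.\<close>

lemma Plancherel_L1_L2:
  assumes fI: "integrable lebesgue f" and f: "f \<in> L2"
  shows "fourier f \<in> L2" "l2sq (fourier f) = l2sq f"
proof -
  have "\<exists>g\<in>Cc. l2sq (\<lambda>x. f x - g x) < 1 / real (Suc n) \<and> (LINT x|lebesgue. cmod (f x - g x)) < 1 / real (Suc n)" for n
    by (rule Cc_dense[OF f fI]) simp
  then obtain g where g: "\<And>n. g n \<in> Cc" and g2: "\<And>n. l2sq (\<lambda>x. f x - g n x) < 1 / real (Suc n)"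
    and g1: "\<And>n. (LINT x|lebesgue. cmod (f x - g n x)) < 1 / real (Suc n)" by metis
  note gI = Cc_integrable(1)[OF g] and gL2 = Cc_integrable(2)[OF g]
  have lim0: "(\<lambda>n. 1 / real (Suc n)) \<longlonglongrightarrow> 0" by (rule LIMSEQ_Suc[OF lim_const_over_n[of 1]])
  have g2l: "(\<lambda>n. l2sq (\<lambda>x. g n x - f x)) \<longlonglongrightarrow> 0"
    by (rule tendsto_sandwich[OF _ _ tendsto_const lim0])
       (use g2 in \<open>auto simp: l2sq_nonneg l2sq_commute[of "g _"] less_imp_le\<close>)
  have FL2: "fourier (g n) \<in> L2" for n by (rule Plancherel_Cc(1)[OF g])
  have F_diff: "l2sq (\<lambda>p. fourier (g m) p - fourier (g n) p) = l2sq (\<lambda>x. g m x - g n x)" for m n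
  proof -
    have "fourier (\<lambda>x. g m x - g n x) = (\<lambda>p. fourier (g m) p - fourier (g n) p)"
      by (rule ext) (rule fourier_diff[OF gI gI])
    then show ?thesis using Plancherel_Cc(2)[OF Cc_diff[OF g g], of m n] by simp
  qed
  from L2_limit_transfer[OF gL2 f FL2 F_diff g2l] obtain G where G: "G \<in> L2" "(\<lambda>n. l2sq (\<lambda>p. fourier (g n) p - G p)) \<longlonglongrightarrow> 0"
    by blast
  obtain r where r: "strict_mono r" and rG: "AE p in lebesgue. (\<lambda>n. fourier (g (r n)) p) \<longlonglongrightarrow> G p"
    using L2_subseq_AE[OF FL2 G] by blast
  have Fl: "(\<lambda>n. fourier (g n) p) \<longlonglongrightarrow> fourier f p" for p
  proof -
    have "cmod (fourier (g n) p - fourier f p) \<le> 1 / real (Suc n)" for n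
    proof -
      have "cmod (fourier (g n) p - fourier f p) \<le> (LINT x|lebesgue. cmod (f x - g n x)) / (2 * pi)"
        using fourier_bound[OF Bochner_Integration.integrable_diff[OF fI gI[of n]], of p]
        by (simp add: fourier_diff[OF fI gI] norm_minus_commute)
      also have "\<dots> \<le> (LINT x|lebesgue. cmod (f x - g n x)) / 1"
        using pi_gt3 by (intro divide_left_mono) auto
      finally show ?thesis using g1[of n] by simp
    qed
    then have "(\<lambda>n. fourier (g n) p - fourier f p) \<longlonglongrightarrow> 0"
      by (intro Lim_null_comparison[OF _ lim0]) auto
    then show ?thesis by (simp add: LIM_zero_iff)
  qed
  have eq: "AE p in lebesgue. G p = fourier f p"
    using rG
  proof eventually_elim
    case (elim p)
    show ?case
      using LIMSEQ_unique[OF elim] LIMSEQ_subseq_LIMSEQ[OF Fl r, of p] by (simp add: o_def)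
  qed
  show "fourier f \<in> L2" by (rule L2_cong_AE[OF G(1) eq])
  have "(\<lambda>n. l2sq (fourier (g n))) \<longlonglongrightarrow> l2sq G" by (rule l2sq_tendsto[OF FL2 G])
  moreover have "(\<lambda>n. l2sq (fourier (g n))) \<longlonglongrightarrow> l2sq f"
    unfolding Plancherel_Cc(2)[OF g] by (rule l2sq_tendsto[OF gL2 f g2l])
  ultimately have "l2sq G = l2sq f" by (rule LIMSEQ_unique)
  then show "l2sq (fourier f) = l2sq f" using l2sq_cong_AE[OF G(1) eq] by simp
qed


text \<open>The property by which \<^const>\<open>fourier_L2\<close> selects its value.\<close>

definition fourier_rel :: "(plane \<Rightarrow> complex) \<Rightarrow> (plane \<Rightarrow> complex) \<Rightarrow> bool" where
  "fourier_rel f g \<longleftrightarrow> g \<in> L2 \<and>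
     (\<exists>u. (\<forall>n. integrable lebesgue (u n) \<and> u n \<in> L2) \<and>
          L2_tendsto u f \<and> L2_tendsto (\<lambda>n. fourier (u n)) g)"

lemma fourier_relD:
  assumes "fourier_rel f g" "f \<in> L2"
  shows "\<exists>u. (\<forall>n. integrable lebesgue (u n)) \<and> (\<forall>n. u n \<in> L2) \<and>
    (\<lambda>n. l2sq (\<lambda>x. u n x - f x)) \<longlonglongrightarrow> 0 \<and> g \<in> L2 \<and>
    (\<forall>n. fourier (u n) \<in> L2) \<and> (\<lambda>n. l2sq (\<lambda>p. fourier (u n) p - g p)) \<longlonglongrightarrow> 0"
proof -
  obtain u where u': "\<forall>n. integrable lebesgue (u n) \<and> u n \<in> L2"
    and g: "g \<in> L2" and l: "L2_tendsto u f" "L2_tendsto (\<lambda>n. fourier (u n)) g"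
    using assms(1) unfolding fourier_rel_def by blast
  have u: "integrable lebesgue (u n)" "u n \<in> L2" for n using u' by auto
  have F: "fourier (u n) \<in> L2" for n by (rule Plancherel_L1_L2(1)[OF u])
  have "(\<lambda>n. l2sq (\<lambda>x. u n x - f x)) \<longlonglongrightarrow> 0"
    using l(1) unfolding L2_tendsto_iff[OF u(2) assms(2)] .
  moreover have "(\<lambda>n. l2sq (\<lambda>p. fourier (u n) p - g p)) \<longlonglongrightarrow> 0"
    using l(2) unfolding L2_tendsto_iff[OF F g] .
  ultimately show ?thesis
    by (intro exI[of _ u] conjI allI u g F)
qed

lemma fourier_relI:
  assumes f: "f \<in> L2" and u: "\<And>n. integrable lebesgue (u n)" "\<And>n. u n \<in> L2"
    and l: "(\<lambda>n. l2sq (\<lambda>x. u n x - f x)) \<longlonglongrightarrow> 0" and g: "g \<in> L2"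
    and l': "(\<lambda>n. l2sq (\<lambda>p. fourier (u n) p - g p)) \<longlonglongrightarrow> 0"
  shows "fourier_rel f g"
proof -
  have F: "fourier (u n) \<in> L2" for n by (rule Plancherel_L1_L2(1)[OF u])
  have "L2_tendsto u f" using l unfolding L2_tendsto_iff[OF u(2) f] .
  moreover have "L2_tendsto (\<lambda>n. fourier (u n)) g" using l' unfolding L2_tendsto_iff[OF F g] .
  ultimately show ?thesis
    unfolding fourier_rel_def by (intro exI[of _ u] conjI allI u g)
qed

lemma fourier_rel_isometric:
  assumes "fourier_rel f g" "f \<in> L2" shows "l2sq g = l2sq f"
proof -
  obtain u where u': "\<forall>n. integrable lebesgue (u n)" "\<forall>n. u n \<in> L2"
    "(\<lambda>n. l2sq (\<lambda>x. u n x - f x)) \<longlonglongrightarrow> 0" "g \<in> L2"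
    "\<forall>n. fourier (u n) \<in> L2" "(\<lambda>n. l2sq (\<lambda>p. fourier (u n) p - g p)) \<longlonglongrightarrow> 0"
    using fourier_relD[OF assms] by blast
  note u = u'[rule_format]
  have "(\<lambda>n. l2sq (fourier (u n))) \<longlonglongrightarrow> l2sq g" by (rule l2sq_tendsto[OF u(5,4,6)])
  moreover have "(\<lambda>n. l2sq (fourier (u n))) \<longlonglongrightarrow> l2sq f"
    unfolding Plancherel_L1_L2(2)[OF u(1,2)] by (rule l2sq_tendsto[OF u(2) assms(2) u(3)])
  ultimately show ?thesis by (rule LIMSEQ_unique)
qed

lemma l2sq_combo_tendsto:
  fixes u v :: "nat \<Rightarrow> plane \<Rightarrow> complex"
  assumes u: "\<And>n. u n \<in> L2" and f: "f \<in> L2" and v: "\<And>n. v n \<in> L2" and g: "g \<in> L2"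
    and uf: "(\<lambda>n. l2sq (\<lambda>x. u n x - f x)) \<longlonglongrightarrow> 0"
    and vg: "(\<lambda>n. l2sq (\<lambda>x. v n x - g x)) \<longlonglongrightarrow> 0"
  shows "(\<lambda>n. l2sq (\<lambda>x. (c * u n x + v n x) - (c * f x + g x))) \<longlonglongrightarrow> 0"
proof (rule tendsto_sandwich[OF _ _ tendsto_const])
  have le: "l2sq (\<lambda>x. (c * u n x + v n x) - (c * f x + g x))
      \<le> 2 * ((cmod c)\<^sup>2 * l2sq (\<lambda>x. u n x - f x)) + 2 * l2sq (\<lambda>x. v n x - g x)" for n
    using l2sq_add_le[OF L2_mult[OF L2_diff[OF u f]] L2_diff[OF v g], of c n n]
    unfolding l2sq_mult by (simp add: algebra_simps)
  then show "\<forall>\<^sub>F n in sequentially. l2sq (\<lambda>x. (c * u n x + v n x) - (c * f x + g x))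
      \<le> 2 * ((cmod c)\<^sup>2 * l2sq (\<lambda>x. u n x - f x)) + 2 * l2sq (\<lambda>x. v n x - g x)"
    by (intro always_eventually allI)
  have "(\<lambda>n. 2 * ((cmod c)\<^sup>2 * l2sq (\<lambda>x. u n x - f x)) + 2 * l2sq (\<lambda>x. v n x - g x))
     \<longlonglongrightarrow> 2 * ((cmod c)\<^sup>2 * 0) + 2 * 0"
    by (intro tendsto_intros uf vg)
  then show "(\<lambda>n. 2 * ((cmod c)\<^sup>2 * l2sq (\<lambda>x. u n x - f x)) + 2 * l2sq (\<lambda>x. v n x - g x)) \<longlonglongrightarrow> 0"
    by simp
qed (intro always_eventually allI l2sq_nonneg)

text \<open>The choice made by \<open>fourier_L2\<close> is linear only up to null sets, whereas the
  relation respects linear combinations exactly. This is the reason for working with the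
  relation.\<close>

lemma fourier_rel_combo:
  assumes r: "fourier_rel f g" "fourier_rel f' g'" and f: "f \<in> L2" "f' \<in> L2"
  shows "fourier_rel (\<lambda>x. c * f x + f' x) (\<lambda>p. c * g p + g' p)"
proof -
  obtain u where u': "\<forall>n. integrable lebesgue (u n)" "\<forall>n. u n \<in> L2"
    "(\<lambda>n. l2sq (\<lambda>x. u n x - f x)) \<longlonglongrightarrow> 0" "g \<in> L2"
    "\<forall>n. fourier (u n) \<in> L2" "(\<lambda>n. l2sq (\<lambda>p. fourier (u n) p - g p)) \<longlonglongrightarrow> 0"
    using fourier_relD[OF r(1) f(1)] by blast
  note u = u'[rule_format]
  obtain v where v': "\<forall>n. integrable lebesgue (v n)" "\<forall>n. v n \<in> L2"
    "(\<lambda>n. l2sq (\<lambda>x. v n x - f' x)) \<longlonglongrightarrow> 0" "g' \<in> L2"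
    "\<forall>n. fourier (v n) \<in> L2" "(\<lambda>n. l2sq (\<lambda>p. fourier (v n) p - g' p)) \<longlonglongrightarrow> 0"
    using fourier_relD[OF r(2) f(2)] by blast
  note v = v'[rule_format]
  have F: "fourier (\<lambda>x. c * u n x + v n x) = (\<lambda>p. c * fourier (u n) p + fourier (v n) p)" for n
    by (rule ext) (simp add: fourier_add[OF integrable_mult_right v(1)] fourier_mult u(1))
  show ?thesis
  proof (rule fourier_relI[where u = "\<lambda>n x. c * u n x + v n x"])
    show "(\<lambda>n. l2sq (\<lambda>x. (c * u n x + v n x) - (c * f x + f' x))) \<longlonglongrightarrow> 0"
      by (rule l2sq_combo_tendsto[OF u(2) f(1) v(2) f(2) u(3) v(3)])
    show "(\<lambda>n. l2sq (\<lambda>p. fourier (\<lambda>x. c * u n x + v n x) p - (c * g p + g' p))) \<longlonglongrightarrow> 0"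
      unfolding F by (rule l2sq_combo_tendsto[OF u(5) u(4) v(5) v(4) u(6) v(6)])
  qed (use u v f in \<open>auto intro!: L2_add L2_mult\<close>)
qed

lemma fourier_rel_zero: "fourier_rel (\<lambda>x. 0) (\<lambda>p. 0)"
  by (rule fourier_relI[where u = "\<lambda>n x. 0"]) (auto simp: L2_zero l2sq_def fourier_def)

lemma fourier_rel_cong_AE:
  assumes "fourier_rel f g" "f \<in> L2" "AE x in lebesgue. f x = f' x" "AE p in lebesgue. g p = g' p"
  shows "fourier_rel f' g'"
proof -
  obtain u where u': "\<forall>n. integrable lebesgue (u n)" "\<forall>n. u n \<in> L2"
    "(\<lambda>n. l2sq (\<lambda>x. u n x - f x)) \<longlonglongrightarrow> 0" "g \<in> L2"
    "\<forall>n. fourier (u n) \<in> L2" "(\<lambda>n. l2sq (\<lambda>p. fourier (u n) p - g p)) \<longlonglongrightarrow> 0"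
    using fourier_relD[OF assms(1,2)] by blast
  note u = u'[rule_format]
  have f': "f' \<in> L2" and g': "g' \<in> L2" using L2_cong_AE assms u(4) by blast+
  have "l2sq (\<lambda>x. u n x - f x) = l2sq (\<lambda>x. u n x - f' x)" for n
    by (rule l2sq_cong_AE[OF L2_diff[OF u(2) assms(2)]]) (use assms(3) in auto)
  moreover have "l2sq (\<lambda>p. fourier (u n) p - g p) = l2sq (\<lambda>p. fourier (u n) p - g' p)" for n
    by (rule l2sq_cong_AE[OF L2_diff[OF u(5,4)]]) (use assms(4) in auto)
  ultimately show ?thesis using fourier_relI[OF f' u(1,2) _ g'] u(3,6) by simp
qed

text \<open>The isometry applied to the difference; it makes the arbitrary choice in
  \<open>fourier_L2\<close> harmless.\<close>

lemma fourier_rel_unique: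
  assumes r: "fourier_rel f g" "fourier_rel f' g'" and f: "f \<in> L2" "AE x in lebesgue. f x = f' x"
  shows "AE p in lebesgue. g p = g' p"
proof -
  have f': "f' \<in> L2" by (rule L2_cong_AE[OF f])
  have g: "g \<in> L2" "g' \<in> L2" using r by (auto simp: fourier_rel_def)
  have rel: "fourier_rel (\<lambda>x. (- 1) * f x + f' x) (\<lambda>p. (- 1) * g p + g' p)"
    by (rule fourier_rel_combo[OF r f(1) f'])
  have L: "(\<lambda>x. (- 1) * f x + f' x) \<in> L2" by (intro L2_add L2_mult f f')
  have "l2sq (\<lambda>p. (- 1) * g p + g' p) = 0"
    unfolding fourier_rel_isometric[OF rel L] using l2sq_eq_0_iff[OF L] f(2) by auto
  then have "AE p in lebesgue. (- 1) * g p + g' p = 0"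
    using l2sq_eq_0_iff[of "\<lambda>p. (- 1) * g p + g' p"] L2_diff[OF g(2,1)] by simp
  then show ?thesis by eventually_elim simp
qed

lemma fourier_rel_exists:
  assumes f: "f \<in> L2" shows "\<exists>g. fourier_rel f g"
proof -
  note u = truncation[OF f]
  have F: "fourier (trunc f n) \<in> L2" for n by (rule Plancherel_L1_L2(1)[OF u(2,3)])
  have F_diff: "l2sq (\<lambda>p. fourier (trunc f m) p - fourier (trunc f n) p) = l2sq (\<lambda>x. trunc f m x - trunc f n x)" for m n
  proof -
    have "fourier (\<lambda>x. trunc f m x - trunc f n x) = (\<lambda>p. fourier (trunc f m) p - fourier (trunc f n) p)"
      by (rule ext) (rule fourier_diff[OF u(2) u(2)])
    then show ?thesis
      using Plancherel_L1_L2(2)[OF Bochner_Integration.integrable_diff[OF u(2) u(2)] L2_diff[OF u(3) u(3)], of m n] by simp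
  qed
  from L2_limit_transfer[OF u(3) f F F_diff u(4)] obtain G where "G \<in> L2" "(\<lambda>n. l2sq (\<lambda>p. fourier (trunc f n) p - G p)) \<longlonglongrightarrow> 0"
    by blast
  from fourier_relI[OF f u(2,3,4) this] show ?thesis by blast
qed

lemma fourier_rel_fourier_L2: "f \<in> L2 \<Longrightarrow> fourier_rel f (fourier_L2 f)"
  unfolding fourier_L2_def fourier_rel_def[symmetric] by (rule someI_ex[OF fourier_rel_exists])

lemma Plancherel_inverse:
  assumes gI: "integrable lebesgue g" and g: "g \<in> L2"
  shows "ifourier g \<in> L2" "l2sq (ifourier g) = l2sq g"
proof -
  have m: "fourier g \<in> borel_measurable lebesgue" by (rule fourier_measurable[OF gI])
  have e: "0 + (- 1) *\<^sub>R x = - x" for x :: plane by simp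
  note F = Plancherel_L1_L2[OF gI g]
  have m2: "(\<lambda>x. (cmod (fourier g x))\<^sup>2) \<in> borel_measurable lebesgue" using m by measurable
  have mi: "ifourier g \<in> borel_measurable lebesgue"
    using borel_measurable_affine[OF m, of "- 1" 0] by (simp add: ifourier_def[abs_def])
  show "ifourier g \<in> L2"
    using lebesgue_integral_affine(1)[OF m2, of "- 1" 0] L2_integrable[OF F(1)] mi
    unfolding e by (simp add: L2_def ifourier_def)
  show "l2sq (ifourier g) = l2sq g"
    unfolding F(2)[symmetric] using lebesgue_integral_affine(2)[OF m2, of "- 1" 0]
    unfolding e by (simp add: l2sq_def ifourier_def)
qed

text \<open>Inversion from norms alone. If \<open>G\<close> is the transform of
  \<open>ifourier g\<close>, the adjoint identity passes to the limit and gives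
  \<open>ip2 G g = l2sq g\<close>, while \<open>G\<close> and g have equal norms; expanding the
  square of the difference leaves 0.\<close>

lemma fourier_rel_ifourier:
  assumes gI: "integrable lebesgue g" and g: "g \<in> L2"
  shows "fourier_rel (ifourier g) g"
proof -
  note f = Plancherel_inverse[OF gI g]
  obtain G where G: "fourier_rel (ifourier g) G" using fourier_rel_exists[OF f(1)] by blast
  obtain u where u': "\<forall>n. integrable lebesgue (u n)" "\<forall>n. u n \<in> L2"
    "(\<lambda>n. l2sq (\<lambda>x. u n x - ifourier g x)) \<longlonglongrightarrow> 0" "G \<in> L2"
    "\<forall>n. fourier (u n) \<in> L2" "(\<lambda>n. l2sq (\<lambda>p. fourier (u n) p - G p)) \<longlonglongrightarrow> 0"
    using fourier_relD[OF G f(1)] by blast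
  note u = u'[rule_format]
  have c: "(\<lambda>n. l2sq (\<lambda>x. h x - h x)) \<longlonglongrightarrow> 0" for h :: "plane \<Rightarrow> complex" by (simp add: l2sq_def)
  have "(\<lambda>n. ip2 (fourier (u n)) g) \<longlonglongrightarrow> ip2 G g"
    by (rule ip2_tendsto[OF u(5,4) g g u(6) c])
  moreover have "(\<lambda>n. ip2 (fourier (u n)) g) \<longlonglongrightarrow> ip2 (ifourier g) (ifourier g)"
  proof -
    have "ip2 (fourier (u n)) g = ip2 (u n) (ifourier g)" for n
      unfolding ip2_def by (rule fourier_adjoint[OF u(1) gI])
    then show ?thesis using ip2_tendsto[OF u(2) f(1) f(1) f(1) u(3) c] by simp
  qed
  ultimately have "ip2 G g = complex_of_real (l2sq g)"
    using LIMSEQ_unique ip2_self[OF f(1)] f(2) by fastforce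
  then have "l2sq (\<lambda>p. G p - g p) = 0"
    using l2sq_diff_expand[OF u(4) g] fourier_rel_isometric[OF G f(1)] f(2) by simp
  then have "AE p in lebesgue. G p = g p"
    using l2sq_eq_0_iff[OF L2_diff[OF u(4) g]] by simp
  then show ?thesis using fourier_rel_cong_AE[OF G f(1)] by simp
qed

text \<open>Truncations of g have explicit preimages, and the isometry makes these converge.\<close>

lemma fourier_rel_surj:
  assumes g: "g \<in> L2" shows "\<exists>f\<in>L2. fourier_rel f g"
proof -
  note u = truncation[OF g]
  define v where "v n = ifourier (trunc g n)" for n
  have v: "v n \<in> L2" for n unfolding v_def by (rule Plancherel_inverse(1)[OF u(2,3)])
  have rel: "fourier_rel (v n) (trunc g n)" for n unfolding v_def by (rule fourier_rel_ifourier[OF u(2,3)])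
  have diff: "l2sq (\<lambda>x. v m x - v n x) = l2sq (\<lambda>x. trunc g m x - trunc g n x)" for m n
    using fourier_rel_isometric[OF fourier_rel_combo[OF rel rel v v, of "- 1" n m]] v
    by (simp add: L2_diff)
  from L2_limit_transfer[OF u(3) g v diff u(4)] obtain f where f: "f \<in> L2" "(\<lambda>n. l2sq (\<lambda>x. v n x - f x)) \<longlonglongrightarrow> 0"
    by blast
  obtain G where G: "fourier_rel f G" using fourier_rel_exists[OF f(1)] by blast
  have GL2: "G \<in> L2" using G by (simp add: fourier_rel_def)
  have "l2sq (\<lambda>x. trunc g n x - G x) = l2sq (\<lambda>x. v n x - f x)" for n
    using fourier_rel_isometric[OF fourier_rel_combo[OF G rel f(1) v, of "- 1" n]] v f
    by (simp add: L2_diff)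
  then have "AE p in lebesgue. G p = g p"
    using L2_limit_unique[OF u(3) GL2 g _ u(4)] f(2) by simp
  then show ?thesis using fourier_rel_cong_AE[OF G f(1)] f(1) by auto
qed

section \<open>Potential energy estimates\<close>

lemma measure_cball_plane: "0 \<le> \<rho> \<Longrightarrow> measure lebesgue (cball (0::plane) \<rho>) = pi * \<rho>\<^sup>2"
  using content_cball[of \<rho> "0::plane"] by (simp add: unit_ball_vol_2)

lemma L2_indicator_cball:
  assumes "0 \<le> \<rho>"
  shows "(\<lambda>p::plane. complex_of_real (indicator (cball 0 \<rho>) p)) \<in> L2"
    and "l2sq (\<lambda>p::plane. complex_of_real (indicator (cball 0 \<rho>) p)) = pi * \<rho>\<^sup>2"
proof -
  have e: "(cmod (complex_of_real (indicator (cball 0 \<rho>) p)))\<^sup>2 = indicator (cball 0 \<rho>) p" for p :: plane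
    by (simp add: indicator_def)
  have "(\<lambda>p::plane. complex_of_real (indicator (cball 0 \<rho>) p)) \<in> borel_measurable lebesgue"
  proof (rule borel_imp_lebesgue_measurable)
    have [measurable]: "indicator (cball (0::plane) \<rho>) \<in> borel_measurable borel"
      by (rule borel_measurable_indicator) simp
    show "(\<lambda>p::plane. complex_of_real (indicator (cball 0 \<rho>) p)) \<in> borel_measurable borel"
      by measurable
  qed
  then show "(\<lambda>p::plane. complex_of_real (indicator (cball 0 \<rho>) p)) \<in> L2"
    using lebesgue_indicator_cball_integrable[of 1 \<rho>]
    unfolding L2_def mem_Collect_eq e mult_1 by blast
  show "l2sq (\<lambda>p::plane. complex_of_real (indicator (cball 0 \<rho>) p)) = pi * \<rho>\<^sup>2"
    unfolding l2sq_def e using measure_cball_plane[OF assms] by simp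
qed

lemma L2_ball_integrable:
  fixes g :: "plane \<Rightarrow> complex"
  assumes g: "g \<in> L2" and supp: "\<And>p. norm p > \<rho> \<Longrightarrow> g p = 0" and \<rho>: "0 \<le> \<rho>"
  shows "integrable lebesgue g" "(LINT p|lebesgue. cmod (g p))\<^sup>2 \<le> pi * \<rho>\<^sup>2 * l2sq g"
proof -
  note c = L2_indicator_cball[OF \<rho>]
  have e: "norm (g p) * norm (complex_of_real (indicator (cball 0 \<rho>) p)) = norm (g p)" for p
    using supp[of p] by (cases "norm p \<le> \<rho>") auto
  show "integrable lebesgue g"
    using L2_product_integrable[OF g c(1)] L2_measurable[OF g] unfolding e by (simp add: integrable_norm_iff)
  show "(LINT p|lebesgue. cmod (g p))\<^sup>2 \<le> pi * \<rho>\<^sup>2 * l2sq g"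
    using L2_Cauchy_Schwarz[OF g c(1)] unfolding e c(2) by (simp add: mult.commute)
qed

text \<open>Bernstein's inequality in the plane: Cauchy-Schwarz against the indicator of a disc of
  area \<open>pi * \<rho>\<^sup>2\<close> bounds the L1 norm, and the L1 norm bounds the transform.
  A factor \<open>1 / (4 * pi)\<close> is estimated by 1.\<close>

lemma ifourier_sup:
  assumes g: "g \<in> L2" and supp: "\<And>p. norm p > \<rho> \<Longrightarrow> g p = 0" and \<rho>: "0 \<le> \<rho>"
  shows "((LINT p|lebesgue. cmod (g p)) / (2 * pi))\<^sup>2 \<le> \<rho>\<^sup>2 * l2sq g"
    and "(cmod (ifourier g x))\<^sup>2 \<le> \<rho>\<^sup>2 * l2sq g"
proof -
  note b = L2_ball_integrable[OF assms]
  have "((LINT p|lebesgue. cmod (g p)) / (2 * pi))\<^sup>2 \<le> pi * \<rho>\<^sup>2 * l2sq g / (2 * pi)\<^sup>2"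
    using b(2) by (simp add: power_divide divide_right_mono)
  also have "\<dots> = \<rho>\<^sup>2 * l2sq g / (4 * pi)" by (simp add: power2_eq_square)
  also have "\<dots> \<le> \<rho>\<^sup>2 * l2sq g / 1"
    using pi_gt3 l2sq_nonneg[of g] by (intro divide_left_mono) auto
  finally show 1: "((LINT p|lebesgue. cmod (g p)) / (2 * pi))\<^sup>2 \<le> \<rho>\<^sup>2 * l2sq g" by simp
  have "(cmod (ifourier g x))\<^sup>2 \<le> ((LINT p|lebesgue. cmod (g p)) / (2 * pi))\<^sup>2"
    unfolding ifourier_def by (intro power_mono fourier_bound b(1)) auto
  from this 1 show "(cmod (ifourier g x))\<^sup>2 \<le> \<rho>\<^sup>2 * l2sq g" by (rule order.trans)
qed

lemma exp_i_Lipschitz: "cmod (exp (\<i> * complex_of_real a) - exp (\<i> * complex_of_real b)) \<le> \<bar>a - b\<bar>"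
proof -
  have "exp (\<i> * complex_of_real a) - exp (\<i> * complex_of_real b)
      = exp (\<i> * complex_of_real b) * (exp (\<i> * complex_of_real (a - b)) - 1)"
    by (simp add: right_diff_distrib exp_add[symmetric])
  then have "cmod (exp (\<i> * complex_of_real a) - exp (\<i> * complex_of_real b))
      = cmod (exp (\<i> * complex_of_real (a - b)) - 1)"
    by (simp only: norm_mult norm_exp_i_times mult_1)
  also have "\<dots> \<le> \<bar>a - b\<bar>" using iexp_approx1[of "a - b" 0] by simp
  finally show ?thesis .
qed

text \<open>Waves of frequency at most \<rho> are \<rho>-Lipschitz, which costs one more factor
  \<rho> than the sup bound.\<close>

lemma ifourier_Lipschitz:
  assumes g: "g \<in> L2" and supp: "\<And>p. norm p > \<rho> \<Longrightarrow> g p = 0" and \<rho>: "0 \<le> \<rho>"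
  shows "(cmod (ifourier g x - ifourier g y))\<^sup>2 \<le> (\<rho>\<^sup>2 * norm (x - y))\<^sup>2 * l2sq g"
proof -
  note b = L2_ball_integrable[OF assms]
  note w = wave_mult_integrable(2)[OF b(1)]
  have "ifourier g x - ifourier g y = 1 / (2 * of_real pi) *
     (LINT p|lebesgue. exp (\<i> * of_real (x \<bullet> p)) * g p - exp (\<i> * of_real (y \<bullet> p)) * g p)"
    using w by (simp add: ifourier_alt right_diff_distrib)
  also have "cmod \<dots> \<le> 1 / (2 * pi) * (LINT p|lebesgue. \<rho> * norm (x - y) * cmod (g p))"
  proof -
    have "cmod (LINT p|lebesgue. exp (\<i> * of_real (x \<bullet> p)) * g p - exp (\<i> * of_real (y \<bullet> p)) * g p)
       \<le> (LINT p|lebesgue. cmod (exp (\<i> * of_real (x \<bullet> p)) * g p - exp (\<i> * of_real (y \<bullet> p)) * g p))"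
      by (rule integral_norm_bound)
    also have "\<dots> \<le> (LINT p|lebesgue. \<rho> * norm (x - y) * cmod (g p))"
    proof (rule integral_mono)
      show "integrable lebesgue (\<lambda>p. cmod (exp (\<i> * of_real (x \<bullet> p)) * g p - exp (\<i> * of_real (y \<bullet> p)) * g p))"
        using w by (intro integrable_norm Bochner_Integration.integrable_diff)
      show "integrable lebesgue (\<lambda>p. \<rho> * norm (x - y) * cmod (g p))"
        using b(1) by (intro integrable_mult_right integrable_norm)
      fix p :: plane
      show "cmod (exp (\<i> * of_real (x \<bullet> p)) * g p - exp (\<i> * of_real (y \<bullet> p)) * g p) \<le> \<rho> * norm (x - y) * cmod (g p)"
      proof (cases "norm p \<le> \<rho>")
        case True
        have "cmod (exp (\<i> * of_real (x \<bullet> p)) - exp (\<i> * of_real (y \<bullet> p))) \<le> \<bar>x \<bullet> p - y \<bullet> p\<bar>"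
          by (rule exp_i_Lipschitz)
        also have "\<dots> = \<bar>(x - y) \<bullet> p\<bar>" by (simp add: inner_diff_left)
        also have "\<dots> \<le> norm (x - y) * norm p" by (rule Cauchy_Schwarz_ineq2)
        also have "\<dots> \<le> \<rho> * norm (x - y)" using True by (simp add: mult.commute mult_right_mono)
        finally show ?thesis
          unfolding left_diff_distrib[symmetric] norm_mult by (rule mult_right_mono) simp
      qed (use supp[of p] in auto)
    qed
    finally show ?thesis by (simp add: norm_mult norm_divide divide_right_mono)
  qed
  also have "\<dots> = \<rho> * norm (x - y) * ((LINT p|lebesgue. cmod (g p)) / (2 * pi))" by simp
  finally have "(cmod (ifourier g x - ifourier g y))\<^sup>2 \<le> (\<rho> * norm (x - y) * ((LINT p|lebesgue. cmod (g p)) / (2 * pi)))\<^sup>2"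
    by (rule power_mono) simp
  also have "\<dots> = (\<rho> * norm (x - y))\<^sup>2 * ((LINT p|lebesgue. cmod (g p)) / (2 * pi))\<^sup>2"
    by (rule power_mult_distrib)
  also have "\<dots> \<le> (\<rho> * norm (x - y))\<^sup>2 * (\<rho>\<^sup>2 * l2sq g)"
    by (intro mult_left_mono ifourier_sup(1)[OF assms]) auto
  finally show ?thesis by (simp add: power_mult_distrib power2_eq_square mult_ac)
qed

section \<open>Low-frequency parts and the weighted norm\<close>

definition low :: "real \<Rightarrow> (plane \<Rightarrow> complex) \<Rightarrow> plane \<Rightarrow> complex" where
  "low R g p = (if norm p < R then g p else 0)"

text \<open>The contribution of one spinor component to the squared \<open>H1\<close> norm, read in
  momentum space.\<close>

definition wnorm :: "(plane \<Rightarrow> complex) \<Rightarrow> real" where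
  "wnorm g = (LINT p|lebesgue. (1 + (norm p)\<^sup>2) * (cmod (g p))\<^sup>2)"

definition wL2 :: "(plane \<Rightarrow> complex) set" where
  "wL2 = {g\<in>L2. integrable lebesgue (\<lambda>p. (1 + (norm p)\<^sup>2) * (cmod (g p))\<^sup>2)}"

lemma norm_lebesgue_measurable[measurable]: "norm \<in> borel_measurable (lebesgue :: plane measure)"
  by (rule borel_imp_lebesgue_measurable) measurable

lemma wL2I:
  assumes g: "g \<in> wL2" and h: "h \<in> borel_measurable lebesgue" and le: "\<And>p. cmod (h p) \<le> cmod (g p)"
  shows "h \<in> wL2" "wnorm h \<le> wnorm g" "l2sq h \<le> l2sq g"
proof -
  have gL: "g \<in> L2" and gi: "integrable lebesgue (\<lambda>p. (1 + (norm p)\<^sup>2) * (cmod (g p))\<^sup>2)"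
    using g by (auto simp: wL2_def)
  note [measurable] = h
  have hL: "h \<in> L2"
    by (rule L2I[OF h L2_integrable[OF gL]]) (use le in \<open>auto intro: power_mono\<close>)
  have le': "(1 + (norm p)\<^sup>2) * (cmod (h p))\<^sup>2 \<le> (1 + (norm p)\<^sup>2) * (cmod (g p))\<^sup>2" for p
    by (intro mult_left_mono power_mono le) auto
  have hi: "integrable lebesgue (\<lambda>p. (1 + (norm p)\<^sup>2) * (cmod (h p))\<^sup>2)"
    by (rule Bochner_Integration.integrable_bound[OF gi]) (measurable, use le' in \<open>auto simp: abs_of_nonneg\<close>)
  show "h \<in> wL2" using hL hi by (simp add: wL2_def)
  show "wnorm h \<le> wnorm g" unfolding wnorm_def by (rule integral_mono[OF hi gi le'])
  show "l2sq h \<le> l2sq g" unfolding l2sq_def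
    by (rule integral_mono[OF L2_integrable[OF hL] L2_integrable[OF gL]]) (intro power_mono le norm_ge_zero)
qed

lemma l2sq_le_wnorm: "g \<in> wL2 \<Longrightarrow> l2sq g \<le> wnorm g"
  unfolding l2sq_def wnorm_def wL2_def
  by (intro integral_mono) (auto simp: L2_integrable distrib_right)

lemma wnorm_nonneg: "0 \<le> wnorm g"
  unfolding wnorm_def by (intro Bochner_Integration.integral_nonneg) auto

lemma low_wL2: assumes "g \<in> wL2" shows "low R g \<in> wL2" "wnorm (low R g) \<le> wnorm g" "l2sq (low R g) \<le> l2sq g"
proof -
  have [measurable]: "g \<in> borel_measurable lebesgue" using assms L2_measurable by (auto simp: wL2_def)
  have "low R g \<in> borel_measurable lebesgue" unfolding low_def[abs_def] by measurable
  from wL2I[OF assms this] show "low R g \<in> wL2" "wnorm (low R g) \<le> wnorm g" "l2sq (low R g) \<le> l2sq g"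
    by (auto simp: low_def)
qed

lemma wL2_L2: "g \<in> wL2 \<Longrightarrow> g \<in> L2" by (simp add: wL2_def)

lemma low_integrable: "g \<in> wL2 \<Longrightarrow> 0 \<le> R \<Longrightarrow> integrable lebesgue (low R g)"
  by (rule L2_ball_integrable(1)[of _ R]) (auto simp: wL2_L2 low_wL2 low_def)

section \<open>The potential energy relative to the weighted norm\<close>

locale potential =
  fixes V :: "plane \<Rightarrow> real" and r :: real
  assumes V: "integrable lebesgue V" and r: "r > 1" and Vr: "integrable lebesgue (\<lambda>x. \<bar>V x\<bar> powr r)"
begin

lemma V_measurable[measurable]: "V \<in> borel_measurable lebesgue"
  by (rule borel_measurable_integrable[OF V])

definition "Vr_int = (LINT x|lebesgue. \<bar>V x\<bar> powr r)"
text \<open>In band k the potential is split at the level \<open>growth ^ k\<close>. As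
  \<open>growth powr r = 4\<close>, both parts of \<open>band_estimate\<close> are then of the order
  \<open>growth ^ k\<close> times the squared \<open>L2\<close> norm, that is
  \<open>(growth / 4) ^ k\<close> relative to the weighted norm; r > 1 makes this ratio less than
  one.\<close>

definition "growth = 4 powr (1 / r)"
text \<open>Half of the decay per band on a logarithmic scale. Used as weights in Cauchy-Schwarz
  over the bands, the \<open>\<theta> ^ k\<close> have a tail sum of order
  \<open>\<theta> ^ K\<close>, while the inverse weights are absorbed by the band decay
  \<open>(\<theta> ^ k)\<^sup>2\<close>.\<close>

definition "\<theta> = sqrt (growth / 4)"
text \<open>The 1 stems from the part of V below the splitting level, the 4 from the outer radius of
  the band: \<open>(2 ^ Suc k)\<^sup>2 = 4 * 4 ^ k\<close>.\<close>

definition "band_const = 1 + 4 * Vr_int"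

lemma Vr_int_nonneg: "0 \<le> Vr_int" unfolding Vr_int_def by simp

lemma growth: "0 < growth" "growth < 4"
proof -
  show "0 < growth" by (simp add: growth_def)
  have "4 powr (1 / r) < 4 powr (1::real)" using r by (intro powr_less_mono) auto
  then show "growth < 4" by (simp add: growth_def)
qed

lemma \<theta>: "0 < \<theta>" "\<theta> < 1" "\<theta>\<^sup>2 = growth / 4"
  using growth by (auto simp: \<theta>_def)

lemma bounded_potential_integrable:
  assumes h[measurable]: "h \<in> borel_measurable lebesgue" and B: "\<And>x. (cmod (h x))\<^sup>2 \<le> B"
  shows "integrable lebesgue (\<lambda>x. \<bar>V x\<bar> * (cmod (h x))\<^sup>2)"
proof (rule Bochner_Integration.integrable_bound[OF integrable_mult_right[OF integrable_abs[OF V], of B]])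
  show "(\<lambda>x. \<bar>V x\<bar> * (cmod (h x))\<^sup>2) \<in> borel_measurable lebesgue" by measurable
  have "0 \<le> B" using B[of 0] zero_le_power2 order.trans by blast
  then show "AE x in lebesgue. norm (\<bar>V x\<bar> * (cmod (h x))\<^sup>2) \<le> norm (B * \<bar>V x\<bar>)"
    using mult_right_mono[OF B abs_ge_zero] by (intro AE_I2) (simp add: abs_mult mult.commute)
qed

text \<open>Where \<open>|V| > l\<close> one has \<open>|V| \<le> l powr (1 - r) * |V| powr r\<close>.\<close>

lemma band_estimate:
  assumes g: "g \<in> L2" and supp: "\<And>p. norm p > \<rho> \<Longrightarrow> g p = 0" and \<rho>: "0 \<le> \<rho>" and l: "l > 0"
  shows "integrable lebesgue (\<lambda>x. \<bar>V x\<bar> * (cmod (ifourier g x))\<^sup>2)"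
    and "(LINT x|lebesgue. \<bar>V x\<bar> * (cmod (ifourier g x))\<^sup>2) \<le> l * l2sq g + \<rho>\<^sup>2 * l2sq g * (l powr (1 - r) * Vr_int)"
proof -
  note b = L2_ball_integrable[OF g supp \<rho>] and s = ifourier_sup(2)[OF g supp \<rho>]
  note f = Plancherel_inverse[OF b(1) g]
  show i: "integrable lebesgue (\<lambda>x. \<bar>V x\<bar> * (cmod (ifourier g x))\<^sup>2)"
    by (rule bounded_potential_integrable[OF L2_measurable[OF f(1)] s])
  have pw: "\<bar>V x\<bar> * (cmod (ifourier g x))\<^sup>2
      \<le> l * (cmod (ifourier g x))\<^sup>2 + \<rho>\<^sup>2 * l2sq g * (l powr (1 - r) * \<bar>V x\<bar> powr r)" for x
  proof (cases "\<bar>V x\<bar> \<le> l")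
    case True
    have "\<bar>V x\<bar> * (cmod (ifourier g x))\<^sup>2 \<le> l * (cmod (ifourier g x))\<^sup>2"
      using True by (intro mult_right_mono) auto
    moreover have "0 \<le> \<rho>\<^sup>2 * l2sq g * (l powr (1 - r) * \<bar>V x\<bar> powr r)"
      by (intro mult_nonneg_nonneg l2sq_nonneg) auto
    ultimately show ?thesis by simp
  next
    case False
    have "\<bar>V x\<bar> = \<bar>V x\<bar> powr (1 - r) * \<bar>V x\<bar> powr r"
      using False l by (simp add: powr_add[symmetric])
    also have "\<dots> \<le> l powr (1 - r) * \<bar>V x\<bar> powr r"
      using False l r by (intro mult_right_mono powr_mono2') auto
    finally have "\<bar>V x\<bar> * (cmod (ifourier g x))\<^sup>2 \<le> (l powr (1 - r) * \<bar>V x\<bar> powr r) * (\<rho>\<^sup>2 * l2sq g)"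
      using s by (intro mult_mono) auto
    moreover have "0 \<le> l * (cmod (ifourier g x))\<^sup>2" using l by simp
    ultimately show ?thesis by (simp only: mult.commute)
  qed
  have "(LINT x|lebesgue. \<bar>V x\<bar> * (cmod (ifourier g x))\<^sup>2)
      \<le> (LINT x|lebesgue. l * (cmod (ifourier g x))\<^sup>2 + \<rho>\<^sup>2 * l2sq g * (l powr (1 - r) * \<bar>V x\<bar> powr r))"
    using Vr L2_integrable[OF f(1)] by (intro integral_mono[OF i _ pw]) auto
  also have "\<dots> = l * l2sq (ifourier g) + \<rho>\<^sup>2 * l2sq g * (l powr (1 - r) * Vr_int)"
    using Vr L2_integrable[OF f(1)] by (simp add: l2sq_def Vr_int_def)
  finally show "(LINT x|lebesgue. \<bar>V x\<bar> * (cmod (ifourier g x))\<^sup>2) \<le> l * l2sq g + \<rho>\<^sup>2 * l2sq g * (l powr (1 - r) * Vr_int)"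
    by (simp only: f(2))
qed

text \<open>A difference of low-frequency parts, so that sums over bands telescope, for the
  functions as well as for their weighted norms.\<close>

definition band :: "(plane \<Rightarrow> complex) \<Rightarrow> nat \<Rightarrow> plane \<Rightarrow> complex" where
  "band g k p = low (2 ^ Suc k) g p - low (2 ^ k) g p"

lemma pow2_mono: "(2::real) ^ k < 2 ^ Suc k" by simp

lemma band_alt: "band g k p = (if 2 ^ k \<le> norm p \<and> norm p < 2 ^ Suc k then g p else 0)"
  by (auto simp: band_def low_def simp del: power_Suc dest: less_trans[OF _ pow2_mono])

lemma band_wL2: assumes "g \<in> wL2" shows "band g k \<in> wL2"
proof -
  have [measurable]: "g \<in> borel_measurable lebesgue" using assms L2_measurable by (auto simp: wL2_def)
  have "band g k \<in> borel_measurable lebesgue" unfolding band_alt[abs_def] by measurable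
  then show ?thesis by (rule wL2I(1)[OF assms]) (auto simp: band_alt)
qed

lemma band_wnorm:
  assumes "g \<in> wL2" shows "wnorm (band g k) = wnorm (low (2 ^ Suc k) g) - wnorm (low (2 ^ k) g)"
proof -
  have i: "integrable lebesgue (\<lambda>p. (1 + (norm p)\<^sup>2) * (cmod (low R g p))\<^sup>2)" for R
    using low_wL2(1)[OF assms] by (simp add: wL2_def)
  have "(cmod (band g k p))\<^sup>2 = (cmod (low (2 ^ Suc k) g p))\<^sup>2 - (cmod (low (2 ^ k) g p))\<^sup>2" for p
    by (auto simp: band_alt low_def simp del: power_Suc dest: less_trans[OF _ pow2_mono])
  then show ?thesis
    unfolding wnorm_def using Bochner_Integration.integral_diff[OF i i, of "2 ^ Suc k" "2 ^ k"]
    by (simp only: right_diff_distrib)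
qed

lemma band_l2sq: assumes g: "g \<in> wL2" shows "4 ^ k * l2sq (band g k) \<le> wnorm (band g k)"
proof -
  have bL: "band g k \<in> wL2" by (rule band_wL2[OF g])
  have "4 ^ k * l2sq (band g k) = (LINT p|lebesgue. 4 ^ k * (cmod (band g k p))\<^sup>2)"
    by (simp add: l2sq_def)
  also have "\<dots> \<le> wnorm (band g k)"
    unfolding wnorm_def
  proof (rule integral_mono)
    show "integrable lebesgue (\<lambda>p. 4 ^ k * (cmod (band g k p))\<^sup>2)"
      using L2_integrable[OF wL2_L2[OF bL]] by simp
    show "integrable lebesgue (\<lambda>p. (1 + (norm p)\<^sup>2) * (cmod (band g k p))\<^sup>2)"
      using bL by (simp add: wL2_def)
    fix p :: plane
    show "4 ^ k * (cmod (band g k p))\<^sup>2 \<le> (1 + (norm p)\<^sup>2) * (cmod (band g k p))\<^sup>2"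
    proof (cases "2 ^ k \<le> norm p")
      case True
      have "(4::real) ^ k = (2 ^ k)\<^sup>2" by (simp add: power_even_eq[symmetric] power_mult)
      also have "\<dots> \<le> (norm p)\<^sup>2" using True by (intro power_mono) auto
      finally show ?thesis by (intro mult_right_mono) auto
    qed (simp add: band_alt)
  qed
  finally show ?thesis .
qed

lemma band_potential:
  assumes g: "g \<in> wL2"
  shows "integrable lebesgue (\<lambda>x. \<bar>V x\<bar> * (cmod (ifourier (band g k) x))\<^sup>2)"
    and "(LINT x|lebesgue. \<bar>V x\<bar> * (cmod (ifourier (band g k) x))\<^sup>2) \<le> band_const * (\<theta> ^ k)\<^sup>2 * wnorm (band g k)"
proof -
  have bL: "band g k \<in> L2" by (rule wL2_L2[OF band_wL2[OF g]])
  have bk: "growth ^ k > 0" using growth by simp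
  have supp: "band g k p = 0" if "norm p > 2 ^ Suc k" for p using that by (simp add: band_alt)
  note e = band_estimate[of "band g k" "2 ^ Suc k" "growth ^ k", OF bL supp _ bk]
  show "integrable lebesgue (\<lambda>x. \<bar>V x\<bar> * (cmod (ifourier (band g k) x))\<^sup>2)" using e(1) by simp
  have br: "growth powr r = 4" using r by (simp add: growth_def powr_powr)
  have "(growth ^ k) powr (1 - r) = (growth ^ k) / (growth ^ k) powr r" using bk by (simp add: powr_diff)
  also have "(growth ^ k) powr r = (growth powr r) ^ k" using growth by (simp add: powr_power powr_powr powr_realpow[symmetric] mult.commute)
  finally have p: "(growth ^ k) powr (1 - r) = growth ^ k / 4 ^ k" unfolding br .
  have four: "((2::real) ^ Suc k)\<^sup>2 = 4 * 4 ^ k"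
    by (simp add: power_mult_distrib power_even_eq[symmetric] power_mult)
  have th: "(\<theta> ^ k)\<^sup>2 = growth ^ k / 4 ^ k"
    by (metis \<theta>(3) power_commutes power_divide power_mult mult.commute)
  have "(LINT x|lebesgue. \<bar>V x\<bar> * (cmod (ifourier (band g k) x))\<^sup>2)
     \<le> growth ^ k * l2sq (band g k) + (4 * 4 ^ k) * l2sq (band g k) * (growth ^ k / 4 ^ k * Vr_int)"
    using e(2) unfolding four p by simp
  also have "\<dots> = band_const * (\<theta> ^ k)\<^sup>2 * (4 ^ k * l2sq (band g k))"
    unfolding th band_const_def by (simp add: field_simps)
  also have "\<dots> \<le> band_const * (\<theta> ^ k)\<^sup>2 * wnorm (band g k)"
    using Vr_int_nonneg by (intro mult_left_mono band_l2sq[OF g]) (simp add: band_const_def)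
  finally show "(LINT x|lebesgue. \<bar>V x\<bar> * (cmod (ifourier (band g k) x))\<^sup>2) \<le> band_const * (\<theta> ^ k)\<^sup>2 * wnorm (band g k)" .
qed

definition "tail_const = band_const / (1 - \<theta>)"

lemma tail_const_nonneg: "0 \<le> tail_const" using Vr_int_nonneg \<theta> by (simp add: tail_const_def band_const_def)

lemma ifourier_band: "g \<in> wL2 \<Longrightarrow> ifourier (band g k) x = ifourier (low (2 ^ Suc k) g) x - ifourier (low (2 ^ k) g) x"
  unfolding ifourier_def band_def[abs_def] by (rule fourier_diff) (auto intro: low_integrable)

text \<open>Bands are orthogonal in \<open>L2\<close> but not with respect to |V|, so their
  potential energies do not simply add. Cauchy-Schwarz with the weights \<open>\<theta> ^ k\<close>
  replaces orthogonality at the cost of a factor \<open>1 / (1 - \<theta>)\<close> and supplies the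
  decay \<open>\<theta> ^ K\<close>; the weighted norms of the bands are then summed
  exactly.\<close>

lemma multiband_potential:
  assumes g: "g \<in> wL2" and Kn: "K \<le> n"
  shows "integrable lebesgue (\<lambda>x. \<bar>V x\<bar> * (cmod (ifourier (low (2 ^ n) g) x - ifourier (low (2 ^ K) g) x))\<^sup>2)"
    and "(LINT x|lebesgue. \<bar>V x\<bar> * (cmod (ifourier (low (2 ^ n) g) x - ifourier (low (2 ^ K) g) x))\<^sup>2)
       \<le> tail_const * \<theta> ^ K * wnorm g"
proof -
  let ?f = "\<lambda>k. ifourier (band g k)"
  let ?F = "\<lambda>x. ifourier (low (2 ^ n) g) x - ifourier (low (2 ^ K) g) x"
  have mF: "?f k \<in> L2" for k
    using Plancherel_inverse(1)[OF L2_ball_integrable(1)[of "band g k" "2 ^ Suc k"] wL2_L2[OF band_wL2[OF g]]]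
      wL2_L2[OF band_wL2[OF g]] by (simp add: band_alt)
  note [measurable] = L2_measurable[OF mF]
  have tel: "?F x = (\<Sum>k\<in>{K..<n}. ?f k x)" for x
    unfolding ifourier_band[OF g] using sum_Suc_diff'[OF Kn, of "\<lambda>k. ifourier (low (2 ^ k) g) x"] by simp
  have pw: "\<bar>V x\<bar> * (cmod (?F x))\<^sup>2
      \<le> (\<theta> ^ K / (1 - \<theta>)) * (\<Sum>k\<in>{K..<n}. (1 / \<theta> ^ k) * (\<bar>V x\<bar> * (cmod (?f k x))\<^sup>2))" for x
  proof -
    have "cmod (?F x) \<le> (\<Sum>k\<in>{K..<n}. sqrt (\<theta> ^ k) * (cmod (?f k x) / sqrt (\<theta> ^ k)))"
      unfolding tel using \<theta>(1) by (intro order.trans[OF norm_sum] sum_mono) (simp add: less_imp_neq[symmetric])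
    then have "(cmod (?F x))\<^sup>2 \<le> (\<Sum>k\<in>{K..<n}. sqrt (\<theta> ^ k) * (cmod (?f k x) / sqrt (\<theta> ^ k)))\<^sup>2"
      by (intro power_mono) auto
    also have "\<dots> \<le> (\<Sum>k\<in>{K..<n}. (sqrt (\<theta> ^ k))\<^sup>2) * (\<Sum>k\<in>{K..<n}. (cmod (?f k x) / sqrt (\<theta> ^ k))\<^sup>2)"
      by (rule Cauchy_Schwarz_ineq_sum)
    also have "\<dots> = (\<Sum>k\<in>{K..<n}. \<theta> ^ k) * (\<Sum>k\<in>{K..<n}. (1 / \<theta> ^ k) * (cmod (?f k x))\<^sup>2)"
      using \<theta>(1) by (simp add: power_divide)
    also have "\<dots> \<le> (\<theta> ^ K / (1 - \<theta>)) * (\<Sum>k\<in>{K..<n}. (1 / \<theta> ^ k) * (cmod (?f k x))\<^sup>2)"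
    proof (rule mult_right_mono)
      have "(\<Sum>k\<in>{K..<n}. \<theta> ^ k) * (1 - \<theta>) = \<theta> ^ K - \<theta> ^ n"
      proof -
        have "(\<Sum>k\<in>{K..<n}. \<theta> ^ k) * (1 - \<theta>) = (\<Sum>k\<in>{K..<n}. - (\<theta> ^ Suc k) - - (\<theta> ^ k))"
          unfolding sum_distrib_right by (intro sum.cong) (auto simp: right_diff_distrib)
        also have "\<dots> = - (\<theta> ^ n) - - (\<theta> ^ K)" by (rule sum_Suc_diff'[OF Kn])
        finally show ?thesis by simp
      qed
      also have "\<dots> \<le> \<theta> ^ K" using \<theta>(1) by simp
      finally show "(\<Sum>k\<in>{K..<n}. \<theta> ^ k) \<le> \<theta> ^ K / (1 - \<theta>)" using \<theta>(2) by (simp add: pos_le_divide_eq)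
    qed (use \<theta>(1) in \<open>auto intro!: sum_nonneg\<close>)
    finally have "\<bar>V x\<bar> * (cmod (?F x))\<^sup>2 \<le> \<bar>V x\<bar> * ((\<theta> ^ K / (1 - \<theta>)) * (\<Sum>k\<in>{K..<n}. (1 / \<theta> ^ k) * (cmod (?f k x))\<^sup>2))"
      by (rule mult_left_mono) simp
    then show ?thesis by (simp add: sum_distrib_left mult_ac)
  qed
  have i: "integrable lebesgue (\<lambda>x. (\<theta> ^ K / (1 - \<theta>)) * (\<Sum>k\<in>{K..<n}. (1 / \<theta> ^ k) * (\<bar>V x\<bar> * (cmod (?f k x))\<^sup>2)))"
    using band_potential(1)[OF g] by (intro integrable_mult_right Bochner_Integration.integrable_sum) auto
  have m: "(\<lambda>x. \<bar>V x\<bar> * (cmod (?F x))\<^sup>2) \<in> borel_measurable lebesgue" unfolding tel by measurable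
  show Fi: "integrable lebesgue (\<lambda>x. \<bar>V x\<bar> * (cmod (?F x))\<^sup>2)"
  proof (rule Bochner_Integration.integrable_bound[OF i m], rule AE_I2)
    fix x
    show "norm (\<bar>V x\<bar> * (cmod (?F x))\<^sup>2) \<le> norm ((\<theta> ^ K / (1 - \<theta>)) * (\<Sum>k\<in>{K..<n}. (1 / \<theta> ^ k) * (\<bar>V x\<bar> * (cmod (?f k x))\<^sup>2)))"
      unfolding real_norm_def
      by (rule order.trans[OF _ abs_ge_self]) (use pw[of x] in \<open>simp only: abs_mult abs_abs abs_power2\<close>)
  qed
  have "(LINT x|lebesgue. \<bar>V x\<bar> * (cmod (?F x))\<^sup>2)
     \<le> (LINT x|lebesgue. (\<theta> ^ K / (1 - \<theta>)) * (\<Sum>k\<in>{K..<n}. (1 / \<theta> ^ k) * (\<bar>V x\<bar> * (cmod (?f k x))\<^sup>2)))"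
    by (rule integral_mono[OF Fi i pw])
  also have "\<dots> = (\<theta> ^ K / (1 - \<theta>)) * (\<Sum>k\<in>{K..<n}. (1 / \<theta> ^ k) * (LINT x|lebesgue. \<bar>V x\<bar> * (cmod (?f k x))\<^sup>2))"
    using band_potential(1)[OF g] by (simp add: Bochner_Integration.integral_sum)
  also have "\<dots> \<le> (\<theta> ^ K / (1 - \<theta>)) * (\<Sum>k\<in>{K..<n}. band_const * wnorm (band g k))"
  proof (intro mult_left_mono sum_mono)
    fix k
    have "(1 / \<theta> ^ k) * (LINT x|lebesgue. \<bar>V x\<bar> * (cmod (?f k x))\<^sup>2) \<le> (1 / \<theta> ^ k) * (band_const * (\<theta> ^ k)\<^sup>2 * wnorm (band g k))"
      using \<theta>(1) by (intro mult_left_mono band_potential(2)[OF g]) auto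
    also have "\<dots> = band_const * \<theta> ^ k * wnorm (band g k)" using \<theta>(1) by (simp add: power2_eq_square)
    also have "\<dots> \<le> band_const * 1 * wnorm (band g k)"
      using \<theta> Vr_int_nonneg by (intro mult_right_mono mult_left_mono wnorm_nonneg power_le_one) (auto simp: band_const_def)
    finally show "(1 / \<theta> ^ k) * (LINT x|lebesgue. \<bar>V x\<bar> * (cmod (?f k x))\<^sup>2) \<le> band_const * wnorm (band g k)" by simp
  qed (use \<theta> in auto)
  also have "\<dots> = tail_const * \<theta> ^ K * (\<Sum>k\<in>{K..<n}. wnorm (band g k))"
    by (simp add: tail_const_def sum_distrib_left sum_divide_distrib mult_ac)
  also have "\<dots> \<le> tail_const * \<theta> ^ K * wnorm g"
  proof (intro mult_left_mono)
    have "(\<Sum>k\<in>{K..<n}. wnorm (band g k)) = wnorm (low (2 ^ n) g) - wnorm (low (2 ^ K) g)"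
      unfolding band_wnorm[OF g] using sum_Suc_diff'[OF Kn, of "\<lambda>k. wnorm (low (2 ^ k) g)"] by simp
    also have "\<dots> \<le> wnorm g" using low_wL2(2)[OF g, of "2 ^ n"] wnorm_nonneg[of "low (2 ^ K) g"] by linarith
    finally show "(\<Sum>k\<in>{K..<n}. wnorm (band g k)) \<le> wnorm g" .
  qed (use tail_const_nonneg \<theta> in auto)
  finally show "(LINT x|lebesgue. \<bar>V x\<bar> * (cmod (?F x))\<^sup>2) \<le> tail_const * \<theta> ^ K * wnorm g" .
qed

text \<open>The bound on finitely many bands is uniform in their number. Fatou's lemma, along a
  subsequence of low-frequency parts converging almost everywhere to f, carries it to the whole
  high-frequency remainder and proves integrability at the same time.\<close>

lemma high_potential:
  assumes f: "f \<in> L2" and rel: "fourier_rel f g" and g: "g \<in> wL2"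
  shows "integrable lebesgue (\<lambda>x. \<bar>V x\<bar> * (cmod (f x - ifourier (low (2 ^ K) g) x))\<^sup>2)"
    and "(LINT x|lebesgue. \<bar>V x\<bar> * (cmod (f x - ifourier (low (2 ^ K) g) x))\<^sup>2) \<le> tail_const * \<theta> ^ K * wnorm g"
proof -
  define l where "l n = ifourier (low (2 ^ n) g)" for n :: nat
  have gL: "g \<in> L2" by (rule wL2_L2[OF g])
  have lowI: "integrable lebesgue (low (2 ^ n) g)" "low (2 ^ n) g \<in> L2" for n
    by (auto intro: low_integrable[OF g] wL2_L2[OF low_wL2(1)[OF g]])
  have lL: "l n \<in> L2" for n unfolding l_def by (rule Plancherel_inverse(1)[OF lowI])
  have lr: "fourier_rel (l n) (low (2 ^ n) g)" for n unfolding l_def by (rule fourier_rel_ifourier[OF lowI])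
  note [measurable] = L2_measurable[OF f] L2_measurable[OF lL] L2_measurable[OF gL] L2_measurable[OF lowI(2)]
  have "l2sq (\<lambda>x. l n x - f x) = l2sq (\<lambda>p. low (2 ^ n) g p - g p)" for n
    using fourier_rel_isometric[OF fourier_rel_combo[OF rel lr f lL, of "- 1" n]] f lL[of n]
    by (simp add: L2_diff)
  moreover have "(\<lambda>n. LINT p|lebesgue. (cmod (low (2 ^ n) g p - g p))\<^sup>2) \<longlonglongrightarrow> (LINT p::plane|lebesgue. 0)"
  proof (rule integral_dominated_convergence[OF _ _ L2_integrable[OF gL]])
    show "AE p in lebesgue. (\<lambda>n. (cmod (low (2 ^ n) g p - g p))\<^sup>2) \<longlonglongrightarrow> 0"
    proof (intro AE_I2 tendsto_eventually)
      fix p :: plane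
      obtain k :: nat where k: "norm p < 2 ^ k" using real_arch_pow[of 2 "norm p"] by auto
      show "\<forall>\<^sub>F n in sequentially. (cmod (low (2 ^ n) g p - g p))\<^sup>2 = 0"
        using eventually_ge_at_top[of k]
      proof eventually_elim
        case (elim n)
        then have "(2::real) ^ k \<le> 2 ^ n" by (intro power_increasing) auto
        with k have "norm p < 2 ^ n" by (rule less_le_trans)
        then show ?case by (simp add: low_def)
      qed
    qed
    show "AE p in lebesgue. norm ((cmod (low (2 ^ n) g p - g p))\<^sup>2) \<le> (cmod (g p))\<^sup>2" for n
      by (intro AE_I2) (simp add: low_def)
  qed measurable
  ultimately have lim: "(\<lambda>n. l2sq (\<lambda>x. l n x - f x)) \<longlonglongrightarrow> 0" by (simp add: l2sq_def)
  obtain q where q: "strict_mono q" and ae: "AE x in lebesgue. (\<lambda>n. l (q n) x) \<longlonglongrightarrow> f x"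
    using L2_subseq_AE[OF lL f lim] by blast
  let ?B = "tail_const * \<theta> ^ K * wnorm g"
  have B0: "0 \<le> ?B" using tail_const_nonneg \<theta> wnorm_nonneg[of g] by simp
  have "(\<integral>\<^sup>+x. ennreal (\<bar>V x\<bar> * (cmod (f x - l K x))\<^sup>2) \<partial>lebesgue)
      \<le> (\<integral>\<^sup>+x. liminf (\<lambda>n. ennreal (\<bar>V x\<bar> * (cmod (l (q n) x - l K x))\<^sup>2)) \<partial>lebesgue)"
  proof (rule nn_integral_mono_AE)
    show "AE x in lebesgue. ennreal (\<bar>V x\<bar> * (cmod (f x - l K x))\<^sup>2)
        \<le> liminf (\<lambda>n. ennreal (\<bar>V x\<bar> * (cmod (l (q n) x - l K x))\<^sup>2))"
      using ae
    proof eventually_elim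
      case (elim x)
      then have "(\<lambda>n. ennreal (\<bar>V x\<bar> * (cmod (l (q n) x - l K x))\<^sup>2)) \<longlonglongrightarrow> ennreal (\<bar>V x\<bar> * (cmod (f x - l K x))\<^sup>2)"
        by (intro tendsto_intros)
      from lim_imp_Liminf[OF trivial_limit_sequentially this]
      show ?case by (simp only: order_refl)
    qed
  qed
  also have "\<dots> \<le> liminf (\<lambda>n. \<integral>\<^sup>+x. ennreal (\<bar>V x\<bar> * (cmod (l (q n) x - l K x))\<^sup>2) \<partial>lebesgue)"
    by (rule nn_integral_liminf) measurable
  also have "\<dots> \<le> ennreal ?B"
  proof (rule Liminf_le)
    show "\<forall>\<^sub>F n in sequentially. (\<integral>\<^sup>+x. ennreal (\<bar>V x\<bar> * (cmod (l (q n) x - l K x))\<^sup>2) \<partial>lebesgue) \<le> ennreal ?B"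
      using eventually_ge_at_top[of K]
    proof eventually_elim
      case (elim n)
      have Kq: "K \<le> q n" using elim seq_suble[OF q, of n] by simp
      have "(\<integral>\<^sup>+x. ennreal (\<bar>V x\<bar> * (cmod (l (q n) x - l K x))\<^sup>2) \<partial>lebesgue)
          = ennreal (LINT x|lebesgue. \<bar>V x\<bar> * (cmod (l (q n) x - l K x))\<^sup>2)"
        unfolding l_def by (rule nn_integral_eq_integral[OF multiband_potential(1)[OF g Kq]]) auto
      also have "\<dots> \<le> ennreal ?B"
        unfolding l_def by (rule ennreal_leI[OF multiband_potential(2)[OF g Kq]])
      finally show ?case .
    qed
  qed simp
  finally have fin: "(\<integral>\<^sup>+x. ennreal (\<bar>V x\<bar> * (cmod (f x - l K x))\<^sup>2) \<partial>lebesgue) \<le> ennreal ?B" .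
  have i: "integrable lebesgue (\<lambda>x. \<bar>V x\<bar> * (cmod (f x - l K x))\<^sup>2)"
  proof (rule integrableI_nonneg)
    show "(\<integral>\<^sup>+x. ennreal (\<bar>V x\<bar> * (cmod (f x - l K x))\<^sup>2) \<partial>lebesgue) < \<infinity>"
      using fin by (rule order_le_less_trans) simp
    show "(\<lambda>x. \<bar>V x\<bar> * (cmod (f x - l K x))\<^sup>2) \<in> borel_measurable lebesgue" by measurable
  qed simp
  then show "integrable lebesgue (\<lambda>x. \<bar>V x\<bar> * (cmod (f x - ifourier (low (2 ^ K) g) x))\<^sup>2)" by (simp only: l_def)
  have "ennreal (LINT x|lebesgue. \<bar>V x\<bar> * (cmod (f x - l K x))\<^sup>2) \<le> ennreal ?B"
    using fin nn_integral_eq_integral[OF i] by simp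
  then show "(LINT x|lebesgue. \<bar>V x\<bar> * (cmod (f x - ifourier (low (2 ^ K) g) x))\<^sup>2) \<le> ?B"
    using B0 by (simp only: l_def ennreal_le_iff)
qed

lemma potential_split:
  assumes f: "f \<in> L2" and rel: "fourier_rel f g" and g: "g \<in> wL2"
  shows "integrable lebesgue (\<lambda>x. \<bar>V x\<bar> * (cmod (f x))\<^sup>2)"
    and "integrable lebesgue (\<lambda>x. \<bar>V x\<bar> * (cmod (ifourier (low (2 ^ K) g) x))\<^sup>2)"
    and "(LINT x|lebesgue. \<bar>V x\<bar> * (cmod (f x))\<^sup>2)
      \<le> 2 * tail_const * \<theta> ^ K * wnorm g + 2 * (LINT x|lebesgue. \<bar>V x\<bar> * (cmod (ifourier (low (2 ^ K) g) x))\<^sup>2)"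
proof -
  let ?l = "\<lambda>K::nat. ifourier (low (2 ^ K) g)"
  have lowI: "integrable lebesgue (low (2 ^ K) g)" "low (2 ^ K) g \<in> L2" for K
    by (auto intro: low_integrable[OF g] wL2_L2[OF low_wL2(1)[OF g]])
  have lL: "?l K \<in> L2" for K by (rule Plancherel_inverse(1)[OF lowI])
  note [measurable] = L2_measurable[OF f] L2_measurable[OF lL]
  show lo: "integrable lebesgue (\<lambda>x. \<bar>V x\<bar> * (cmod (?l K x))\<^sup>2)" for K
  proof (rule bounded_potential_integrable[OF L2_measurable[OF lL]])
    show "(cmod (?l K x))\<^sup>2 \<le> (2 ^ K)\<^sup>2 * l2sq (low (2 ^ K) g)" for x
      by (rule ifourier_sup(2)[OF lowI(2)]) (auto simp: low_def)
  qed
  note hi = high_potential[OF f rel g]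
  have pw: "\<bar>V x\<bar> * (cmod (f x))\<^sup>2 \<le> 2 * (\<bar>V x\<bar> * (cmod (f x - ?l K x))\<^sup>2) + 2 * (\<bar>V x\<bar> * (cmod (?l K x))\<^sup>2)" for x K
    using mult_left_mono[OF norm_add_sq_le[of "f x - ?l K x" "?l K x"] abs_ge_zero[of "V x"]]
    by (simp add: distrib_left mult_ac)
  have si: "integrable lebesgue (\<lambda>x. 2 * (\<bar>V x\<bar> * (cmod (f x - ?l K x))\<^sup>2) + 2 * (\<bar>V x\<bar> * (cmod (?l K x))\<^sup>2))" for K
    using hi(1) lo by (intro Bochner_Integration.integrable_add integrable_mult_right)
  show i: "integrable lebesgue (\<lambda>x. \<bar>V x\<bar> * (cmod (f x))\<^sup>2)"
  proof (rule Bochner_Integration.integrable_bound[OF si[of 0]])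
    show "AE x in lebesgue. norm (\<bar>V x\<bar> * (cmod (f x))\<^sup>2)
        \<le> norm (2 * (\<bar>V x\<bar> * (cmod (f x - ?l 0 x))\<^sup>2) + 2 * (\<bar>V x\<bar> * (cmod (?l 0 x))\<^sup>2))"
      unfolding real_norm_def
      by (intro AE_I2) (rule order.trans[OF _ abs_ge_self], use pw[of _ 0] in \<open>simp only: abs_mult abs_abs abs_power2\<close>)
  qed measurable
  have "(LINT x|lebesgue. \<bar>V x\<bar> * (cmod (f x))\<^sup>2)
    \<le> (LINT x|lebesgue. 2 * (\<bar>V x\<bar> * (cmod (f x - ?l K x))\<^sup>2) + 2 * (\<bar>V x\<bar> * (cmod (?l K x))\<^sup>2))"
    by (rule integral_mono[OF i si pw])
  also have "\<dots> = 2 * (LINT x|lebesgue. \<bar>V x\<bar> * (cmod (f x - ?l K x))\<^sup>2) + 2 * (LINT x|lebesgue. \<bar>V x\<bar> * (cmod (?l K x))\<^sup>2)"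
    using hi(1) lo by simp
  also have "\<dots> \<le> 2 * tail_const * \<theta> ^ K * wnorm g + 2 * (LINT x|lebesgue. \<bar>V x\<bar> * (cmod (?l K x))\<^sup>2)"
    using hi(2)[of K] by simp
  finally show "(LINT x|lebesgue. \<bar>V x\<bar> * (cmod (f x))\<^sup>2)
      \<le> 2 * tail_const * \<theta> ^ K * wnorm g + 2 * (LINT x|lebesgue. \<bar>V x\<bar> * (cmod (?l K x))\<^sup>2)" .
qed

definition "V_norm = (LINT x|lebesgue. \<bar>V x\<bar>)"

lemma V_norm_nonneg: "0 \<le> V_norm" by (simp add: V_norm_def)

text \<open>Cut at frequency 1: the high part is covered by the tail estimate with
  \<open>K = 0\<close>, and the low part is bounded in sup norm by the weighted norm, so that
  integrability of V suffices for it.\<close>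

lemma potential_bound:
  assumes f: "f \<in> L2" and rel: "fourier_rel f g" and g: "g \<in> wL2"
  shows "(LINT x|lebesgue. \<bar>V x\<bar> * (cmod (f x))\<^sup>2) \<le> (2 * tail_const + 2 * V_norm) * wnorm g"
proof -
  have lowL: "low 1 g \<in> L2" by (rule wL2_L2[OF low_wL2(1)[OF g]])
  have sup: "(cmod (ifourier (low 1 g) x))\<^sup>2 \<le> wnorm g" for x
    using ifourier_sup(2)[OF lowL, of 1 x] low_wL2(3)[OF g, of 1] l2sq_le_wnorm[OF g]
    by (simp add: low_def)
  note sp2 = potential_split(2)[OF f rel g, of 0, unfolded power_0]
    and sp3 = potential_split(3)[OF f rel g, of 0, unfolded power_0 mult_1_right]
  have "(LINT x|lebesgue. \<bar>V x\<bar> * (cmod (ifourier (low 1 g) x))\<^sup>2) \<le> (LINT x|lebesgue. \<bar>V x\<bar> * wnorm g)"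
    using V by (intro integral_mono[OF sp2] mult_left_mono sup) auto
  also have "\<dots> = V_norm * wnorm g" using V by (simp add: V_norm_def)
  finally show ?thesis using sp3 by (simp add: distrib_right)
qed

text \<open>The low-frequency part is uniformly Lipschitz, so on the compact set carrying most of the
  mass of \<open>V\<close> it is controlled by its values on a finite net.\<close>

lemma potential_relatively_compact:
  assumes \<epsilon>: "\<epsilon> > 0"
  shows "\<exists>(K::nat) Y C. finite Y \<and> 0 \<le> C \<and> (\<forall>f g. f \<in> L2 \<longrightarrow> fourier_rel f g \<longrightarrow> g \<in> wL2 \<longrightarrow>
      (LINT x|lebesgue. \<bar>V x\<bar> * (cmod (f x))\<^sup>2)
        \<le> \<epsilon> * wnorm g + C * (\<Sum>y\<in>Y. (cmod (ifourier (low (2 ^ K) g) y))\<^sup>2))"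
proof -
  have "(\<lambda>n. 2 * tail_const * \<theta> ^ n) \<longlonglongrightarrow> 2 * tail_const * 0"
    using \<theta> by (intro tendsto_intros LIMSEQ_realpow_zero) auto
  then have "\<forall>\<^sub>F n in sequentially. 2 * tail_const * \<theta> ^ n < \<epsilon> / 3"
    using \<epsilon> by (intro order_tendstoD(2)) auto
  \<comment> \<open>The error budget: \<epsilon> / 3 for the high frequencies and \<epsilon> / 3 for
    the low ones, the latter doubled by \<open>potential_split\<close>.\<close>
  then obtain K where K: "2 * tail_const * \<theta> ^ K < \<epsilon> / 3" by (auto simp: eventually_sequentially)
  define R where "R = (2::real) ^ K"
  have R: "R > 0" by (simp add: R_def)
  have tm: "(\<lambda>x. if norm x \<le> real n then 0 else \<bar>V x\<bar>) \<in> borel_measurable lebesgue" for n :: nat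
    by measurable
  have "(\<lambda>n::nat. LINT x|lebesgue. (if norm x \<le> real n then 0 else \<bar>V x\<bar>)) \<longlonglongrightarrow> (LINT x::plane|lebesgue. 0)"
  proof (rule integral_dominated_convergence[OF _ _ integrable_abs[OF V]])
    show "AE x in lebesgue. (\<lambda>n. if norm x \<le> real n then 0 else \<bar>V x\<bar>) \<longlonglongrightarrow> 0"
    proof (intro AE_I2 tendsto_eventually)
      fix x :: plane
      obtain k :: nat where "norm x \<le> real k" using real_arch_simple by blast
      then have "(if norm x \<le> real n then 0 else \<bar>V x\<bar>) = 0" if "k \<le> n" for n
        using that by simp
      then show "\<forall>\<^sub>F n in sequentially. (if norm x \<le> real n then 0 else \<bar>V x\<bar>) = 0"
        unfolding eventually_sequentially by blast
    qed
  qed (auto intro: tm)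
  then have "\<forall>\<^sub>F n in sequentially. (LINT x|lebesgue. (if norm x \<le> real n then 0 else \<bar>V x\<bar>)) < \<epsilon> / (6 * R\<^sup>2)"
    using \<epsilon> R by (intro order_tendstoD(2)) auto
  \<comment> \<open>Outside the disc the low part is only bounded by
    \<open>R\<^sup>2 * wnorm g\<close>; this bound turns the remaining mass of V into \<epsilon> /
    6, half of the low-frequency budget.\<close>
  then obtain n :: nat where n: "(LINT x|lebesgue. (if norm x \<le> real n then 0 else \<bar>V x\<bar>)) < \<epsilon> / (6 * R\<^sup>2)"
    by (auto simp: eventually_sequentially)
  \<comment> \<open>The mesh makes the Lipschitz error at most \<epsilon> / 12 after integration
    against |V|; comparison with the nearest net point doubles it to the other \<epsilon> / 6. The
    summand 1 guards against a vanishing potential.\<close>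
  define \<delta> where "\<delta> = sqrt (\<epsilon> / (12 * (V_norm + 1))) / R\<^sup>2"
  have \<delta>: "\<delta> > 0" using \<epsilon> R V_norm_nonneg by (simp add: \<delta>_def)
  have \<delta>2: "V_norm * (R\<^sup>2 * \<delta>)\<^sup>2 \<le> \<epsilon> / 12"
  proof -
    have "(R\<^sup>2 * \<delta>)\<^sup>2 = \<epsilon> / (12 * (V_norm + 1))" using \<epsilon> R V_norm_nonneg by (simp add: \<delta>_def)
    then have "V_norm * (R\<^sup>2 * \<delta>)\<^sup>2 = (\<epsilon> / 12) * (V_norm / (V_norm + 1))" by simp
    also have "\<dots> \<le> (\<epsilon> / 12) * 1" using \<epsilon> V_norm_nonneg by (intro mult_left_mono) auto
    finally show ?thesis by simp
  qed
  obtain Y where Y: "finite Y" "cball (0::plane) (real n) \<subseteq> (\<Union>y\<in>Y. ball y \<delta>)"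
    using seq_compact_imp_totally_bounded[of "cball (0::plane) (real n)"] \<delta> compact_imp_seq_compact[OF compact_cball]
    by blast
  define C where "C = 4 * V_norm"
  have main: "(LINT x|lebesgue. \<bar>V x\<bar> * (cmod (f x))\<^sup>2)
      \<le> \<epsilon> * wnorm g + C * (\<Sum>y\<in>Y. (cmod (ifourier (low (2 ^ K) g) y))\<^sup>2)"
    if f: "f \<in> L2" and rel: "fourier_rel f g" and g: "g \<in> wL2" for f g
  proof -
    let ?h = "ifourier (low R g)" and ?\<Sigma> = "\<Sum>y\<in>Y. (cmod (ifourier (low R g) y))\<^sup>2"
    let ?t = "\<lambda>x. if norm x \<le> real n then 0 else \<bar>V x\<bar>"
    have lowL: "low R g \<in> L2" by (rule wL2_L2[OF low_wL2(1)[OF g]])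
    have supp: "low R g p = 0" if "norm p > R" for p using that by (simp add: low_def)
    have ll: "l2sq (low R g) \<le> wnorm g" using low_wL2(3)[OF g, of R] l2sq_le_wnorm[OF g] by simp
    have sup: "(cmod (?h x))\<^sup>2 \<le> R\<^sup>2 * wnorm g" for x
    proof -
      have "(cmod (?h x))\<^sup>2 \<le> R\<^sup>2 * l2sq (low R g)"
        by (rule ifourier_sup(2)[OF lowL supp]) (use R in auto)
      then show ?thesis using mult_left_mono[OF ll, of "R\<^sup>2"] by simp
    qed
    have net: "(cmod (?h x))\<^sup>2 \<le> 2 * ?\<Sigma> + 2 * ((R\<^sup>2 * \<delta>)\<^sup>2 * wnorm g)" if x: "norm x \<le> real n" for x
    proof -
      have "x \<in> cball 0 (real n)" using x by simp
      then obtain y where y: "y \<in> Y" "dist y x < \<delta>" using Y(2) by auto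
      have "(cmod (?h x))\<^sup>2 \<le> 2 * (cmod (?h x - ?h y))\<^sup>2 + 2 * (cmod (?h y))\<^sup>2"
        using norm_add_sq_le[of "?h x - ?h y" "?h y"] by simp
      moreover have "(cmod (?h y))\<^sup>2 \<le> ?\<Sigma>"
        by (rule member_le_sum[OF y(1) _ Y(1), of "\<lambda>y. (cmod (?h y))\<^sup>2"]) simp
      moreover have "(cmod (?h x - ?h y))\<^sup>2 \<le> (R\<^sup>2 * \<delta>)\<^sup>2 * wnorm g"
      proof -
        have "(cmod (?h x - ?h y))\<^sup>2 \<le> (R\<^sup>2 * norm (x - y))\<^sup>2 * l2sq (low R g)"
          by (rule ifourier_Lipschitz[OF lowL supp]) (use R in auto)
        also have "\<dots> \<le> (R\<^sup>2 * \<delta>)\<^sup>2 * wnorm g"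
          using y(2) by (intro mult_mono power_mono mult_left_mono ll l2sq_nonneg)
            (auto simp: dist_norm norm_minus_commute)
        finally show ?thesis .
      qed
      ultimately show ?thesis by linarith
    qed
    let ?c = "2 * ?\<Sigma> + 2 * ((R\<^sup>2 * \<delta>)\<^sup>2 * wnorm g)"
    have S0: "0 \<le> ?\<Sigma>" by (intro sum_nonneg) auto
    have c0: "0 \<le> ?c" using S0 wnorm_nonneg[of g] by simp
    have pw: "\<bar>V x\<bar> * (cmod (?h x))\<^sup>2 \<le> ?t x * (R\<^sup>2 * wnorm g) + \<bar>V x\<bar> * ?c" for x
    proof (cases "norm x \<le> real n")
      case True
      then show ?thesis using mult_left_mono[OF net[OF True] abs_ge_zero[of "V x"]] by simp
    next
      case False
      have "0 \<le> \<bar>V x\<bar> * ?c" using c0 by simp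
      then show ?thesis using False mult_left_mono[OF sup[of x] abs_ge_zero[of "V x"]] by simp
    qed
    note sp2 = potential_split(2)[OF f rel g, of K, folded R_def]
      and sp3 = potential_split(3)[OF f rel g, of K, folded R_def]
    have ti: "integrable lebesgue ?t"
      by (rule Bochner_Integration.integrable_bound[OF integrable_abs[OF V] tm]) auto
    have "(LINT x|lebesgue. \<bar>V x\<bar> * (cmod (?h x))\<^sup>2) \<le> (LINT x|lebesgue. ?t x * (R\<^sup>2 * wnorm g) + \<bar>V x\<bar> * ?c)"
      using V ti by (intro integral_mono[OF sp2 _ pw] Bochner_Integration.integrable_add integrable_mult_left) auto
    also have "\<dots> = (LINT x|lebesgue. ?t x * (R\<^sup>2 * wnorm g)) + (LINT x|lebesgue. \<bar>V x\<bar> * ?c)"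
      using V ti by (intro Bochner_Integration.integral_add integrable_mult_left) auto
    also have "\<dots> = (LINT x|lebesgue. ?t x) * (R\<^sup>2 * wnorm g) + V_norm * ?c"
      by (simp only: integral_mult_left_zero V_norm_def)
    also have "\<dots> \<le> \<epsilon> / (6 * R\<^sup>2) * (R\<^sup>2 * wnorm g) + (2 * V_norm * ?\<Sigma> + 2 * (\<epsilon> / 12 * wnorm g))"
    proof (rule add_mono)
      show "(LINT x|lebesgue. ?t x) * (R\<^sup>2 * wnorm g) \<le> \<epsilon> / (6 * R\<^sup>2) * (R\<^sup>2 * wnorm g)"
        using n wnorm_nonneg[of g] by (intro mult_right_mono) auto
      have "V_norm * ?c = 2 * V_norm * ?\<Sigma> + 2 * ((V_norm * (R\<^sup>2 * \<delta>)\<^sup>2) * wnorm g)"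
        by (simp only: distrib_left mult_ac)
      also have "\<dots> \<le> 2 * V_norm * ?\<Sigma> + 2 * (\<epsilon> / 12 * wnorm g)"
        by (intro add_left_mono mult_left_mono mult_right_mono \<delta>2 wnorm_nonneg) auto
      finally show "V_norm * ?c \<le> 2 * V_norm * ?\<Sigma> + 2 * (\<epsilon> / 12 * wnorm g)" .
    qed
    also have "\<dots> = \<epsilon> / 3 * wnorm g + 2 * V_norm * ?\<Sigma>" using R by (simp add: field_simps)
    finally have lo: "(LINT x|lebesgue. \<bar>V x\<bar> * (cmod (?h x))\<^sup>2) \<le> \<epsilon> / 3 * wnorm g + 2 * V_norm * ?\<Sigma>" .
    have "2 * tail_const * \<theta> ^ K * wnorm g \<le> \<epsilon> / 3 * wnorm g"
      using K wnorm_nonneg[of g] by (intro mult_right_mono) auto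
    then have "(LINT x|lebesgue. \<bar>V x\<bar> * (cmod (f x))\<^sup>2) \<le> \<epsilon> / 3 * wnorm g + 2 * (\<epsilon> / 3 * wnorm g + 2 * V_norm * ?\<Sigma>)"
      by (intro order.trans[OF sp3] add_mono mult_left_mono lo) auto
    also have "\<dots> = \<epsilon> * wnorm g + C * ?\<Sigma>" by (simp add: C_def)
    finally show ?thesis unfolding R_def .
  qed
  show ?thesis
    by (rule exI[of _ K], rule exI[of _ Y], rule exI[of _ C]) (use Y(1) V_norm_nonneg main in \<open>auto simp: C_def\<close>)
qed

end

section \<open>The quadratic form of the Hamiltonian\<close>

lemma spinor_norm_sq: "(norm (v::spinor))\<^sup>2 = (cmod (v $ 1))\<^sup>2 + (cmod (v $ 2))\<^sup>2"
  by (simp add: norm_vec_def L2_set_def sum_2)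

lemma component_measurable[measurable]:
  fixes \<Psi> :: "'a \<Rightarrow> complex^2"
  assumes "\<Psi> \<in> borel_measurable M" shows "(\<lambda>x. \<Psi> x $ i) \<in> borel_measurable M"
  by (rule borel_measurable_continuous_on[OF _ assms]) (intro continuous_intros)

lemma spinor_measurableI:
  fixes \<Psi> :: "'a \<Rightarrow> complex^2"
  assumes "\<And>i. (\<lambda>x. \<Psi> x $ i) \<in> borel_measurable M" shows "\<Psi> \<in> borel_measurable M"
proof (rule borel_measurable_euclidean_space[THEN iffD2], rule ballI)
  fix b :: "complex^2" assume "b \<in> Basis"
  then obtain i u where b: "b = axis i u" by (auto simp: Basis_vec_def)
  have "(\<lambda>x. (\<Psi> x $ i) \<bullet> u) \<in> borel_measurable M" using assms by measurable
  then show "(\<lambda>x. \<Psi> x \<bullet> b) \<in> borel_measurable M" by (simp add: b inner_axis)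
qed

lemma L2_component:
  fixes \<Psi> :: "plane \<Rightarrow> spinor" assumes "\<Psi> \<in> L2" shows "(\<lambda>x. \<Psi> x $ i) \<in> L2"
  by (rule L2I[OF component_measurable[OF L2_measurable[OF assms]] L2_integrable[OF assms]])
     (intro AE_I2 power_mono Finite_Cartesian_Product.norm_nth_le norm_ge_zero)

lemma L2_spinorI:
  fixes \<Psi> :: "plane \<Rightarrow> spinor" assumes "\<And>i. (\<lambda>x. \<Psi> x $ i) \<in> L2" shows "\<Psi> \<in> L2"
proof (rule L2I[OF spinor_measurableI[OF L2_measurable[OF assms]]])
  show "integrable lebesgue (\<lambda>x. (cmod (\<Psi> x $ 1))\<^sup>2 + (cmod (\<Psi> x $ 2))\<^sup>2)"
    using assms by (intro Bochner_Integration.integrable_add L2_integrable)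
qed (simp add: spinor_norm_sq)

lemma l2sq_spinor:
  fixes \<Psi> :: "plane \<Rightarrow> spinor" assumes "\<Psi> \<in> L2"
  shows "l2sq \<Psi> = l2sq (\<lambda>x. \<Psi> x $ 1) + l2sq (\<lambda>x. \<Psi> x $ 2)"
  using L2_integrable[OF L2_component[OF assms, of 1]] L2_integrable[OF L2_component[OF assms, of 2]]
  by (simp add: l2sq_def spinor_norm_sq)

lemma fourier2_rel:
  assumes "\<Psi> \<in> L2" shows "fourier_rel (\<lambda>x. \<Psi> x $ i) (\<lambda>p. fourier2 \<Psi> p $ i)"
  using fourier_rel_fourier_L2[OF L2_component[OF assms, of i]] by (simp add: fourier2_def)

lemma fourier_rel_L2: "fourier_rel f g \<Longrightarrow> g \<in> L2"
  by (simp add: fourier_rel_def)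

lemma fourier2_L2: "\<Psi> \<in> L2 \<Longrightarrow> fourier2 \<Psi> \<in> L2"
  by (rule L2_spinorI) (rule fourier_rel_L2[OF fourier2_rel])

lemma fourier2_isometric: assumes "\<Psi> \<in> L2" shows "l2sq (fourier2 \<Psi>) = l2sq \<Psi>"
  unfolding l2sq_spinor[OF assms] l2sq_spinor[OF fourier2_L2[OF assms]]
  using fourier_rel_isometric[OF fourier2_rel[OF assms] L2_component[OF assms]] by simp

lemma fourier2_eqI:
  assumes \<Psi>: "\<Psi> \<in> L2" and "\<And>i. fourier_rel (\<lambda>x. \<Psi> x $ i) (\<lambda>p. G p $ i)"
  shows "AE p in lebesgue. fourier2 \<Psi> p = G p"
proof -
  have "AE p in lebesgue. fourier2 \<Psi> p $ i = G p $ i" for i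
    by (rule fourier_rel_unique[OF fourier2_rel[OF \<Psi>] assms(2) L2_component[OF \<Psi>]]) simp
  from this[of 1] this[of 2] show ?thesis
    by eventually_elim (simp add: vec_eq_iff forall_2)
qed

lemma L2_combo:
  fixes \<Phi> \<Psi> :: "plane \<Rightarrow> spinor"
  assumes "\<Phi> \<in> L2" "\<Psi> \<in> L2" shows "(\<lambda>x. c *s \<Phi> x + \<Psi> x) \<in> L2"
proof (rule L2_spinorI)
  fix i show "(\<lambda>x. (c *s \<Phi> x + \<Psi> x) $ i) \<in> L2"
    using L2_add[OF L2_mult[OF L2_component[OF assms(1), of i], of c] L2_component[OF assms(2), of i]] by simp
qed

lemma fourier2_combo:
  assumes "\<Phi> \<in> L2" "\<Psi> \<in> L2"
  shows "AE p in lebesgue. fourier2 (\<lambda>x. c *s \<Phi> x + \<Psi> x) p = c *s fourier2 \<Phi> p + fourier2 \<Psi> p"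
proof (rule fourier2_eqI[OF L2_combo[OF assms]])
  fix i
  show "fourier_rel (\<lambda>x. (c *s \<Phi> x + \<Psi> x) $ i) (\<lambda>p. (c *s fourier2 \<Phi> p + fourier2 \<Psi> p) $ i)"
    using fourier_rel_combo[OF fourier2_rel[OF assms(1), of i] fourier2_rel[OF assms(2), of i] L2_component[OF assms(1)] L2_component[OF assms(2)], of c]
    by simp
qed

lemma fourier2_surj:
  fixes G :: "plane \<Rightarrow> spinor" assumes "G \<in> L2"
  shows "\<exists>\<Psi>\<in>L2. AE p in lebesgue. fourier2 \<Psi> p = G p"
proof -
  have "\<forall>i. \<exists>f\<in>L2. fourier_rel f (\<lambda>p. G p $ i)" using fourier_rel_surj[OF L2_component[OF assms]] by blast
  then obtain f where f: "\<And>i. f i \<in> L2" "\<And>i. fourier_rel (f i) (\<lambda>p. G p $ i)" by metis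
  define \<Psi> where "\<Psi> x = (\<chi> i. f i x)" for x
  have "\<Psi> \<in> L2" by (rule L2_spinorI) (simp add: \<Psi>_def f)
  moreover from this have "AE p in lebesgue. fourier2 \<Psi> p = G p"
    by (rule fourier2_eqI) (simp add: \<Psi>_def f)
  ultimately show ?thesis by blast
qed

section \<open>The Sobolev space and its completeness\<close>

definition sH :: "(plane \<Rightarrow> spinor) \<Rightarrow> real" where
  "sH \<Psi> = (LINT p|lebesgue. (1 + (norm p)\<^sup>2) * (norm (fourier2 \<Psi> p))\<^sup>2)"

lemma H1_L2: "\<Psi> \<in> H1 \<Longrightarrow> \<Psi> \<in> L2" by (simp add: H1_def)

lemma H1_integrable: "\<Psi> \<in> H1 \<Longrightarrow> integrable lebesgue (\<lambda>p. (1 + (norm p)\<^sup>2) * (norm (fourier2 \<Psi> p))\<^sup>2)"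
  by (simp add: H1_def)

text \<open>\<open>fourier2\<close> picks an unspecified representative; membership and norm may be
  computed from any function \<open>G\<close> that agrees with it almost everywhere.\<close>

lemma H1I_AE:
  assumes \<Psi>: "\<Psi> \<in> L2" and ae: "AE p in lebesgue. fourier2 \<Psi> p = G p"
    and i: "integrable lebesgue (\<lambda>p. (1 + (norm p)\<^sup>2) * (norm (G p))\<^sup>2)"
  shows "\<Psi> \<in> H1" "sH \<Psi> = (LINT p|lebesgue. (1 + (norm p)\<^sup>2) * (norm (G p))\<^sup>2)"
proof -
  note [measurable] = L2_measurable[OF fourier2_L2[OF \<Psi>]]
  have m: "(\<lambda>p. (1 + (norm p)\<^sup>2) * (norm (fourier2 \<Psi> p))\<^sup>2) \<in> borel_measurable lebesgue" by measurable
  have ae': "AE p in lebesgue. (1 + (norm p)\<^sup>2) * (norm (G p))\<^sup>2 = (1 + (norm p)\<^sup>2) * (norm (fourier2 \<Psi> p))\<^sup>2"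
    using ae by eventually_elim simp
  have "integrable lebesgue (\<lambda>p. (1 + (norm p)\<^sup>2) * (norm (fourier2 \<Psi> p))\<^sup>2)"
    by (rule integrable_cong_AE_imp[OF i m]) (use ae' in \<open>auto\<close>)
  then show "\<Psi> \<in> H1" using \<Psi> by (simp add: H1_def)
  show "sH \<Psi> = (LINT p|lebesgue. (1 + (norm p)\<^sup>2) * (norm (G p))\<^sup>2)"
    unfolding sH_def
    by (rule integral_cong_AE[OF m borel_measurable_integrable[OF i]]) (use ae in auto)
qed

lemma H1_combo:
  assumes "\<Phi> \<in> H1" "\<Psi> \<in> H1" shows "(\<lambda>x. c *s \<Phi> x + \<Psi> x) \<in> H1"
proof (rule H1I_AE(1)[OF L2_combo[OF H1_L2[OF assms(1)] H1_L2[OF assms(2)]] fourier2_combo[OF H1_L2[OF assms(1)] H1_L2[OF assms(2)]]])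
  note L = fourier2_L2[OF H1_L2[OF assms(1)]] fourier2_L2[OF H1_L2[OF assms(2)]]
  have m: "(\<lambda>p. c *s fourier2 \<Phi> p + fourier2 \<Psi> p) \<in> borel_measurable lebesgue"
    by (rule L2_measurable[OF L2_combo[OF L]])
  have nc: "norm (c *s v) = cmod c * norm v" for v :: spinor
  proof -
    have "(norm (c *s v))\<^sup>2 = (cmod c * norm v)\<^sup>2"
      by (simp add: spinor_norm_sq norm_mult power_mult_distrib distrib_left)
    then show ?thesis by (simp add: power2_eq_iff_nonneg)
  qed
  show "integrable lebesgue (\<lambda>p. (1 + (norm p)\<^sup>2) * (norm (c *s fourier2 \<Phi> p + fourier2 \<Psi> p))\<^sup>2)"
  proof (rule Bochner_Integration.integrable_bound)
    show "integrable lebesgue (\<lambda>p. 2 * (cmod c)\<^sup>2 * ((1 + (norm p)\<^sup>2) * (norm (fourier2 \<Phi> p))\<^sup>2)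
        + 2 * ((1 + (norm p)\<^sup>2) * (norm (fourier2 \<Psi> p))\<^sup>2))"
      by (intro Bochner_Integration.integrable_add integrable_mult_right H1_integrable assms)
    show "(\<lambda>p. (1 + (norm p)\<^sup>2) * (norm (c *s fourier2 \<Phi> p + fourier2 \<Psi> p))\<^sup>2) \<in> borel_measurable lebesgue"
      using m by measurable
    show "AE p in lebesgue. norm ((1 + (norm p)\<^sup>2) * (norm (c *s fourier2 \<Phi> p + fourier2 \<Psi> p))\<^sup>2)
       \<le> norm (2 * (cmod c)\<^sup>2 * ((1 + (norm p)\<^sup>2) * (norm (fourier2 \<Phi> p))\<^sup>2)
        + 2 * ((1 + (norm p)\<^sup>2) * (norm (fourier2 \<Psi> p))\<^sup>2))"
    proof (rule AE_I2)
      fix p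
      have "(1 + (norm p)\<^sup>2) * (norm (c *s fourier2 \<Phi> p + fourier2 \<Psi> p))\<^sup>2
        \<le> (1 + (norm p)\<^sup>2) * (2 * (norm (c *s fourier2 \<Phi> p))\<^sup>2 + 2 * (norm (fourier2 \<Psi> p))\<^sup>2)"
        by (intro mult_left_mono norm_add_sq_le) auto
      also have "\<dots> = 2 * (cmod c)\<^sup>2 * ((1 + (norm p)\<^sup>2) * (norm (fourier2 \<Phi> p))\<^sup>2)
        + 2 * ((1 + (norm p)\<^sup>2) * (norm (fourier2 \<Psi> p))\<^sup>2)"
        by (simp add: nc power_mult_distrib algebra_simps)
      finally show "norm ((1 + (norm p)\<^sup>2) * (norm (c *s fourier2 \<Phi> p + fourier2 \<Psi> p))\<^sup>2)
       \<le> norm (2 * (cmod c)\<^sup>2 * ((1 + (norm p)\<^sup>2) * (norm (fourier2 \<Phi> p))\<^sup>2)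
        + 2 * ((1 + (norm p)\<^sup>2) * (norm (fourier2 \<Psi> p))\<^sup>2))"
        by (simp add: abs_of_nonneg)
    qed
  qed
qed

lemma zero_H1: "(\<lambda>x. 0) \<in> H1"
proof (rule H1I_AE(1)[OF L2_zero fourier2_eqI[OF L2_zero]])
  fix i :: 2
  show "fourier_rel (\<lambda>x. (0::spinor) $ i) (\<lambda>p. (0::spinor) $ i)"
    by (simp add: fourier_rel_zero)
qed simp

lemma H1_component_wL2: assumes "\<Psi> \<in> H1" shows "(\<lambda>p. fourier2 \<Psi> p $ i) \<in> wL2"
proof -
  note L = L2_component[OF fourier2_L2[OF H1_L2[OF assms]], of i]
  note [measurable] = L2_measurable[OF L]
  have "integrable lebesgue (\<lambda>p. (1 + (norm p)\<^sup>2) * (cmod (fourier2 \<Psi> p $ i))\<^sup>2)"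
  proof (rule Bochner_Integration.integrable_bound[OF H1_integrable[OF assms]])
    have "(1 + (norm p)\<^sup>2) * (cmod (fourier2 \<Psi> p $ i))\<^sup>2 \<le> (1 + (norm p)\<^sup>2) * (norm (fourier2 \<Psi> p))\<^sup>2" for p
      by (intro mult_left_mono power_mono Finite_Cartesian_Product.norm_nth_le) auto
    then show "AE p in lebesgue. norm ((1 + (norm p)\<^sup>2) * (cmod (fourier2 \<Psi> p $ i))\<^sup>2)
        \<le> norm ((1 + (norm p)\<^sup>2) * (norm (fourier2 \<Psi> p))\<^sup>2)"
      by (auto simp: abs_mult)
  qed measurable
  then show ?thesis using L by (simp add: wL2_def)
qed

lemma sH_wnorm:
  assumes "\<Psi> \<in> H1" shows "sH \<Psi> = wnorm (\<lambda>p. fourier2 \<Psi> p $ 1) + wnorm (\<lambda>p. fourier2 \<Psi> p $ 2)"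
  using H1_component_wL2[OF assms, of 1] H1_component_wL2[OF assms, of 2]
  unfolding sH_def wnorm_def spinor_norm_sq wL2_def by (simp add: distrib_left)

lemma l2sq_le_sH: assumes "\<Psi> \<in> H1" shows "l2sq \<Psi> \<le> sH \<Psi>"
  unfolding fourier2_isometric[OF H1_L2[OF assms], symmetric] sH_wnorm[OF assms]
    l2sq_spinor[OF fourier2_L2[OF H1_L2[OF assms]]]
  by (intro add_mono l2sq_le_wnorm H1_component_wL2 assms)

text \<open>Fields are added and scaled pointwise as functions, which gives a genuine complex vector
  space; identification modulo null sets is left to the degenerate inner product.\<close>

definition fscale :: "complex \<Rightarrow> (plane \<Rightarrow> spinor) \<Rightarrow> plane \<Rightarrow> spinor" where
  "fscale c \<Psi> = (\<lambda>x. c *s \<Psi> x)"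

interpretation spinor_fields: complex_vector_space fscale
  by unfold_locales
     (auto simp: fscale_def fun_eq_iff vec_eq_iff algebra_simps)

lemma H1_subspace: "spinor_fields.subspace H1"
proof (rule spinor_fields.subspaceI)
  show "0 \<in> H1" using zero_H1 by (simp add: zero_fun_def)
  show "x + y \<in> H1" if "x \<in> H1" "y \<in> H1" for x y
    using H1_combo[OF that, of 1] by (simp add: plus_fun_def)
  show "fscale c x \<in> H1" if "x \<in> H1" for c x
    using H1_combo[OF that zero_H1, of c] by (simp add: fscale_def)
qed

lemma H1_diff: "x \<in> H1 \<Longrightarrow> y \<in> H1 \<Longrightarrow> x - y \<in> H1"
  by (rule spinor_fields.subspace_diff[OF H1_subspace])

lemma fourier2_diff:
  assumes "x \<in> L2" "y \<in> L2"
  shows "AE p in lebesgue. fourier2 (x - y) p = fourier2 x p - fourier2 y p"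
proof -
  have "(\<lambda>a. (- 1) *s y a + x a) = x - y" by (auto simp: fun_eq_iff vec_eq_iff)
  then show ?thesis using fourier2_combo[OF assms(2,1), of "- 1"] by (simp add: vec_eq_iff)
qed

text \<open>Multiplication of the transform by \<open>sqrt (1 + (norm p)\<^sup>2)\<close> turns the
  \<open>H1\<close> distance into an \<open>L2\<close> distance. The \<open>L2\<close> limit is
  divided by the weight and pulled back by surjectivity of the transform.\<close>

lemma H1_complete:
  assumes u: "\<And>n. u n \<in> H1"
    and cau: "\<And>\<epsilon>. \<epsilon> > 0 \<Longrightarrow> \<exists>n0. \<forall>m\<ge>n0. \<forall>n\<ge>n0. sH (u m - u n) < \<epsilon>"
  shows "\<exists>x\<in>H1. (\<lambda>n::nat. sH (u n - x)) \<longlonglongrightarrow> 0"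
proof -
  define w where "w p = sqrt (1 + (norm p)\<^sup>2)" for p :: plane
  have w: "w p \<ge> 1" "(w p)\<^sup>2 = 1 + (norm p)\<^sup>2" "w p \<noteq> 0" for p
    using real_sqrt_ge_one[of "1 + (norm p)\<^sup>2"] by (auto simp: w_def add_nonneg_eq_0_iff)
  have wm[measurable]: "w \<in> borel_measurable lebesgue" unfolding w_def by measurable
  define G where "G n p = w p *\<^sub>R fourier2 (u n) p" for n p
  have FL: "fourier2 (u n) \<in> L2" for n by (rule fourier2_L2[OF H1_L2[OF u]])
  note [measurable] = L2_measurable[OF FL]
  have [measurable]: "G n \<in> borel_measurable lebesgue" for n
    unfolding G_def[abs_def] by measurable
  have GL: "G n \<in> L2" for n
    by (rule L2I[OF _ H1_integrable[OF u[of n]]]) (auto simp: G_def power_mult_distrib w)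
  have diff: "sH (u n - x) = l2sq (\<lambda>p. G n p - w p *\<^sub>R fourier2 x p)" if x: "x \<in> H1" for n x
  proof -
    note XL = fourier2_L2[OF H1_L2[OF x]]
    have "AE p in lebesgue. (1 + (norm p)\<^sup>2) * (norm (fourier2 (u n - x) p))\<^sup>2 = (norm (G n p - w p *\<^sub>R fourier2 x p))\<^sup>2"
      using fourier2_diff[OF H1_L2[OF u[of n]] H1_L2[OF x]]
      by eventually_elim (simp add: G_def scaleR_diff_right[symmetric] power_mult_distrib w)
    moreover note [measurable] = L2_measurable[OF XL] L2_measurable[OF fourier2_L2[OF H1_L2[OF H1_diff[OF u[of n] x]]]] L2_measurable[OF GL]
    have "(\<lambda>p. (1 + (norm p)\<^sup>2) * (norm (fourier2 (u n - x) p))\<^sup>2) \<in> borel_measurable lebesgue"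
      "(\<lambda>p. (norm (G n p - w p *\<^sub>R fourier2 x p))\<^sup>2) \<in> borel_measurable lebesgue" by measurable
    ultimately show ?thesis unfolding sH_def l2sq_def by (intro integral_cong_AE) auto
  qed
  have "\<exists>n0. \<forall>m\<ge>n0. \<forall>n\<ge>n0. l2sq (\<lambda>p. G m p - G n p) < \<epsilon>" if "\<epsilon> > 0" for \<epsilon>
    using cau[OF that] diff[OF u] by (simp add: G_def)
  from L2_complete[OF GL this] obtain H where H: "H \<in> L2" "(\<lambda>n. l2sq (\<lambda>p. G n p - H p)) \<longlonglongrightarrow> 0"
    by blast
  note [measurable] = L2_measurable[OF H(1)]
  have "(\<lambda>p. (1 / w p) *\<^sub>R H p) \<in> L2"
  proof (rule L2I[OF _ L2_integrable[OF H(1)]])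
    show "AE p in lebesgue. (norm ((1 / w p) *\<^sub>R H p))\<^sup>2 \<le> (norm (H p))\<^sup>2"
    proof (intro AE_I2 power_mono)
      fix p show "norm ((1 / w p) *\<^sub>R H p) \<le> norm (H p)"
        using w(1)[of p] mult_right_mono[of "1 / w p" 1 "norm (H p)"] by simp
    qed simp
  qed measurable
  from fourier2_surj[OF this] obtain x where x: "x \<in> L2" "AE p in lebesgue. fourier2 x p = (1 / w p) *\<^sub>R H p"
    by blast
  have "(1 + (norm p)\<^sup>2) * (norm ((1 / w p) *\<^sub>R H p))\<^sup>2 = (norm (H p))\<^sup>2" for p
    using w(3)[of p] by (simp add: power_mult_distrib power_divide w(2)[symmetric])
  then have xH: "x \<in> H1"
    by (intro H1I_AE(1)[OF x]) (simp only: L2_integrable[OF H(1)])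
  note [measurable] = L2_measurable[OF fourier2_L2[OF x(1)]] L2_measurable[OF GL]
  have GH: "(\<lambda>p. G n p - H p) \<in> L2" for n by (rule L2_diff[OF GL H(1)])
  have "l2sq (\<lambda>p. G n p - H p) = l2sq (\<lambda>p. G n p - w p *\<^sub>R fourier2 x p)" for n
    by (rule l2sq_cong_AE[OF GH]) (use x(2) w(3) in auto)
  then have "(\<lambda>n. sH (u n - x)) \<longlonglongrightarrow> 0" using H(2) diff[OF xH] by simp
  then show ?thesis using xH by blast
qed


section \<open>Pointwise spinor algebra of the symbol\<close>

lemma cinner_spinor: "cinner (u::spinor) v = cnj (u $ 1) * v $ 1 + cnj (u $ 2) * v $ 2"
  by (simp add: cinner_def sum_2)

lemma cinner_self: "cinner (v::spinor) v = of_real ((norm v)\<^sup>2)"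
  unfolding cinner_spinor spinor_norm_sq of_real_add complex_norm_square by (simp only: mult.commute)

lemma spinor_products_le:
  "cmod (u $ i) * cmod (v $ j) \<le> norm (u::spinor) * norm (v::spinor)"
  by (intro mult_mono Finite_Cartesian_Product.norm_nth_le) auto

lemma cinner_bound: "cmod (cinner (u::spinor) v) \<le> 2 * (norm u * norm v)"
  using norm_triangle_ineq[of "cnj (u $ 1) * v $ 1" "cnj (u $ 2) * v $ 2"]
    spinor_products_le[of u 1 v 1] spinor_products_le[of u 2 v 2]
  unfolding cinner_spinor by (simp add: norm_mult)

lemma cinner_commute: "cinner (v::spinor) u = cnj (cinner u v)"
  by (simp add: cinner_spinor mult.commute)

lemma cinner_linear: "cinner (u::spinor) (c *s v + w) = c * cinner u v + cinner u w"
  by (simp add: cinner_spinor algebra_simps)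

lemma cinner_measurable[measurable]:
  assumes [measurable]: "\<Phi> \<in> borel_measurable M" "\<Psi> \<in> borel_measurable M"
  shows "(\<lambda>x. cinner (\<Phi> x :: spinor) (\<Psi> x)) \<in> borel_measurable M"
  unfolding cinner_spinor by measurable

lemma H0_symbol_cinner:
  "cinner u (H0_symbol A p *v v) = of_real ((norm p)\<^sup>2) * cinner u v
     + A p * (cnj (u $ 1) * v $ 2) + cnj (A p) * (cnj (u $ 2) * v $ 1)"
  by (simp add: cinner_spinor H0_symbol_def matrix_vector_mult_def sum_2 vector_2 algebra_simps)

lemma H0_symbol_bound:
  "cmod (cinner u (H0_symbol A p *v v)) \<le> 2 * ((norm p)\<^sup>2 + cmod (A p)) * (norm u * norm v)"
proof -
  let ?n = "norm u * norm v"
  have "cmod (of_real ((norm p)\<^sup>2) * cinner u v) \<le> (norm p)\<^sup>2 * (2 * ?n)"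
    unfolding norm_mult by (intro mult_mono cinner_bound) (auto simp: norm_power)
  moreover have "cmod (A p * (cnj (u $ 1) * v $ 2)) \<le> cmod (A p) * ?n"
    unfolding norm_mult complex_mod_cnj by (intro mult_left_mono spinor_products_le) auto
  moreover have "cmod (cnj (A p) * (cnj (u $ 2) * v $ 1)) \<le> cmod (A p) * ?n"
    unfolding norm_mult complex_mod_cnj by (intro mult_left_mono spinor_products_le) auto
  ultimately have "cmod (cinner u (H0_symbol A p *v v)) \<le> (norm p)\<^sup>2 * (2 * ?n) + cmod (A p) * ?n + cmod (A p) * ?n"
    unfolding H0_symbol_cinner by (intro order.trans[OF norm_triangle_ineq] add_mono order.trans[OF norm_triangle_ineq])
  then show ?thesis by (simp add: algebra_simps)
qed

lemma H0_symbol_commute: "cinner v (H0_symbol A p *v u) = cnj (cinner u (H0_symbol A p *v v))"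
  unfolding H0_symbol_cinner cinner_commute[of v u] by (simp add: algebra_simps)

lemma H0_symbol_linear:
  "cinner u (H0_symbol A p *v (c *s v + w)) = c * cinner u (H0_symbol A p *v v) + cinner u (H0_symbol A p *v w)"
  unfolding H0_symbol_cinner cinner_linear by (simp add: algebra_simps)

text \<open>\<open>lambda_minus A p\<close> is the lower eigenvalue of the symbol: the off-diagonal
  entries contribute at least \<open>- 2 * cmod (A p)\<close> times the product of the moduli of the
  two components, and twice that product is at most the squared norm.\<close>

lemma H0_symbol_ge: "lambda_minus A p * (norm v)\<^sup>2 \<le> Re (cinner v (H0_symbol A p *v v))"
proof -
  have c: "cnj (A p) * (cnj (v $ 2) * v $ 1) = cnj (A p * (cnj (v $ 1) * v $ 2))"
    by (simp only: complex_cnj_mult complex_cnj_cnj mult_ac)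
  have Re3: "Re (of_real a * of_real b + z + cnj z) = a * b + 2 * Re z" for a b z by simp
  have "Re (cinner v (H0_symbol A p *v v)) = (norm p)\<^sup>2 * (norm v)\<^sup>2 + 2 * Re (A p * (cnj (v $ 1) * v $ 2))"
    unfolding H0_symbol_cinner cinner_self c by (rule Re3)
  moreover have "- (cmod (A p) * (cmod (v $ 1) * cmod (v $ 2))) \<le> Re (A p * (cnj (v $ 1) * v $ 2))"
    using abs_Re_le_cmod[of "A p * (cnj (v $ 1) * v $ 2)"] by (simp add: norm_mult)
  moreover have "cmod (A p) * (2 * (cmod (v $ 1) * cmod (v $ 2))) \<le> cmod (A p) * (norm v)\<^sup>2"
    unfolding spinor_norm_sq using sum_squares_bound[of "cmod (v $ 1)" "cmod (v $ 2)"]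
    by (intro mult_left_mono) auto
  ultimately show ?thesis by (simp add: lambda_minus_def algebra_simps)
qed

text \<open>A common source for the inner product, the kinetic and the potential form. The map
  \<open>T\<close> is the identity or \<open>fourier2\<close>; the latter is linear only almost
  everywhere, which is all that the integrals see.\<close>

lemma hermitian_integral:
  assumes D: "spinor_fields.subspace D"
    and int: "\<And>\<Phi> \<Psi>. \<Phi> \<in> D \<Longrightarrow> \<Psi> \<in> D \<Longrightarrow> integrable lebesgue (\<lambda>p::plane. \<beta> p (T \<Phi> p) (T \<Psi> p))"
    and lin: "\<And>p u v w c. \<beta> p u (c *s v + w) = c * \<beta> p u v + \<beta> p u w"
    and sym: "\<And>p u v. \<beta> p v u = cnj (\<beta> p u v)"
    and T: "\<And>\<Phi> \<Psi> c. \<Phi> \<in> D \<Longrightarrow> \<Psi> \<in> D \<Longrightarrow> AE p in lebesgue. T (fscale c \<Phi> + \<Psi>) p = c *s T \<Phi> p + T \<Psi> p"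
  shows "spinor_fields.hermitian_on D (\<lambda>\<Phi> \<Psi>. LINT p|lebesgue. (\<beta> p (T \<Phi> p) (T \<Psi> p) :: complex))"
  unfolding spinor_fields.hermitian_on_def
proof (intro conjI ballI allI)
  fix x y z c assume X: "x \<in> D" "y \<in> D" "z \<in> D"
  have cD: "fscale c y + z \<in> D"
    using D X by (intro spinor_fields.subspace_add spinor_fields.subspace_scale)
  have "(LINT p|lebesgue. \<beta> p (T x p) (T (fscale c y + z) p))
      = (LINT p|lebesgue. c * \<beta> p (T x p) (T y p) + \<beta> p (T x p) (T z p))"
  proof (rule integral_cong_AE[OF borel_measurable_integrable[OF int[OF X(1) cD]]])
    show "(\<lambda>p. c * \<beta> p (T x p) (T y p) + \<beta> p (T x p) (T z p)) \<in> borel_measurable lebesgue"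
      using int[OF X(1,2)] int[OF X(1,3)] by (intro borel_measurable_integrable Bochner_Integration.integrable_add integrable_mult_right)
    show "AE p in lebesgue. \<beta> p (T x p) (T (fscale c y + z) p) = c * \<beta> p (T x p) (T y p) + \<beta> p (T x p) (T z p)"
      using T[OF X(2,3), of c] by eventually_elim (simp add: lin)
  qed
  also have "\<dots> = c * (LINT p|lebesgue. \<beta> p (T x p) (T y p)) + (LINT p|lebesgue. \<beta> p (T x p) (T z p))"
    using int[OF X(1,2)] int[OF X(1,3)] by simp
  finally show "(LINT p|lebesgue. \<beta> p (T x p) (T (fscale c y + z) p))
      = c * (LINT p|lebesgue. \<beta> p (T x p) (T y p)) + (LINT p|lebesgue. \<beta> p (T x p) (T z p))" .
next
  fix x y assume X: "x \<in> D" "y \<in> D"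
  have "(LINT p|lebesgue. \<beta> p (T y p) (T x p)) = (LINT p|lebesgue. cnj (\<beta> p (T x p) (T y p)))"
    by (rule Bochner_Integration.integral_cong[OF refl sym])
  also have "\<dots> = cnj (LINT p|lebesgue. \<beta> p (T x p) (T y p))"
    by (rule integral_bounded_linear[OF bounded_linear_cnj int[OF X]])
  finally show "(LINT p|lebesgue. \<beta> p (T y p) (T x p)) = cnj (LINT p|lebesgue. \<beta> p (T x p) (T y p))" .
qed

lemma L2_inner_integrable:
  fixes \<Phi> \<Psi> :: "plane \<Rightarrow> spinor"
  assumes "\<Phi> \<in> L2" "\<Psi> \<in> L2" shows "integrable lebesgue (\<lambda>x. cinner (\<Phi> x) (\<Psi> x))"
proof (rule Bochner_Integration.integrable_bound[OF integrable_mult_right[OF L2_product_integrable[OF assms], of 2]])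
  note [measurable] = L2_measurable[OF assms(1)] L2_measurable[OF assms(2)]
  show "(\<lambda>x. cinner (\<Phi> x) (\<Psi> x)) \<in> borel_measurable lebesgue"
    by (rule cinner_measurable[OF L2_measurable[OF assms(1)] L2_measurable[OF assms(2)]])
qed (simp add: cinner_bound)

lemma L2_inner_self: assumes "\<Psi> \<in> L2" shows "L2_inner \<Psi> \<Psi> = of_real (l2sq \<Psi>)"
  unfolding L2_inner_def cinner_self l2sq_def by (rule integral_complex_of_real)

lemma fourier2_fscale:
  assumes "\<Phi> \<in> H1" "\<Psi> \<in> H1"
  shows "AE p in lebesgue. fourier2 (fscale c \<Phi> + \<Psi>) p = c *s fourier2 \<Phi> p + fourier2 \<Psi> p"
  using fourier2_combo[OF H1_L2[OF assms(1)] H1_L2[OF assms(2)], of c] by (simp add: fscale_def plus_fun_def)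

lemma L2_inner_hermitian: "spinor_fields.hermitian_on H1 L2_inner"
  unfolding L2_inner_def[abs_def]
proof (rule hermitian_integral[OF H1_subspace, of "\<lambda>p. cinner" "\<lambda>\<Psi>. \<Psi>"])
  show "cinner v u = cnj (cinner u v)" for u v :: spinor by (rule cinner_commute)
qed (auto simp: cinner_linear fscale_def intro: L2_inner_integrable H1_L2)

section \<open>The Hamiltonian: bounds and coercivity of its form\<close>

locale spin_orbit = potential V r for V r +
  fixes A :: "plane \<Rightarrow> complex"
  assumes A_cont: "continuous_on UNIV A"
    and A_growth: "Limsup at_infinity (\<lambda>k. ereal (cmod (A k) / (norm k)\<^sup>2)) < 1"
begin

lemma A_measurable[measurable]: "A \<in> borel_measurable lebesgue"
  by (rule continuous_imp_lebesgue_measurable[OF A_cont])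

lemma A_outer: "\<exists>\<eta> R. 0 \<le> \<eta> \<and> \<eta> < 1 \<and> 1 \<le> R \<and> (\<forall>k. R \<le> norm k \<longrightarrow> cmod (A k) \<le> \<eta> * (norm k)\<^sup>2)"
proof -
  obtain c where c: "Limsup at_infinity (\<lambda>k. ereal (cmod (A k) / (norm k)\<^sup>2)) < ereal c" "ereal c < 1"
    using ereal_dense2[OF A_growth] by auto
  obtain b where b: "\<And>k. b \<le> norm k \<Longrightarrow> ereal (cmod (A k) / (norm k)\<^sup>2) < ereal c"
    using Limsup_lessD[OF c(1)] unfolding eventually_at_infinity by blast
  have "cmod (A k) \<le> max c 0 * (norm k)\<^sup>2" if "max b 1 \<le> norm k" for k
  proof -
    have "(norm k)\<^sup>2 > 0" using that by auto
    then have "cmod (A k) \<le> c * (norm k)\<^sup>2" using b[of k] that by (simp add: field_simps)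
    also have "\<dots> \<le> max c 0 * (norm k)\<^sup>2" by (intro mult_right_mono) auto
    finally show ?thesis .
  qed
  moreover have "max c 0 < 1" using c(2) by (simp add: one_ereal_def)
  ultimately show ?thesis by (intro exI[of _ "max c 0"] exI[of _ "max b 1"]) auto
qed

text \<open>The first bound makes the kinetic form finite on \<open>H1\<close>. The second gives
  \<open>kappa A\<close> its meaning as an infimum, since \<open>INF\<close> over a set unbounded
  below would not bound its elements.\<close>

lemma A_upper: "\<exists>M\<ge>0. (\<forall>k. cmod (A k) \<le> M * (1 + (norm k)\<^sup>2)) \<and> (\<forall>k. - M \<le> lambda_minus A k)"
proof -
  obtain \<eta> R where o: "0 \<le> \<eta>" "\<eta> < 1" "\<And>k. R \<le> norm k \<Longrightarrow> cmod (A k) \<le> \<eta> * (norm k)\<^sup>2" using A_outer by blast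
  have "compact (A ` cball 0 R)" by (intro compact_continuous_image continuous_on_subset[OF A_cont]) auto
  from compact_imp_bounded[OF this] obtain M where "\<forall>y\<in>A ` cball 0 R. cmod y \<le> M"
    unfolding bounded_iff by blast
  then have M: "cmod (A k) \<le> M" if "norm k \<le> R" for k using that by auto
  define M' where "M' = max M 1"
  have 1: "cmod (A k) \<le> M' * (1 + (norm k)\<^sup>2)" for k
  proof (cases "norm k \<le> R")
    case True
    have "cmod (A k) \<le> M' * 1" using M[OF True] by (simp add: M'_def)
    also have "\<dots> \<le> M' * (1 + (norm k)\<^sup>2)" by (intro mult_left_mono) (auto simp: M'_def)
    finally show ?thesis .
  next
    case False
    then have "cmod (A k) \<le> \<eta> * (norm k)\<^sup>2" by (intro o) auto
    also have "\<dots> \<le> M' * (1 + (norm k)\<^sup>2)" using o by (intro mult_mono) (auto simp: M'_def)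
    finally show ?thesis .
  qed
  have 2: "- M' \<le> lambda_minus A k" for k
  proof (cases "norm k \<le> R")
    case True
    have "cmod (A k) \<le> M'" "0 \<le> (norm k)\<^sup>2" using M[OF True] by (auto simp: M'_def)
    then show ?thesis unfolding lambda_minus_def by linarith
  next
    case False
    then have "cmod (A k) \<le> \<eta> * (norm k)\<^sup>2" by (intro o) auto
    also have "\<dots> \<le> 1 * (norm k)\<^sup>2" using o by (intro mult_right_mono) auto
    finally show ?thesis by (simp add: lambda_minus_def M'_def)
  qed
  show ?thesis using 1 2 by (intro exI[of _ M']) (auto simp: M'_def)
qed

lemma kappa_le: "kappa A \<le> lambda_minus A p"
proof -
  obtain M where "\<And>k. - M \<le> lambda_minus A k" using A_upper by blast
  then have "bdd_below (range (lambda_minus A))" by (intro bdd_belowI[of _ "- M"]) auto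
  then show ?thesis unfolding kappa_def by (intro cINF_lower) auto
qed

text \<open>At large momenta the strict growth condition leaves a fraction 1 - \<eta> of
  \<open>(norm p)\<^sup>2\<close>; on the remaining disc the positive gap \<open>kappa A - E\<close>
  is compared with the largest value of the weight.\<close>

lemma symbol_coercive:
  assumes "E < kappa A" shows "\<exists>c>0. \<forall>p. c * (1 + (norm p)\<^sup>2) \<le> lambda_minus A p - E"
proof -
  obtain \<eta> R where o: "0 \<le> \<eta>" "\<eta> < 1" "\<And>k. R \<le> norm k \<Longrightarrow> cmod (A k) \<le> \<eta> * (norm k)\<^sup>2" using A_outer by blast
  define c1 where "c1 = (1 - \<eta>) / 2"
  have c1: "c1 > 0" using o by (simp add: c1_def)
  \<comment> \<open>Beyond this radius one half of the fraction 1 - \<eta>, namely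
    \<open>c1 * (norm p)\<^sup>2\<close>, absorbs both |E| and the constant \<open>c1\<close>; the
    other half remains as coercivity.\<close>
  define R1 where "R1 = max R (sqrt ((\<bar>E\<bar> + c1) / c1))"
  define c where "c = min c1 ((kappa A - E) / (1 + R1\<^sup>2))"
  have den: "0 < 1 + R1\<^sup>2" by (simp add: add_pos_nonneg)
  have cpos: "c > 0" using c1 assms den by (simp add: c_def)
  have "c * (1 + (norm p)\<^sup>2) \<le> lambda_minus A p - E" for p
  proof (cases "norm p \<le> R1")
    case True
    have "c * (1 + (norm p)\<^sup>2) \<le> ((kappa A - E) / (1 + R1\<^sup>2)) * (1 + R1\<^sup>2)"
      using True assms den by (intro mult_mono add_left_mono power_mono) (auto simp: c_def)
    also have "\<dots> = kappa A - E" using den by simp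
    finally show ?thesis using kappa_le[of p] by simp
  next
    case False
    have "R \<le> norm p" using False by (simp add: R1_def)
    from o(3)[OF this] have A: "cmod (A p) \<le> \<eta> * (norm p)\<^sup>2" .
    have "sqrt ((\<bar>E\<bar> + c1) / c1) \<le> norm p" using False by (simp add: R1_def)
    then have "(\<bar>E\<bar> + c1) / c1 \<le> (norm p)\<^sup>2" by (rule sqrt_le_D)
    then have "\<bar>E\<bar> + c1 \<le> c1 * (norm p)\<^sup>2" using c1 by (simp add: pos_divide_le_eq mult.commute)
    moreover have "c * (1 + (norm p)\<^sup>2) \<le> c1 * (1 + (norm p)\<^sup>2)"
      by (intro mult_right_mono) (auto simp: c_def)
    moreover have "c1 * (norm p)\<^sup>2 + c1 * (norm p)\<^sup>2 = (norm p)\<^sup>2 - \<eta> * (norm p)\<^sup>2"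
    proof -
      have "c1 + c1 = 1 - \<eta>" by (simp add: c1_def)
      then have "(c1 + c1) * (norm p)\<^sup>2 = (1 - \<eta>) * (norm p)\<^sup>2" by simp
      then show ?thesis by (simp only: distrib_right left_diff_distrib mult_1)
    qed
    ultimately show ?thesis using A unfolding lambda_minus_def distrib_left by linarith
  qed
  then show ?thesis using cpos by blast
qed

lemma H0_integrable:
  assumes "\<Phi> \<in> H1" "\<Psi> \<in> H1"
  shows "integrable lebesgue (\<lambda>p. cinner (fourier2 \<Phi> p) (H0_symbol A p *v fourier2 \<Psi> p))"
proof -
  obtain M where M: "M \<ge> 0" "\<And>k. cmod (A k) \<le> M * (1 + (norm k)\<^sup>2)" using A_upper by blast
  note L = fourier2_L2[OF H1_L2[OF assms(1)]] fourier2_L2[OF H1_L2[OF assms(2)]]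
  note [measurable] = L2_measurable[OF L(1)] L2_measurable[OF L(2)]
  let ?w = "\<lambda>\<Psi> p. (1 + (norm p)\<^sup>2) * (norm (fourier2 \<Psi> p))\<^sup>2"
  have "integrable lebesgue (\<lambda>p. (1 + M) * (?w \<Phi> p + ?w \<Psi> p))"
    by (intro integrable_mult_right Bochner_Integration.integrable_add H1_integrable assms)
  then show ?thesis
  proof (rule Bochner_Integration.integrable_bound)
    show "(\<lambda>p. cinner (fourier2 \<Phi> p) (H0_symbol A p *v fourier2 \<Psi> p)) \<in> borel_measurable lebesgue"
      unfolding H0_symbol_cinner by measurable
    show "AE p in lebesgue. norm (cinner (fourier2 \<Phi> p) (H0_symbol A p *v fourier2 \<Psi> p)) \<le> norm ((1 + M) * (?w \<Phi> p + ?w \<Psi> p))"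
    proof (rule AE_I2)
      fix p
      let ?a = "norm (fourier2 \<Phi> p)" and ?b = "norm (fourier2 \<Psi> p)"
      have "cmod (cinner (fourier2 \<Phi> p) (H0_symbol A p *v fourier2 \<Psi> p)) \<le> ((norm p)\<^sup>2 + cmod (A p)) * (2 * (?a * ?b))"
        using H0_symbol_bound[of "fourier2 \<Phi> p" A p "fourier2 \<Psi> p"] by (simp only: mult_ac)
      also have "\<dots> \<le> ((1 + M) * (1 + (norm p)\<^sup>2)) * (?a\<^sup>2 + ?b\<^sup>2)"
      proof (rule mult_mono)
        show "(norm p)\<^sup>2 + cmod (A p) \<le> (1 + M) * (1 + (norm p)\<^sup>2)"
          using M(2)[of p] by (simp add: algebra_simps)
        show "2 * (?a * ?b) \<le> ?a\<^sup>2 + ?b\<^sup>2" using sum_squares_bound[of ?a ?b] by simp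
      qed (use M in auto)
      also have "\<dots> = (1 + M) * (?w \<Phi> p + ?w \<Psi> p)" by (simp add: algebra_simps)
      finally show "norm (cinner (fourier2 \<Phi> p) (H0_symbol A p *v fourier2 \<Psi> p)) \<le> norm ((1 + M) * (?w \<Phi> p + ?w \<Psi> p))"
        unfolding real_norm_def by (rule order.trans[OF _ abs_ge_self])
    qed
  qed
qed

lemma V_norm_sq_integrable:
  assumes "\<Psi> \<in> H1" shows "integrable lebesgue (\<lambda>x. \<bar>V x\<bar> * (norm (\<Psi> x))\<^sup>2)"
    and "(LINT x|lebesgue. \<bar>V x\<bar> * (norm (\<Psi> x))\<^sup>2) =
      (LINT x|lebesgue. \<bar>V x\<bar> * (cmod (\<Psi> x $ 1))\<^sup>2) + (LINT x|lebesgue. \<bar>V x\<bar> * (cmod (\<Psi> x $ 2))\<^sup>2)"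
  using potential_split(1)[OF L2_component[OF H1_L2[OF assms]] fourier2_rel[OF H1_L2[OF assms]] H1_component_wL2[OF assms]]
  unfolding spinor_norm_sq by (simp_all add: distrib_left)

lemma V_integrable:
  assumes "\<Phi> \<in> H1" "\<Psi> \<in> H1" shows "integrable lebesgue (\<lambda>x. of_real (V x) * cinner (\<Phi> x) (\<Psi> x))"
proof (rule Bochner_Integration.integrable_bound)
  show "integrable lebesgue (\<lambda>x. \<bar>V x\<bar> * (norm (\<Phi> x))\<^sup>2 + \<bar>V x\<bar> * (norm (\<Psi> x))\<^sup>2)"
    by (intro Bochner_Integration.integrable_add V_norm_sq_integrable(1) assms)
  note [measurable] = L2_measurable[OF H1_L2[OF assms(1)]] L2_measurable[OF H1_L2[OF assms(2)]]
  show "(\<lambda>x. of_real (V x) * cinner (\<Phi> x) (\<Psi> x)) \<in> borel_measurable lebesgue" by measurable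
  show "AE x in lebesgue. norm (of_real (V x) * cinner (\<Phi> x) (\<Psi> x)) \<le> norm (\<bar>V x\<bar> * (norm (\<Phi> x))\<^sup>2 + \<bar>V x\<bar> * (norm (\<Psi> x))\<^sup>2)"
  proof (rule AE_I2)
    fix x
    have "norm (of_real (V x) * cinner (\<Phi> x) (\<Psi> x)) = \<bar>V x\<bar> * cmod (cinner (\<Phi> x) (\<Psi> x))" by (simp add: norm_mult)
    also have "\<dots> \<le> \<bar>V x\<bar> * ((norm (\<Phi> x))\<^sup>2 + (norm (\<Psi> x))\<^sup>2)"
      using cinner_bound[of "\<Phi> x" "\<Psi> x"] sum_squares_bound[of "norm (\<Phi> x)" "norm (\<Psi> x)"]
      by (intro mult_left_mono) auto
    finally show "norm (of_real (V x) * cinner (\<Phi> x) (\<Psi> x)) \<le> norm (\<bar>V x\<bar> * (norm (\<Phi> x))\<^sup>2 + \<bar>V x\<bar> * (norm (\<Psi> x))\<^sup>2)"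
      unfolding real_norm_def distrib_left by (rule order.trans[OF _ abs_ge_self])
  qed
qed

lemma H_form_hermitian: "spinor_fields.hermitian_on H1 (H_form A V)"
proof -
  have 1: "spinor_fields.hermitian_on H1 (H0_form A)"
    unfolding H0_form_def[abs_def] L2_inner_def
  proof (rule hermitian_integral[OF H1_subspace, of "\<lambda>p u v. cinner u (H0_symbol A p *v v)" fourier2])
    show "cinner v (H0_symbol A p *v u) = cnj (cinner u (H0_symbol A p *v v))" for p u v
      by (rule H0_symbol_commute)
    show "cinner u (H0_symbol A p *v (c *s v + w)) = c * cinner u (H0_symbol A p *v v) + cinner u (H0_symbol A p *v w)" for p u v w c
      by (rule H0_symbol_linear)
  qed (auto intro: H0_integrable fourier2_fscale)
  have 2: "spinor_fields.hermitian_on H1 (\<lambda>\<Phi> \<Psi>. LINT x|lebesgue. of_real (V x) * cinner (\<Phi> x) (\<Psi> x))"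
  proof (rule hermitian_integral[OF H1_subspace, of "\<lambda>x u v. of_real (V x) * cinner u v" "\<lambda>\<Psi>. \<Psi>"])
    show "of_real (V p) * cinner v u = cnj (of_real (V p) * cinner u v)" for p and u v :: spinor
      unfolding cinner_commute[of v u] by simp
    show "of_real (V p) * cinner u (c *s v + w) = c * (of_real (V p) * cinner u v) + of_real (V p) * cinner u w" for p c and u v w :: spinor
      unfolding cinner_linear by (simp only: distrib_left mult.left_commute)
  qed (auto simp: fscale_def intro: V_integrable)
  show ?thesis
    using spinor_fields.hermitian_on_shift[OF 1 2, of "- 1"] unfolding H_form_def[abs_def] by simp
qed

lemma H_form_self:
  assumes "\<Psi> \<in> H1"
  shows "Re (H_form A V \<Psi> \<Psi>) = (LINT p|lebesgue. Re (cinner (fourier2 \<Psi> p) (H0_symbol A p *v fourier2 \<Psi> p)))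
     + (LINT x|lebesgue. V x * (norm (\<Psi> x))\<^sup>2)"
proof -
  have "Re (LINT x|lebesgue. of_real (V x) * cinner (\<Psi> x) (\<Psi> x)) = (LINT x|lebesgue. Re (of_real (V x) * cinner (\<Psi> x) (\<Psi> x)))"
    by (rule integral_Re[OF V_integrable[OF assms assms], symmetric])
  moreover have "Re (LINT p|lebesgue. cinner (fourier2 \<Psi> p) (H0_symbol A p *v fourier2 \<Psi> p))
     = (LINT p|lebesgue. Re (cinner (fourier2 \<Psi> p) (H0_symbol A p *v fourier2 \<Psi> p)))"
    by (rule integral_Re[OF H0_integrable[OF assms assms], symmetric])
  ultimately show ?thesis unfolding H_form_def H0_form_def L2_inner_def cinner_self by simp
qed

lemma V_form_bound:
  assumes "\<Psi> \<in> H1"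
  shows "\<bar>LINT x|lebesgue. V x * (norm (\<Psi> x))\<^sup>2\<bar> \<le> (LINT x|lebesgue. \<bar>V x\<bar> * (norm (\<Psi> x))\<^sup>2)"
  using integral_abs_bound[of lebesgue "\<lambda>x. V x * (norm (\<Psi> x))\<^sup>2"] by (simp add: abs_mult)

lemma H_form_le:
  "\<exists>C. \<forall>\<Psi>\<in>H1. \<bar>Re (H_form A V \<Psi> \<Psi>)\<bar> \<le> C * sH \<Psi>"
proof -
  obtain M where M: "M \<ge> 0" "\<And>k. cmod (A k) \<le> M * (1 + (norm k)\<^sup>2)" using A_upper by blast
  have "\<bar>Re (H_form A V \<Psi> \<Psi>)\<bar> \<le> (2 * (1 + M) + (2 * tail_const + 2 * V_norm)) * sH \<Psi>" if \<Psi>: "\<Psi> \<in> H1" for \<Psi>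
  proof -
    have "\<bar>LINT p|lebesgue. Re (cinner (fourier2 \<Psi> p) (H0_symbol A p *v fourier2 \<Psi> p))\<bar>
       \<le> (LINT p|lebesgue. \<bar>Re (cinner (fourier2 \<Psi> p) (H0_symbol A p *v fourier2 \<Psi> p))\<bar>)"
      by (rule integral_abs_bound)
    also have "\<dots> \<le> (LINT p|lebesgue. 2 * (1 + M) * ((1 + (norm p)\<^sup>2) * (norm (fourier2 \<Psi> p))\<^sup>2))"
    proof (rule integral_mono)
      fix p
      have "\<bar>Re (cinner (fourier2 \<Psi> p) (H0_symbol A p *v fourier2 \<Psi> p))\<bar>
         \<le> 2 * ((norm p)\<^sup>2 + cmod (A p)) * (norm (fourier2 \<Psi> p))\<^sup>2"
        using order.trans[OF abs_Re_le_cmod H0_symbol_bound] by (simp add: power2_eq_square)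
      also have "\<dots> \<le> 2 * ((1 + M) * (1 + (norm p)\<^sup>2)) * (norm (fourier2 \<Psi> p))\<^sup>2"
        using M(2)[of p] by (intro mult_right_mono mult_left_mono) (auto simp: algebra_simps)
      finally show "\<bar>Re (cinner (fourier2 \<Psi> p) (H0_symbol A p *v fourier2 \<Psi> p))\<bar>
        \<le> 2 * (1 + M) * ((1 + (norm p)\<^sup>2) * (norm (fourier2 \<Psi> p))\<^sup>2)" by (simp only: mult.assoc)
    qed (use H0_integrable[OF \<Psi> \<Psi>] H1_integrable[OF \<Psi>] in auto)
    also have "\<dots> = 2 * (1 + M) * sH \<Psi>" by (simp add: sH_def)
    finally have 1: "\<bar>LINT p|lebesgue. Re (cinner (fourier2 \<Psi> p) (H0_symbol A p *v fourier2 \<Psi> p))\<bar> \<le> 2 * (1 + M) * sH \<Psi>" .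
    have pb: "(LINT x|lebesgue. \<bar>V x\<bar> * (cmod (\<Psi> x $ i))\<^sup>2) \<le> (2 * tail_const + 2 * V_norm) * wnorm (\<lambda>p. fourier2 \<Psi> p $ i)" for i
      by (rule potential_bound[OF L2_component[OF H1_L2[OF \<Psi>]] fourier2_rel[OF H1_L2[OF \<Psi>]] H1_component_wL2[OF \<Psi>]])
    have 2: "\<bar>LINT x|lebesgue. V x * (norm (\<Psi> x))\<^sup>2\<bar> \<le> (2 * tail_const + 2 * V_norm) * sH \<Psi>"
      using V_form_bound[OF \<Psi>] pb[of 1] pb[of 2] unfolding V_norm_sq_integrable(2)[OF \<Psi>] sH_wnorm[OF \<Psi>] distrib_left
      by linarith
    show ?thesis using 1 2 unfolding H_form_self[OF \<Psi>] distrib_right by linarith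
  qed
  then show ?thesis by blast
qed

lemma fourier_cong_AE:
  assumes "integrable lebesgue f" "integrable lebesgue g" "AE x in lebesgue. f x = g x"
  shows "fourier f p = fourier g p"
proof -
  have "(LINT x|lebesgue. exp (- \<i> * of_real (p \<bullet> x)) * f x) = (LINT x|lebesgue. exp (- \<i> * of_real (p \<bullet> x)) * g x)"
    by (rule integral_cong_AE[OF borel_measurable_integrable[OF wave_mult_integrable(1)[OF assms(1)]]
          borel_measurable_integrable[OF wave_mult_integrable(1)[OF assms(2)]]])
       (use assms(3) in auto)
  then show ?thesis by (simp add: fourier_def)
qed

text \<open>The symbol offers c times the squared \<open>H1\<close> norm. The potential consumes at
  most half of it, apart from point evaluations of the low-frequency parts of the two components at
  finitely many net points; these evaluations are bounded on \<open>L2\<close> because of their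
  bounded frequency support.\<close>

lemma H_form_coercive:
  assumes E: "E < kappa A"
  shows "\<exists>c>0. \<exists>(m::nat) (l :: nat \<Rightarrow> (plane \<Rightarrow> spinor) \<Rightarrow> complex) B.
      (\<forall>j<m. \<forall>x\<in>H1. \<forall>y\<in>H1. l j (x - y) = l j x - l j y) \<and>
      (\<forall>j<m. \<forall>x\<in>H1. (cmod (l j x))\<^sup>2 \<le> B * Re (L2_inner x x)) \<and>
      (\<forall>x\<in>H1. c * sH x - (\<Sum>j<m. (cmod (l j x))\<^sup>2) \<le> Re (H_form A V x x) - E * Re (L2_inner x x))"
proof -
  obtain c where c: "c > 0" "\<And>p. c * (1 + (norm p)\<^sup>2) \<le> lambda_minus A p - E" using symbol_coercive[OF E] by blast
  obtain K :: nat and Y C where Y: "finite Y" "0 \<le> C"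
    and rc': "\<forall>f g. f \<in> L2 \<longrightarrow> fourier_rel f g \<longrightarrow> g \<in> wL2 \<longrightarrow>
      (LINT x|lebesgue. \<bar>V x\<bar> * (cmod (f x))\<^sup>2)
        \<le> (c / 2) * wnorm g + C * (\<Sum>y\<in>Y. (cmod (ifourier (low (2 ^ K) g) y))\<^sup>2)"
    using potential_relatively_compact[of "c / 2"] c(1) by auto
  \<comment> \<open>One functional for each pair of a component and a net point. The factor
    \<open>sqrt C\<close> makes the plain sum of squares equal to the error term of the potential
    estimate.\<close>
  define L where "L iy \<Psi> = of_real (sqrt C) * ifourier (low (2 ^ K) (\<lambda>p. fourier2 \<Psi> p $ fst iy)) (snd iy)"
    for iy :: "2 \<times> plane" and \<Psi>
  define J where "J = (UNIV :: 2 set) \<times> Y"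
  have fJ: "finite J" using Y by (simp add: J_def)
  obtain e where e: "bij_betw e {..<card J} J"
    using ex_bij_betw_nat_finite[OF fJ] by (auto simp: lessThan_atLeast0)
  have L_diff: "L iy (x - y) = L iy x - L iy y" if x: "x \<in> H1" and y: "y \<in> H1" for iy x y
  proof -
    let ?g = "\<lambda>\<Psi>. low (2 ^ K) (\<lambda>p. fourier2 \<Psi> p $ fst iy)"
    have I: "integrable lebesgue (?g \<Psi>)" if "\<Psi> \<in> H1" for \<Psi>
      by (rule low_integrable[OF H1_component_wL2[OF that]]) simp
    have "AE p in lebesgue. ?g (x - y) p = ?g x p - ?g y p"
      using fourier2_diff[OF H1_L2[OF x] H1_L2[OF y]] by eventually_elim (simp add: low_def)
    from fourier_cong_AE[OF I[OF H1_diff[OF x y]] Bochner_Integration.integrable_diff[OF I[OF x] I[OF y]] this]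
    show ?thesis by (simp add: L_def ifourier_def fourier_diff[OF I[OF x] I[OF y]] right_diff_distrib)
  qed
  have L_sq: "(cmod (L iy \<Psi>))\<^sup>2 = C * (cmod (ifourier (low (2 ^ K) (\<lambda>p. fourier2 \<Psi> p $ fst iy)) (snd iy)))\<^sup>2" for iy \<Psi>
    using Y by (simp add: L_def norm_mult power_mult_distrib)
  have L_bd: "(cmod (L iy \<Psi>))\<^sup>2 \<le> C * (2 ^ K)\<^sup>2 * Re (L2_inner \<Psi> \<Psi>)" if \<Psi>: "\<Psi> \<in> H1" for iy \<Psi>
  proof -
    let ?g = "\<lambda>p. fourier2 \<Psi> p $ fst iy"
    note g = H1_component_wL2[OF \<Psi>, of "fst iy"]
    have "(cmod (ifourier (low (2 ^ K) ?g) (snd iy)))\<^sup>2 \<le> (2 ^ K)\<^sup>2 * l2sq (low (2 ^ K) ?g)"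
      by (rule ifourier_sup(2)[OF wL2_L2[OF low_wL2(1)[OF g]]]) (auto simp: low_def)
    also have "\<dots> \<le> (2 ^ K)\<^sup>2 * l2sq \<Psi>"
    proof (rule mult_left_mono)
      have "l2sq (low (2 ^ K) ?g) \<le> l2sq ?g" by (rule low_wL2(3)[OF g])
      also have "\<dots> \<le> l2sq (fourier2 \<Psi>)"
        unfolding l2sq_def
        by (rule integral_mono[OF L2_integrable[OF wL2_L2[OF g]] L2_integrable[OF fourier2_L2[OF H1_L2[OF \<Psi>]]]])
           (intro power_mono Finite_Cartesian_Product.norm_nth_le norm_ge_zero)
      finally show "l2sq (low (2 ^ K) ?g) \<le> l2sq \<Psi>" using fourier2_isometric[OF H1_L2[OF \<Psi>]] by simp
    qed simp
    finally show ?thesis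
      unfolding L_sq L2_inner_self[OF H1_L2[OF \<Psi>]] Re_complex_of_real mult.assoc
      by (rule mult_left_mono) (rule Y)
  qed
  have main: "(c / 2) * sH \<Psi> - (\<Sum>j<card J. (cmod (L (e j) \<Psi>))\<^sup>2) \<le> Re (H_form A V \<Psi> \<Psi>) - E * Re (L2_inner \<Psi> \<Psi>)"
    if \<Psi>: "\<Psi> \<in> H1" for \<Psi>
  proof -
    let ?\<Sigma> = "\<lambda>i. C * (\<Sum>y\<in>Y. (cmod (ifourier (low (2 ^ K) (\<lambda>p. fourier2 \<Psi> p $ i)) y))\<^sup>2)"
    have "(\<Sum>j<card J. (cmod (L (e j) \<Psi>))\<^sup>2) = (\<Sum>iy\<in>J. (cmod (L iy \<Psi>))\<^sup>2)"
      by (rule sum.reindex_bij_betw[OF e])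
    also have "\<dots> = (\<Sum>i\<in>UNIV. \<Sum>y\<in>Y. (cmod (L (i, y) \<Psi>))\<^sup>2)"
      unfolding J_def by (subst sum.cartesian_product) (simp add: case_prod_beta')
    also have "\<dots> = ?\<Sigma> 1 + ?\<Sigma> 2"
      unfolding sum_2 L_sq by (simp add: sum_distrib_left)
    finally have sumeq: "(\<Sum>j<card J. (cmod (L (e j) \<Psi>))\<^sup>2) = ?\<Sigma> 1 + ?\<Sigma> 2" .
    have rc: "(LINT x|lebesgue. \<bar>V x\<bar> * (cmod (\<Psi> x $ i))\<^sup>2) \<le> (c / 2) * wnorm (\<lambda>p. fourier2 \<Psi> p $ i) + ?\<Sigma> i" for i
      using rc' L2_component[OF H1_L2[OF \<Psi>], of i] fourier2_rel[OF H1_L2[OF \<Psi>], of i] H1_component_wL2[OF \<Psi>, of i] by blast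
    have V1: "- ((c / 2) * sH \<Psi> + (?\<Sigma> 1 + ?\<Sigma> 2)) \<le> (LINT x|lebesgue. V x * (norm (\<Psi> x))\<^sup>2)"
      using V_form_bound[OF \<Psi>] rc[of 1] rc[of 2]
      unfolding V_norm_sq_integrable(2)[OF \<Psi>] sH_wnorm[OF \<Psi>] distrib_left by linarith
    have i1: "integrable lebesgue (\<lambda>p. Re (cinner (fourier2 \<Psi> p) (H0_symbol A p *v fourier2 \<Psi> p)))"
      by (rule integrable_Re[OF H0_integrable[OF \<Psi> \<Psi>]])
    have i2: "integrable lebesgue (\<lambda>p. (norm (fourier2 \<Psi> p))\<^sup>2)"
      by (rule L2_integrable[OF fourier2_L2[OF H1_L2[OF \<Psi>]]])
    have "c * sH \<Psi> = (LINT p|lebesgue. c * ((1 + (norm p)\<^sup>2) * (norm (fourier2 \<Psi> p))\<^sup>2))"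
      by (simp add: sH_def)
    also have "\<dots> \<le> (LINT p|lebesgue. Re (cinner (fourier2 \<Psi> p) (H0_symbol A p *v fourier2 \<Psi> p)) - E * (norm (fourier2 \<Psi> p))\<^sup>2)"
    proof (rule integral_mono)
      fix p
      have "c * (1 + (norm p)\<^sup>2) * (norm (fourier2 \<Psi> p))\<^sup>2 \<le> (lambda_minus A p - E) * (norm (fourier2 \<Psi> p))\<^sup>2"
        by (intro mult_right_mono c(2)) simp
      then show "c * ((1 + (norm p)\<^sup>2) * (norm (fourier2 \<Psi> p))\<^sup>2)
          \<le> Re (cinner (fourier2 \<Psi> p) (H0_symbol A p *v fourier2 \<Psi> p)) - E * (norm (fourier2 \<Psi> p))\<^sup>2"
        using H0_symbol_ge[of A p "fourier2 \<Psi> p"] unfolding left_diff_distrib mult.assoc by linarith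
    qed (use i1 i2 H1_integrable[OF \<Psi>] in auto)
    also have "\<dots> = (LINT p|lebesgue. Re (cinner (fourier2 \<Psi> p) (H0_symbol A p *v fourier2 \<Psi> p))) - E * l2sq \<Psi>"
      using i1 i2 fourier2_isometric[OF H1_L2[OF \<Psi>]] by (simp add: l2sq_def)
    finally show ?thesis
      using V1 unfolding sumeq H_form_self[OF \<Psi>] L2_inner_self[OF H1_L2[OF \<Psi>]] Re_complex_of_real by linarith
  qed
  show ?thesis
    using c(1) L_diff L_bd main
    by (intro exI[of _ "c / 2"] exI[of _ "card J"] exI[of _ "\<lambda>j. L (e j)"] exI[of _ "C * (2 ^ K)\<^sup>2"] conjI) auto
qed

lemma H_form_variational:
  "\<exists>C. variational fscale H1 (H_form A V) L2_inner sH C (kappa A)"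
proof -
  obtain C where C: "\<And>\<Psi>. \<Psi> \<in> H1 \<Longrightarrow> \<bar>Re (H_form A V \<Psi> \<Psi>)\<bar> \<le> C * sH \<Psi>" using H_form_le by blast
  have ReL: "Re (L2_inner \<Psi> \<Psi>) = l2sq \<Psi>" if "\<Psi> \<in> H1" for \<Psi>
    using L2_inner_self[OF H1_L2[OF that]] by simp
  have "variational fscale H1 (H_form A V) L2_inner sH C (kappa A)"
  proof (unfold_locales, goal_cases)
    case 1 show ?case by (rule H1_subspace)
  next
    case 2 show ?case by (rule H_form_hermitian)
  next
    case 3 show ?case by (rule L2_inner_hermitian)
  next
    case (4 x) then show ?case by (simp add: ReL l2sq_nonneg)
  next
    case (5 x) then show ?case by (simp add: ReL l2sq_le_sH)
  next
    case (6 x)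
    then have "l2sq (fourier2 x) = 0" using fourier2_isometric[OF H1_L2] by (simp add: ReL)
    then have "AE p in lebesgue. fourier2 x p = 0"
      using l2sq_eq_0_iff[OF fourier2_L2[OF H1_L2]] 6 by blast
    from H1I_AE(2)[OF H1_L2[OF 6(1)] this] show ?case by simp
  next
    case (7 x) then show ?case by (rule C)
  next
    case (8 u) then show ?case by (intro H1_complete)
  next
    case (9 E) then show ?case by (rule H_form_coercive)
  qed
  then show ?thesis by blast
qed

lemma sum_fun_apply: "(\<Sum>m\<in>I. F m) x = (\<Sum>m\<in>I. F m x)" for F :: "'m \<Rightarrow> plane \<Rightarrow> spinor"
  by (induction I rule: infinite_finite_induct) auto

text \<open>From the abstract principle to the operator: the weak equation of the minimisers is
  precisely membership in the graph of the form operator, and orthonormality gives independence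
  modulo null sets, since pairing with \<open>\<psi> i\<close> annihilates a combination that
  vanishes almost everywhere and returns its coefficient \<open>c i\<close>.\<close>

lemma eigen_count_ge:
  assumes I: "finite I" and \<phi>: "\<And>m. m \<in> I \<Longrightarrow> \<phi> m \<in> H1"
    and neg: "\<And>\<xi> \<Psi>. (\<exists>m\<in>I. \<xi> m \<noteq> 0) \<Longrightarrow> \<Psi> = (\<lambda>x. \<Sum>m\<in>I. \<xi> m *s \<phi> m x) \<Longrightarrow> \<Psi> \<in> H1 \<Longrightarrow>
       Re (H_form A V \<Psi> \<Psi>) < kappa A * l2sq \<Psi>"
  shows "enat (card I) \<le> eigen_count_below (H_op A V) (kappa A)"
proof -
  obtain C where "variational fscale H1 (H_form A V) L2_inner sH C (kappa A)" using H_form_variational by blast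
  then interpret variational fscale H1 "H_form A V" L2_inner sH C "kappa A" .
  have neg': "Re (H_form A V (\<Sum>m\<in>I. fscale (\<xi> m) (\<phi> m)) (\<Sum>m\<in>I. fscale (\<xi> m) (\<phi> m)))
     < kappa A * Re (L2_inner (\<Sum>m\<in>I. fscale (\<xi> m) (\<phi> m)) (\<Sum>m\<in>I. fscale (\<xi> m) (\<phi> m)))"
    if "\<exists>m\<in>I. \<xi> m \<noteq> 0" for \<xi>
  proof -
    have "(\<Sum>m\<in>I. fscale (\<xi> m) (\<phi> m)) \<in> H1"
      using D \<phi> by (intro spinor_fields.subspace_sum spinor_fields.subspace_scale)
    moreover have "(\<Sum>m\<in>I. fscale (\<xi> m) (\<phi> m)) = (\<lambda>x. \<Sum>m\<in>I. \<xi> m *s \<phi> m x)"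
      by (rule ext) (simp add: sum_fun_apply fscale_def)
    ultimately show ?thesis using neg[OF that] by (simp add: L2_inner_self[OF H1_L2])
  qed
  obtain \<psi> E where \<psi>': "\<forall>j<card I. \<psi> j \<in> H1 \<and> E j < kappa A \<and>
      (\<forall>\<theta>\<in>H1. H_form A V \<theta> (\<psi> j) = of_real (E j) * L2_inner \<theta> (\<psi> j))"
    and on: "\<forall>i<card I. \<forall>j<card I. L2_inner (\<psi> i) (\<psi> j) = (if i = j then 1 else 0)"
    using orthonormal_eigenvectors[of I \<phi> "card I", OF \<phi> I neg' order_refl] by blast
  have \<psi>: "\<psi> j \<in> H1" "E j < kappa A" and eig: "\<And>\<theta>. \<theta> \<in> H1 \<Longrightarrow> H_form A V \<theta> (\<psi> j) = of_real (E j) * L2_inner \<theta> (\<psi> j)"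
    if "j < card I" for j using \<psi>' that by blast+
  show ?thesis
  proof (rule orthonormal_eigen_count[of "card I" \<psi> _ E])
    fix j assume j: "j < card I"
    have cE: "cinner u (E j *\<^sub>R v) = of_real (E j) * cinner u v" for u v :: spinor
      unfolding cinner_spinor vector_scaleR_component by (simp add: scaleR_conv_of_real algebra_simps)
    have "(\<lambda>x. E j *\<^sub>R \<psi> j x) \<in> L2"
      by (rule L2I[OF _ integrable_mult_right[OF L2_integrable[OF H1_L2[OF \<psi>(1)[OF j]]], of "(E j)\<^sup>2"]])
         (use L2_measurable[OF H1_L2[OF \<psi>(1)[OF j]]] in \<open>auto simp: power_mult_distrib\<close>)
    moreover have "L2_inner \<theta> (\<lambda>x. E j *\<^sub>R \<psi> j x) = of_real (E j) * L2_inner \<theta> (\<psi> j)" for \<theta>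
      by (simp add: L2_inner_def cE)
    ultimately show "\<psi> j \<in> eigenspace (H_op A V) (E j)"
      unfolding eigenspace_def H_op_def form_operator_def using \<psi>(1)[OF j] eig[OF j] by simp
    show "E j < kappa A" by (rule \<psi>(2)[OF j])
  next
    show "L2_independent (card I) \<psi>"
      unfolding L2_independent_def
    proof (intro allI impI)
      fix c i assume ae: "AE x in lebesgue. (\<Sum>j<card I. c j *s \<psi> j x) = 0" and i: "i < card I"
      let ?X = "\<Sum>j<card I. fscale (c j) (\<psi> j)"
      have X: "?X = (\<lambda>x. \<Sum>j<card I. c j *s \<psi> j x)" by (rule ext) (simp add: sum_fun_apply fscale_def)
      have "L2_inner (\<psi> i) ?X = (\<Sum>j<card I. L2_inner (\<psi> i) (fscale (c j) (\<psi> j)))"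
        by (rule spinor_fields.herm_sum[OF D ip _ \<psi>(1)[OF i]])
           (auto intro!: spinor_fields.subspace_scale[OF D] \<psi>)
      also have "\<dots> = (\<Sum>j<card I. c j * (if i = j then 1 else 0))"
      proof (rule sum.cong[OF refl])
        fix j assume "j \<in> {..<card I}"
        then show "L2_inner (\<psi> i) (fscale (c j) (\<psi> j)) = c j * (if i = j then 1 else 0)"
          using spinor_fields.herm_scale[OF D ip \<psi>(1)[OF i] \<psi>(1)[of j], of "c j"] on i by simp
      qed
      also have "\<dots> = c i" using i by (simp add: if_distrib cong: if_cong)
      finally have "c i = L2_inner (\<psi> i) ?X" by simp
      also have "\<dots> = 0"
        unfolding L2_inner_def X
        by (rule integral_eq_zero_AE) (use ae in \<open>eventually_elim, simp add: cinner_spinor\<close>)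
      finally show "c i = 0" .
    qed
  qed
qed

end

section \<open>Trial functions\<close>

definition annulus :: "nat \<Rightarrow> plane set" where
  "annulus k = ball 0 ((1/2) ^ k) - ball 0 ((1/2) ^ Suc k)"

lemma half_power_square: "((1/2::real) ^ k)\<^sup>2 = (1/4) ^ k"
proof -
  have "((1/2::real) ^ k)\<^sup>2 = ((1/2)\<^sup>2) ^ k" by (simp only: power_mult[symmetric] mult.commute)
  then show ?thesis by (simp add: power2_eq_square)
qed

lemma annulus_measure:
  "annulus k \<in> sets lebesgue" "emeasure lebesgue (annulus k) < \<infinity>" "measure lebesgue (annulus k) = 3 * pi / 4 * (1/4) ^ k"
proof -
  have b: "ball (0::plane) r \<in> lmeasurable" for r by (rule lmeasurable_ball)
  have A: "annulus k \<in> lmeasurable" unfolding annulus_def by (intro fmeasurable.Diff b)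
  then show "annulus k \<in> sets lebesgue" "emeasure lebesgue (annulus k) < \<infinity>" by (auto simp: fmeasurable_def)
  have mb: "measure lebesgue (ball (0::plane) r) = pi * r\<^sup>2" if "0 \<le> r" for r
    using content_ball[OF that, of "0::plane"] by (simp add: unit_ball_vol_2)
  have "(1/2::real) ^ Suc k \<le> (1/2) ^ k" by simp
  then have "ball (0::plane) ((1/2) ^ Suc k) \<subseteq> ball 0 ((1/2) ^ k)" by (rule subset_ball)
  from measurable_measure_Diff[OF b fmeasurableD[OF b] this]
  have "measure lebesgue (annulus k) = pi * ((1/2) ^ k)\<^sup>2 - pi * ((1/2) ^ Suc k)\<^sup>2"
    unfolding annulus_def using mb[of "(1/2) ^ k"] mb[of "(1/2) ^ Suc k"] by simp
  also have "\<dots> = 3 * pi / 4 * (1/4) ^ k"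
    unfolding half_power_square by simp
  finally show "measure lebesgue (annulus k) = 3 * pi / 4 * (1/4) ^ k" .
qed

text \<open>A logarithmic cut-off on the momentum side: mass one, concentrating at the origin, while
  the second moment of its square tends to zero.\<close>

definition mollifier :: "nat \<Rightarrow> plane \<Rightarrow> real" where
  "mollifier n q = (\<Sum>k\<in>{Suc n..<2 * Suc n}. indicator (annulus k) q / (3 * pi / 4 * (1/4) ^ k)) / real (Suc n)"

lemma mollifier_nonneg: "0 \<le> mollifier n q"
  unfolding mollifier_def by (intro divide_nonneg_nonneg sum_nonneg) auto

lemma mollifier_integral: "integrable lebesgue (mollifier n)" "(LINT q|lebesgue. mollifier n q) = 1"
proof -
  have i: "integrable lebesgue (\<lambda>q. indicator (annulus k) q / (3 * pi / 4 * (1/4) ^ k) :: real)" for k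
    using annulus_measure[of k] by (intro integrable_divide integrable_real_indicator) auto
  have v: "(LINT q|lebesgue. indicator (annulus k) q / (3 * pi / 4 * (1/4) ^ k) :: real) = 1" for k
    using annulus_measure[of k] by simp
  show "integrable lebesgue (mollifier n)"
    unfolding mollifier_def[abs_def] by (intro integrable_divide Bochner_Integration.integrable_sum i)
  have "(LINT q|lebesgue. mollifier n q)
      = (\<Sum>k\<in>{Suc n..<2 * Suc n}. LINT q|lebesgue. indicator (annulus k) q / (3 * pi / 4 * (1/4) ^ k)) / real (Suc n)"
    unfolding mollifier_def by (simp only: integral_divide_zero Bochner_Integration.integral_sum[OF i])
  also have "\<dots> = 1" unfolding v by simp
  finally show "(LINT q|lebesgue. mollifier n q) = 1" .
qed

lemma mollifier_support: assumes "(1/2) ^ Suc n \<le> norm q" shows "mollifier n q = 0"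
proof -
  have "indicator (annulus k) q = (0::real)" if "k \<in> {Suc n..<2 * Suc n}" for k
  proof -
    have "(1/2::real) ^ k \<le> (1/2) ^ Suc n" using that by (intro power_decreasing) auto
    then have "q \<notin> annulus k" using assms by (auto simp: annulus_def)
    then show ?thesis by simp
  qed
  then show ?thesis unfolding mollifier_def by simp
qed

text \<open>On annulus k the factor \<open>(norm q)\<^sup>2\<close>, at most
  \<open>(1/4) ^ k\<close>, cancels the density of order \<open>4 ^ k\<close>, so every annulus
  contributes at most 1 and, the annuli being disjoint, so does their sum. Being pointwise, the
  bound can be multiplied by the mollifier, of mass one, to control the second moment of its
  square.\<close>

lemma mollifier_second_moment: "(norm q)\<^sup>2 * mollifier n q \<le> 1 / real (Suc n)"
proof -
  have sub: "ball (0::plane) ((1/2) ^ Suc k) \<subseteq> ball 0 ((1/2) ^ k)" for k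
    by (rule subset_ball) simp
  have ind: "indicator (annulus k) q = indicator (ball 0 ((1/2) ^ k)) q - (indicator (ball 0 ((1/2) ^ Suc k)) q :: real)" for k
    using sub[of k] unfolding annulus_def by (auto simp: indicator_def)
  have "(norm q)\<^sup>2 * (\<Sum>k\<in>{Suc n..<2 * Suc n}. indicator (annulus k) q / (3 * pi / 4 * (1/4) ^ k))
      \<le> (\<Sum>k\<in>{Suc n..<2 * Suc n}. indicator (annulus k) q)"
    unfolding sum_distrib_left
  proof (rule sum_mono)
    fix k
    show "(norm q)\<^sup>2 * (indicator (annulus k) q / (3 * pi / 4 * (1/4) ^ k)) \<le> indicator (annulus k) q"
    proof (cases "q \<in> annulus k")
      case True
      then have "norm q \<le> (1/2) ^ k" by (auto simp: annulus_def)
      then have "(norm q)\<^sup>2 \<le> ((1/2) ^ k)\<^sup>2" by (intro power_mono) auto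
      also have "\<dots> = (1/4) ^ k" by (rule half_power_square)
      also have "\<dots> \<le> 3 * pi / 4 * (1/4) ^ k"
        using pi_gt3 by (simp add: mult_right_mono[of 1 "3 * pi / 4" "(1/4) ^ k", simplified])
      finally show ?thesis using True by (simp add: divide_le_eq)
    qed simp
  qed
  \<comment> \<open>Disjointness of the annuli in the form of a telescoping sum of ball
    indicators.\<close>
  also have "\<dots> = (\<Sum>k\<in>{Suc n..<2 * Suc n}. (- indicator (ball 0 ((1/2) ^ Suc k)) q) - (- indicator (ball 0 ((1/2) ^ k)) q))"
    unfolding ind by simp
  also have "\<dots> = - indicator (ball 0 ((1/2) ^ (2 * Suc n))) q - (- indicator (ball 0 ((1/2) ^ Suc n)) q)"
    by (rule sum_Suc_diff') simp
  also have "\<dots> \<le> 1" by (simp add: indicator_def)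
  finally show ?thesis unfolding mollifier_def times_divide_eq_right by (intro divide_right_mono) auto
qed

lemma mollifier_shift:
  "integrable lebesgue (\<lambda>p. mollifier n (p - a))" "(LINT p|lebesgue. mollifier n (p - a)) = 1"
proof -
  have e: "(- a) + 1 *\<^sub>R p = p - a" for p by simp
  have m: "mollifier n \<in> borel_measurable lebesgue" by (rule borel_measurable_integrable[OF mollifier_integral(1)])
  show "integrable lebesgue (\<lambda>p. mollifier n (p - a))"
    using lebesgue_integral_affine(1)[OF m, of 1 "- a"] mollifier_integral(1) unfolding e by simp
  show "(LINT p|lebesgue. mollifier n (p - a)) = 1"
    using lebesgue_integral_affine(2)[OF m, of 1 "- a"] mollifier_integral(2) unfolding e by simp
qed

lemma mollifier_square:
  "integrable lebesgue (\<lambda>p. (norm (p - a))\<^sup>2 * (mollifier n (p - a))\<^sup>2)"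
  "(LINT p|lebesgue. (norm (p - a))\<^sup>2 * (mollifier n (p - a))\<^sup>2) \<le> 1 / real (Suc n)"
proof -
  note s = mollifier_shift[of n a]
  have m[measurable]: "(\<lambda>p. mollifier n (p - a)) \<in> borel_measurable lebesgue" by (rule borel_measurable_integrable[OF s(1)])
  have [measurable]: "(\<lambda>p. norm (p - a)) \<in> borel_measurable (lebesgue :: plane measure)"
    by (rule borel_imp_lebesgue_measurable) measurable
  have le: "(norm (p - a))\<^sup>2 * (mollifier n (p - a))\<^sup>2 \<le> 1 / real (Suc n) * mollifier n (p - a)" for p
    using mult_right_mono[OF mollifier_second_moment mollifier_nonneg, of "p - a" n n "p - a"]
    by (simp add: power2_eq_square mult.assoc)
  show i: "integrable lebesgue (\<lambda>p. (norm (p - a))\<^sup>2 * (mollifier n (p - a))\<^sup>2)"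
    by (rule Bochner_Integration.integrable_bound[OF integrable_mult_right[OF s(1), of "1 / real (Suc n)"]])
       (measurable, use le mollifier_nonneg[of n] in auto)
  have "(LINT p|lebesgue. (norm (p - a))\<^sup>2 * (mollifier n (p - a))\<^sup>2) \<le> (LINT p|lebesgue. 1 / real (Suc n) * mollifier n (p - a))"
    by (rule integral_mono[OF i integrable_mult_right[OF s(1)] le])
  also have "\<dots> = 1 / real (Suc n)" using s(2) by simp
  finally show "(LINT p|lebesgue. (norm (p - a))\<^sup>2 * (mollifier n (p - a))\<^sup>2) \<le> 1 / real (Suc n)" .
qed

lemma mollifier_bounded: "\<exists>B. \<forall>q. mollifier n q \<le> B"
proof (intro exI allI)
  fix q
  show "mollifier n q \<le> (\<Sum>k\<in>{Suc n..<2 * Suc n}. 1 / (3 * pi / 4 * (1/4) ^ k)) / real (Suc n)"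
    unfolding mollifier_def by (intro divide_right_mono sum_mono) (auto simp: indicator_def)
qed

lemma mollifier_approx_identity:
  fixes F :: "plane \<Rightarrow> complex"
  assumes F: "F \<in> borel_measurable lebesgue" and b: "\<And>p. cmod (F p) \<le> 1" and c: "isCont F a"
  shows "integrable lebesgue (\<lambda>p. of_real (mollifier n (p - a)) * F p)"
    and "cmod (LINT p|lebesgue. of_real (mollifier n (p - a)) * F p) \<le> 1"
    and "(\<lambda>n. LINT p|lebesgue. of_real (mollifier n (p - a)) * F p) \<longlonglongrightarrow> F a"
proof -
  note [measurable] = F borel_measurable_integrable[OF mollifier_shift(1)]
  show i: "integrable lebesgue (\<lambda>p. of_real (mollifier n (p - a)) * F p)" for n
    by (rule Bochner_Integration.integrable_bound[OF mollifier_shift(1)[of n a]])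
       (measurable, use b mollifier_nonneg in \<open>auto simp: norm_mult mult_left_le\<close>)
  have "cmod (LINT p|lebesgue. of_real (mollifier n (p - a)) * F p) \<le> (LINT p|lebesgue. cmod (of_real (mollifier n (p - a)) * F p))"
    by (rule integral_norm_bound)
  also have "\<dots> \<le> (LINT p|lebesgue. mollifier n (p - a))"
    using i b mollifier_nonneg by (intro integral_mono mollifier_shift(1) integrable_norm) (auto simp: norm_mult mult_left_le)
  finally show "cmod (LINT p|lebesgue. of_real (mollifier n (p - a)) * F p) \<le> 1" by (simp add: mollifier_shift(2))
  show "(\<lambda>n. LINT p|lebesgue. of_real (mollifier n (p - a)) * F p) \<longlonglongrightarrow> F a"
  proof (rule LIMSEQ_I)
    fix e :: real assume e: "0 < e"
    obtain d where d: "d > 0" "\<And>p. norm (p - a) < d \<Longrightarrow> cmod (F p - F a) < e / 2"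
      using c e unfolding continuous_at_eps_delta dist_norm by (meson half_gt_zero)
    obtain n0 where n0: "(1/2::real) ^ n0 < d" using real_arch_pow_inv[OF d(1), of "1/2"] by auto
    have "cmod ((LINT p|lebesgue. of_real (mollifier n (p - a)) * F p) - F a) < e" if n: "n \<ge> n0" for n
    proof -
      have ci: "integrable lebesgue (\<lambda>p. complex_of_real (mollifier n (p - a)) * F a)"
        using mollifier_shift(1)[of n a] by simp
      have "F a = (LINT p|lebesgue. complex_of_real (mollifier n (p - a)) * F a)"
        using mollifier_shift[of n a] by (simp add: integral_complex_of_real)
      then have "(LINT p|lebesgue. of_real (mollifier n (p - a)) * F p) - F a
          = (LINT p|lebesgue. of_real (mollifier n (p - a)) * F p - of_real (mollifier n (p - a)) * F a)"
        using Bochner_Integration.integral_diff[OF i ci] by simp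
      also have "cmod \<dots> \<le> (LINT p|lebesgue. cmod (of_real (mollifier n (p - a)) * F p - of_real (mollifier n (p - a)) * F a))"
        by (rule integral_norm_bound)
      also have "\<dots> \<le> (LINT p|lebesgue. e / 2 * mollifier n (p - a))"
      proof (rule integral_mono)
        show "integrable lebesgue (\<lambda>p. cmod (of_real (mollifier n (p - a)) * F p - of_real (mollifier n (p - a)) * F a))"
          by (intro integrable_norm Bochner_Integration.integrable_diff i ci)
        show "integrable lebesgue (\<lambda>p. e / 2 * mollifier n (p - a))" by (intro integrable_mult_right mollifier_shift(1))
        fix p
        have eq: "cmod (of_real (mollifier n (p - a)) * F p - of_real (mollifier n (p - a)) * F a) = cmod (F p - F a) * mollifier n (p - a)"
          unfolding right_diff_distrib[symmetric] norm_mult using mollifier_nonneg[of n "p - a"] by simp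
        show "cmod (of_real (mollifier n (p - a)) * F p - of_real (mollifier n (p - a)) * F a) \<le> e / 2 * mollifier n (p - a)"
        proof (cases "norm (p - a) < d")
          case True
          then show ?thesis unfolding eq using d(2)[OF True] mollifier_nonneg by (intro mult_right_mono) auto
        next
          case False
          have "(1/2::real) ^ Suc n \<le> (1/2) ^ n0" using n by (intro power_decreasing) auto
          then have "mollifier n (p - a) = 0" using False n0 by (intro mollifier_support) simp
          then show ?thesis by simp
        qed
      qed
      also have "\<dots> = e / 2" using mollifier_shift(2)[of n a] by simp
      finally show ?thesis using e by simp
    qed
    then show "\<exists>no. \<forall>n\<ge>no. norm ((LINT p|lebesgue. of_real (mollifier n (p - a)) * F p) - F a) < e" by blast
  qed
qed

text \<open>At the minimum the derivative of F vanishes, and it is itself differentiable there, so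
  near \<open>p0\<close> it grows at most linearly with the distance. The mean value inequality on
  the ball reaching to q turns this into a quadratic upper bound.\<close>

lemma quadratic_minimum:
  fixes a :: "plane \<Rightarrow> real"
  assumes C2: "C2_on U a" and p0: "p0 \<in> U"
    and min: "\<And>q. (norm p0)\<^sup>2 - a p0 \<le> (norm q)\<^sup>2 - a q"
  shows "\<exists>C \<delta>. 0 \<le> C \<and> 0 < \<delta> \<and> (\<forall>q. norm (q - p0) < \<delta> \<longrightarrow> ((norm q)\<^sup>2 - a q) - ((norm p0)\<^sup>2 - a p0) \<le> C * (norm (q - p0))\<^sup>2)"
proof -
  obtain f' :: "plane \<Rightarrow> plane \<Rightarrow>\<^sub>L real" and f'' :: "plane \<Rightarrow> plane \<Rightarrow>\<^sub>L (plane \<Rightarrow>\<^sub>L real)"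
    where U: "open U" and f': "\<And>x. x \<in> U \<Longrightarrow> (a has_derivative blinfun_apply (f' x)) (at x)"
    and f'': "\<And>x. x \<in> U \<Longrightarrow> (f' has_derivative blinfun_apply (f'' x)) (at x)"
    using C2 unfolding C2_on_def by blast
  define F where "F q = (norm q)\<^sup>2 - a q" for q
  have F: "(F has_derivative (\<lambda>v. 2 * (x \<bullet> v) - f' x v)) (at x)" if "x \<in> U" for x
    unfolding F_def power2_norm_eq_inner
    by (rule has_derivative_eq_rhs, rule has_derivative_diff[OF has_derivative_inner[OF has_derivative_ident has_derivative_ident] f'[OF that]])
       (simp add: inner_commute)
  have "(\<lambda>v. 2 * (p0 \<bullet> v) - f' p0 v) = (\<lambda>v. 0)"
    by (rule differential_zero_maxmin[OF p0 U F[OF p0]]) (use min in \<open>auto simp: F_def\<close>)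
  then have z: "2 * (p0 \<bullet> v) = f' p0 v" for v by (metis eq_iff_diff_eq_0)
  obtain d1 where d1: "d1 > 0" "\<And>y. norm (y - p0) < d1 \<Longrightarrow> norm (f' y - f' p0 - f'' p0 (y - p0)) \<le> 1 * norm (y - p0)"
    using f''[OF p0] unfolding has_derivative_at_alt by (meson zero_less_one)
  obtain d2 where d2: "d2 > 0" "ball p0 d2 \<subseteq> U" using U p0 by (auto simp: open_contains_ball)
  \<comment> \<open>2 is the second derivative of \<open>(norm q)\<^sup>2\<close>, the norm of
    \<open>f'' p0\<close> is that of a, and the 1 pays for the remainder in the differentiability of
    \<open>f'\<close>.\<close>
  define C where "C = 2 + (1 + norm (f'' p0))"
  have C0: "0 \<le> C" by (simp add: C_def add_nonneg_nonneg)
  have deriv: "\<bar>2 * (x \<bullet> v) - f' x v\<bar> \<le> C * norm (x - p0) * norm v" if x: "norm (x - p0) < d1" for x v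
  proof -
    have "norm (f' x - f' p0) \<le> norm (f' x - f' p0 - f'' p0 (x - p0)) + norm (f'' p0 (x - p0))"
      using norm_triangle_sub[of "f' x - f' p0" "f'' p0 (x - p0)"] by (simp add: add.commute)
    also have "\<dots> \<le> 1 * norm (x - p0) + norm (f'' p0) * norm (x - p0)"
      by (intro add_mono d1(2)[OF x] norm_blinfun)
    finally have n: "norm (f' x - f' p0) \<le> (1 + norm (f'' p0)) * norm (x - p0)" by (simp add: distrib_right)
    have "2 * (x \<bullet> v) - f' x v = 2 * ((x - p0) \<bullet> v) - (f' x - f' p0) v"
      by (simp add: inner_diff_left blinfun.diff_left z)
    then have "\<bar>2 * (x \<bullet> v) - f' x v\<bar> \<le> 2 * \<bar>(x - p0) \<bullet> v\<bar> + norm ((f' x - f' p0) v)" by simp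
    also have "\<dots> \<le> 2 * (norm (x - p0) * norm v) + norm (f' x - f' p0) * norm v"
      by (intro add_mono mult_left_mono Cauchy_Schwarz_ineq2 norm_blinfun) auto
    also have "\<dots> \<le> 2 * (norm (x - p0) * norm v) + ((1 + norm (f'' p0)) * norm (x - p0)) * norm v"
      by (intro add_left_mono mult_right_mono n) auto
    also have "\<dots> = C * norm (x - p0) * norm v" by (simp add: C_def algebra_simps)
    finally show ?thesis .
  qed
  have "F q - F p0 \<le> C * (norm (q - p0))\<^sup>2" if q: "norm (q - p0) < min d1 d2" for q
  proof -
    let ?S = "cball p0 (norm (q - p0))"
    have "norm (F q - F p0) \<le> (C * norm (q - p0)) * norm (q - p0)"
    proof (rule differentiable_bound[of ?S])
      fix x assume x: "x \<in> ?S"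
      have xn: "norm (x - p0) \<le> norm (q - p0)" using x by (simp add: dist_norm norm_minus_commute)
      have "x \<in> U" using d2(2) xn q by (auto simp: dist_norm norm_minus_commute)
      then show "(F has_derivative (\<lambda>v. 2 * (x \<bullet> v) - f' x v)) (at x within ?S)"
        by (rule has_derivative_at_withinI[OF F])
      show "onorm (\<lambda>v. 2 * (x \<bullet> v) - f' x v) \<le> C * norm (q - p0)"
      proof (rule onorm_bound)
        fix v
        have "\<bar>2 * (x \<bullet> v) - f' x v\<bar> \<le> C * norm (x - p0) * norm v" using xn q by (intro deriv) simp
        also have "\<dots> \<le> C * norm (q - p0) * norm v" using xn C0 by (intro mult_right_mono mult_left_mono) auto
        finally show "norm (2 * (x \<bullet> v) - f' x v) \<le> C * norm (q - p0) * norm v" by simp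
      qed (use C0 in simp)
    qed (auto simp: dist_norm norm_minus_commute)
    then show ?thesis by (simp add: power2_eq_square mult.assoc)
  qed
  then show ?thesis
    using C0 d1(1) d2(1) unfolding F_def by (intro exI[of _ C] exI[of _ "min d1 d2"]) auto
qed


lemma Re_of_real_mult: "Re (of_real r * z) = r * Re z"
  by simp

text \<open>Expanding the square produces waves with the differences of the momenta, whose integrals
  against V are Fourier coefficients of V; the factor \<open>2 * pi\<close> undoes the normalisation
  of \<open>fourier\<close>. This is where the matrix of the theorem arises.\<close>

lemma exponential_sum_potential:
  assumes V: "integrable lebesgue V" and I: "finite I"
  shows "integrable lebesgue (\<lambda>x. V x * (cmod (\<Sum>m\<in>I. b m * exp (\<i> * of_real (x \<bullet> pt m))))\<^sup>2)"
    and "(LINT x|lebesgue. V x * (cmod (\<Sum>m\<in>I. b m * exp (\<i> * of_real (x \<bullet> pt m))))\<^sup>2)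
      = 2 * pi * Re (\<Sum>m\<in>I. \<Sum>l\<in>I. cnj (b m) * fourier (\<lambda>x. complex_of_real (V x)) (pt m - pt l) * b l)"
proof -
  let ?P = "\<lambda>x. \<Sum>m\<in>I. b m * exp (\<i> * of_real (x \<bullet> pt m))"
  let ?T = "\<lambda>m l x. cnj (b m) * b l * (exp (- \<i> * of_real ((pt m - pt l) \<bullet> x)) * of_real (V x))"
  have Vc: "integrable lebesgue (\<lambda>x. complex_of_real (V x))" using V by simp
  have Ti: "integrable lebesgue (?T m l)" for m l
    by (intro integrable_mult_right wave_mult_integrable(1)[OF Vc])
  have "cnj (b m * exp (\<i> * of_real (x \<bullet> pt m))) * (b l * exp (\<i> * of_real (x \<bullet> pt l)))
      = cnj (b m) * b l * exp (- \<i> * of_real ((pt m - pt l) \<bullet> x))" for m l x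
  proof -
    have "cnj (exp (\<i> * of_real (x \<bullet> pt m))) * exp (\<i> * of_real (x \<bullet> pt l)) = exp (- \<i> * of_real ((pt m - pt l) \<bullet> x))"
    proof -
      have e: "(pt m - pt l) \<bullet> x = x \<bullet> pt m - x \<bullet> pt l" by (simp add: inner_commute[of _ x] inner_diff_right)
      show ?thesis unfolding e by (simp add: exp_cnj exp_add[symmetric] right_diff_distrib)
    qed
    then show ?thesis by (simp only: complex_cnj_mult mult_ac)
  qed
  note cross = this
  have eq: "of_real (V x * (cmod (?P x))\<^sup>2) = (\<Sum>m\<in>I. \<Sum>l\<in>I. ?T m l x)" for x
  proof -
    have "of_real (V x * (cmod (?P x))\<^sup>2) = of_real (V x) * (cnj (?P x) * ?P x)"
      by (simp only: of_real_mult complex_norm_square mult.commute[of "?P x"])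
    also have "cnj (?P x) * ?P x = (\<Sum>m\<in>I. \<Sum>l\<in>I. cnj (b m) * b l * exp (- \<i> * of_real ((pt m - pt l) \<bullet> x)))"
      unfolding cnj_sum sum_product cross ..
    also have "of_real (V x) * \<dots> = (\<Sum>m\<in>I. \<Sum>l\<in>I. ?T m l x)"
      unfolding sum_distrib_left by (intro sum.cong refl) (simp only: mult_ac)
    finally show ?thesis .
  qed
  have Si: "integrable lebesgue (\<lambda>x. \<Sum>m\<in>I. \<Sum>l\<in>I. ?T m l x)"
    by (intro Bochner_Integration.integrable_sum Ti)
  then have "integrable lebesgue (\<lambda>x. complex_of_real (V x * (cmod (?P x))\<^sup>2))" unfolding eq .
  from integrable_Re[OF this]
  show "integrable lebesgue (\<lambda>x. V x * (cmod (?P x))\<^sup>2)" unfolding Re_complex_of_real .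
  have "complex_of_real (LINT x|lebesgue. V x * (cmod (?P x))\<^sup>2) = (LINT x|lebesgue. (\<Sum>m\<in>I. \<Sum>l\<in>I. ?T m l x))"
    unfolding integral_complex_of_real[symmetric] eq ..
  also have "\<dots> = (\<Sum>m\<in>I. \<Sum>l\<in>I. (LINT x|lebesgue. ?T m l x))"
    using Ti by (subst Bochner_Integration.integral_sum) (auto intro!: Bochner_Integration.integrable_sum sum.cong Bochner_Integration.integral_sum)
  also have "\<dots> = (\<Sum>m\<in>I. \<Sum>l\<in>I. of_real (2 * pi) * (cnj (b m) * fourier (\<lambda>x. complex_of_real (V x)) (pt m - pt l) * b l))"
    using wave_mult_integrable(1)[OF Vc] by (intro sum.cong refl) (simp add: fourier_def)
  also have "\<dots> = of_real (2 * pi) * (\<Sum>m\<in>I. \<Sum>l\<in>I. cnj (b m) * fourier (\<lambda>x. complex_of_real (V x)) (pt m - pt l) * b l)"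
    by (simp only: sum_distrib_left)
  finally have "Re (complex_of_real (LINT x|lebesgue. V x * (cmod (?P x))\<^sup>2))
     = Re (of_real (2 * pi) * (\<Sum>m\<in>I. \<Sum>l\<in>I. cnj (b m) * fourier (\<lambda>x. complex_of_real (V x)) (pt m - pt l) * b l))"
    by (rule arg_cong)
  then show "(LINT x|lebesgue. V x * (cmod (?P x))\<^sup>2)
      = 2 * pi * Re (\<Sum>m\<in>I. \<Sum>l\<in>I. cnj (b m) * fourier (\<lambda>x. complex_of_real (V x)) (pt m - pt l) * b l)"
    unfolding Re_complex_of_real Re_of_real_mult .
qed

text \<open>The lower eigenvector of the symbol, normalised by its second component. It is discontinuous
  where \<open>A\<close> vanishes; there (which in \<open>min_set A\<close> can only be the origin, with \<open>kappa A = 0\<close>)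
  a constant spinor does as well.\<close>

definition trial_spinor :: "(plane \<Rightarrow> complex) \<Rightarrow> plane \<Rightarrow> plane \<Rightarrow> spinor" where
  "trial_spinor A a p = vector [if A a = 0 then 0 else - sgn (A p), 1]"

lemma trial_spinor_components:
  "trial_spinor A a p $ 1 = (if A a = 0 then 0 else - sgn (A p))" "trial_spinor A a p $ 2 = 1"
  by (simp_all add: trial_spinor_def)

lemma trial_spinor_bound: "cmod (trial_spinor A a p $ i) \<le> 1"
  using exhaust_2[of i] by (auto simp: trial_spinor_components norm_sgn)

lemma trial_spinor_isCont:
  assumes "continuous_on UNIV A" shows "isCont (\<lambda>p. trial_spinor A a p $ i) a"
proof -
  have A: "isCont A a" using assms by (simp add: continuous_on_eq_continuous_at)
  have "isCont (\<lambda>p. trial_spinor A a p $ 1) a"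
    unfolding trial_spinor_components using A by (cases "A a = 0") (auto intro!: continuous_intros)
  moreover have "isCont (\<lambda>p. trial_spinor A a p $ 2) a" unfolding trial_spinor_components by simp
  ultimately show ?thesis using exhaust_2[of i] by auto
qed

section \<open>Kinetic energy above the threshold\<close>

definition energy :: "(plane \<Rightarrow> complex) \<Rightarrow> plane \<Rightarrow> spinor \<Rightarrow> real" where
  "energy A p v = Re (cinner v (H0_symbol A p *v v)) - kappa A * (norm v)\<^sup>2"

lemma energy_alt: "energy A p v = Re (cinner v (H0_symbol A p *v v) - of_real (kappa A) * cinner v v)"
  by (simp add: energy_def cinner_self)

lemma energy_parallelogram: "energy A p (u + v) + energy A p (u - v) = 2 * energy A p u + 2 * energy A p v"
proof -
  let ?f = "\<lambda>v. cinner v (H0_symbol A p *v v) - of_real (kappa A) * cinner v v"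
  have "?f (u + v) + ?f (u - v) = of_real 2 * ?f u + of_real 2 * ?f v"
    unfolding H0_symbol_cinner unfolding cinner_spinor by (simp add: algebra_simps)
  moreover have "Re w + Re x = 2 * Re y + 2 * Re z" if "w + x = of_real 2 * y + of_real 2 * z" for w x y z
    using arg_cong[OF that, of Re] by simp
  ultimately show ?thesis unfolding energy_alt by blast
qed

lemma energy_scale: "energy A p (c *s v) = (cmod c)\<^sup>2 * energy A p v"
proof -
  have "cinner (c *s v) (H0_symbol A p *v (c *s v)) - of_real (kappa A) * cinner (c *s v) (c *s v)
     = (cnj c * c) * (cinner v (H0_symbol A p *v v) - of_real (kappa A) * cinner v v)"
    unfolding H0_symbol_cinner unfolding cinner_spinor by (simp add: algebra_simps)
  also have "cnj c * c = of_real ((cmod c)\<^sup>2)" by (simp only: complex_norm_square mult.commute)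
  finally show ?thesis unfolding energy_alt by simp
qed

context spin_orbit
begin

lemma energy_nonneg: "0 \<le> energy A p v"
  using H0_symbol_ge[of A p v] mult_right_mono[OF kappa_le[of p], of "(norm v)\<^sup>2"] by (simp add: energy_def)

lemma energy_add_le: "energy A p (u + v) \<le> 2 * energy A p u + 2 * energy A p v"
  using energy_parallelogram[of A p u v] energy_nonneg[of p "u - v"] by simp

text \<open>Being a non-negative quadratic form, the energy obeys a quasi-triangle inequality, which
  disposes of the cross terms between packets. The factor \<open>2 ^ card I\<close> is harmless
  because the energy of every packet tends to zero.\<close>

lemma energy_sum_le: "finite I \<Longrightarrow> energy A p (\<Sum>i\<in>I. v i) \<le> 2 ^ card I * (\<Sum>i\<in>I. energy A p (v i))"
proof (induction I rule: finite_induct)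
  case empty
  show ?case using energy_scale[of A p 0 0] by simp
next
  case (insert i I)
  have "energy A p (\<Sum>i\<in>insert i I. v i) \<le> 2 * energy A p (v i) + 2 * energy A p (\<Sum>i\<in>I. v i)"
    using insert.hyps energy_add_le[of p "v i" "\<Sum>i\<in>I. v i"] by simp
  also have "\<dots> \<le> 2 * (2 ^ card I * energy A p (v i)) + 2 * (2 ^ card I * (\<Sum>i\<in>I. energy A p (v i)))"
    using mult_right_mono[of 1 "2 ^ card I" "energy A p (v i)"] energy_nonneg insert.IH
    by (intro add_mono mult_left_mono) auto
  also have "\<dots> = 2 ^ card (insert i I) * (\<Sum>i\<in>insert i I. energy A p (v i))"
    using insert.hyps by (simp add: algebra_simps)
  finally show ?case .
qed

text \<open>Near a, the trial spinor is an eigenvector of the symbol for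
  \<open>lambda_minus A\<close> wherever A is non-zero, so its energy is a multiple of the distance
  of \<open>lambda_minus A\<close> from its minimum, to which \<open>quadratic_minimum\<close>
  applies. If \<open>A a = 0\<close> the constant spinor is computed directly.\<close>

lemma trial_energy:
  assumes C2: "\<exists>U. min_set A \<subseteq> U \<and> C2_on U (\<lambda>k. cmod (A k))" and a: "a \<in> min_set A"
  shows "\<exists>C \<delta>. 0 \<le> C \<and> 0 < \<delta> \<and> (\<forall>q. norm (q - a) < \<delta> \<longrightarrow> energy A q (trial_spinor A a q) \<le> C * (norm (q - a))\<^sup>2)"
proof (cases "A a = 0")
  case True
  have k: "kappa A = (norm a)\<^sup>2" using a True by (simp add: min_set_def lambda_minus_def)
  \<comment> \<open>Testing the infimum at the origin gives \<open>kappa A \<le> 0\<close>, while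
    \<open>kappa A = (norm a)\<^sup>2\<close>; so both vanish and a is the origin.\<close>
  have "kappa A \<le> - cmod (A 0)" using kappa_le[of 0] by (simp add: lambda_minus_def)
  then have "(norm a)\<^sup>2 \<le> 0" using k norm_ge_zero[of "A 0"] by linarith
  then have k0: "kappa A = 0" "a = 0" using k by auto
  have "energy A q (trial_spinor A a q) = (norm (q - a))\<^sup>2" for q
    unfolding energy_alt H0_symbol_cinner unfolding cinner_spinor trial_spinor_components using True k0 by simp
  then show ?thesis by (intro exI[of _ 1] exI[of _ 1]) simp
next
  case False
  obtain U where U: "min_set A \<subseteq> U" "C2_on U (\<lambda>k. cmod (A k))" using C2 by blast
  have ka: "(norm a)\<^sup>2 - cmod (A a) = kappa A" using a by (simp add: min_set_def lambda_minus_def)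
  obtain C \<delta> where C: "0 \<le> C" "0 < \<delta>" and
    le: "\<And>q. norm (q - a) < \<delta> \<Longrightarrow> ((norm q)\<^sup>2 - cmod (A q)) - kappa A \<le> C * (norm (q - a))\<^sup>2"
    using quadratic_minimum[OF U(2), of a] U(1) a kappa_le unfolding ka lambda_minus_def by blast
  \<comment> \<open>The factor 2 is the squared norm of the spinor where A is non-zero. At a zero of
    A the first component is \<open>sgn 0 = 0\<close>, and the energy is half of the bound.\<close>
  have en: "energy A q (trial_spinor A a q) \<le> 2 * (lambda_minus A q - kappa A)" for q
  proof (cases "A q = 0")
    case True
    have "energy A q (trial_spinor A a q) = lambda_minus A q - kappa A"
      unfolding energy_alt H0_symbol_cinner unfolding cinner_spinor trial_spinor_components lambda_minus_def using True by simp
    then show ?thesis using kappa_le[of q] by simp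
  next
    case Aq: False
    have c1: "cnj (sgn (A q)) * sgn (A q) = 1"
      using complex_norm_square[of "sgn (A q)"] Aq by (simp add: norm_sgn mult.commute)
    have c2: "A q * cnj (sgn (A q)) = of_real (cmod (A q))" "cnj (A q) * sgn (A q) = of_real (cmod (A q))"
    proof -
      have A: "A q = of_real (cmod (A q)) * sgn (A q)" using Aq by (simp add: sgn_eq)
      have "A q * cnj (sgn (A q)) = of_real (cmod (A q)) * (cnj (sgn (A q)) * sgn (A q))"
        by (subst (1) A) (simp only: mult_ac)
      then show 1: "A q * cnj (sgn (A q)) = of_real (cmod (A q))" using c1 by simp
      show "cnj (A q) * sgn (A q) = of_real (cmod (A q))" using arg_cong[OF 1, of cnj] by simp
    qed
    have "cinner (trial_spinor A a q) (H0_symbol A q *v trial_spinor A a q) - of_real (kappa A) * cinner (trial_spinor A a q) (trial_spinor A a q)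
      = of_real ((norm q)\<^sup>2) * (cnj (sgn (A q)) * sgn (A q) + 1) - A q * cnj (sgn (A q)) - cnj (A q) * sgn (A q)
        - of_real (kappa A) * (cnj (sgn (A q)) * sgn (A q) + 1)"
      unfolding H0_symbol_cinner unfolding cinner_spinor trial_spinor_components using False by simp
    also have "\<dots> = of_real (2 * (lambda_minus A q - kappa A))"
      unfolding c1 c2 by (simp add: lambda_minus_def)
    finally show ?thesis unfolding energy_alt by (simp only: Re_complex_of_real order_refl)
  qed
  have "energy A q (trial_spinor A a q) \<le> (2 * C) * (norm (q - a))\<^sup>2" if "norm (q - a) < \<delta>" for q
  proof -
    have "2 * (lambda_minus A q - kappa A) \<le> 2 * (C * (norm (q - a))\<^sup>2)"
      using le[OF that] by (intro mult_left_mono) (auto simp: lambda_minus_def)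
    with en[of q] show ?thesis unfolding mult.assoc by (rule order.trans)
  qed
  then show ?thesis using C by (intro exI[of _ "2 * C"] exI[of _ \<delta>]) auto
qed

lemma trial_spinor_measurable[measurable]: "(\<lambda>p. trial_spinor A a p $ i) \<in> borel_measurable lebesgue"
proof -
  have "(\<lambda>p. trial_spinor A a p $ 1) \<in> borel_measurable lebesgue" "(\<lambda>p. trial_spinor A a p $ 2) \<in> borel_measurable lebesgue"
    unfolding trial_spinor_components sgn_eq by measurable
  then show ?thesis using exhaust_2[of i] by auto
qed

section \<open>Wave packets and their binding\<close>

definition packet :: "nat \<Rightarrow> plane \<Rightarrow> plane \<Rightarrow> spinor" where
  "packet n a p = of_real (mollifier n (p - a)) *s trial_spinor A a p"

text \<open>Given by the integral \<open>ifourier\<close>, not as some preimage in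
  \<open>L2\<close>, because its limit is to be taken at every point x.\<close>

definition packet_field :: "nat \<Rightarrow> plane \<Rightarrow> plane \<Rightarrow> spinor" where
  "packet_field n a x = (\<chi> i. ifourier (\<lambda>p. packet n a p $ i) x)"

lemma packet_component: "packet n a p $ i = of_real (mollifier n (p - a)) * trial_spinor A a p $ i"
  by (simp add: packet_def)

lemma packet_regular:
  "integrable lebesgue (\<lambda>p. packet n a p $ i)" "(\<lambda>p. packet n a p $ i) \<in> L2"
  "integrable lebesgue (\<lambda>p. (1 + (norm p)\<^sup>2) * (norm (packet n a p))\<^sup>2)"
proof -
  obtain B where B: "\<And>q. mollifier n q \<le> B" using mollifier_bounded by blast
  note [measurable] = borel_measurable_integrable[OF mollifier_shift(1)]
  have m[measurable]: "(\<lambda>p. packet n a p $ i) \<in> borel_measurable lebesgue" for i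
    unfolding packet_component by measurable
  have b: "cmod (packet n a p $ i) \<le> B" for p i
    using mult_mono[OF B trial_spinor_bound[of A a p i], of "p - a"] mollifier_nonneg[of n "p - a"] order.trans[OF mollifier_nonneg B]
    by (simp add: packet_component norm_mult)
  have s: "packet n a p $ i = 0" if "norm p > norm a + 1" for p i
  proof -
    have "(1/2::real) ^ Suc n \<le> 1" by (intro power_le_one) auto
    also have "1 \<le> norm (p - a)" using that norm_triangle_ineq2[of p a] by simp
    finally show ?thesis by (simp add: packet_component mollifier_support)
  qed
  show "integrable lebesgue (\<lambda>p. packet n a p $ i)" "(\<lambda>p. packet n a p $ i) \<in> L2"
    by (rule bounded_support_integrable[OF m b s], assumption)+
  have pm[measurable]: "packet n a \<in> borel_measurable lebesgue" by (rule spinor_measurableI) (rule m)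
  show "integrable lebesgue (\<lambda>p. (1 + (norm p)\<^sup>2) * (norm (packet n a p))\<^sup>2)"
  proof (rule bounded_support_integrable(1)[where B = "(1 + (norm a + 1)\<^sup>2) * (2 * B\<^sup>2)" and R = "norm a + 1"])
    show "(\<lambda>p. (1 + (norm p)\<^sup>2) * (norm (packet n a p))\<^sup>2) \<in> borel_measurable lebesgue" by measurable
    show z: "(1 + (norm p)\<^sup>2) * (norm (packet n a p))\<^sup>2 = 0" if "norm p > norm a + 1" for p
      using s[OF that] by (simp add: spinor_norm_sq del: power_eq_0_iff)
    show "norm ((1 + (norm p)\<^sup>2) * (norm (packet n a p))\<^sup>2) \<le> (1 + (norm a + 1)\<^sup>2) * (2 * B\<^sup>2)" for p
    proof (cases "norm p > norm a + 1")
      case True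
      then show ?thesis unfolding z[OF True] by simp
    next
      case False
      have "(norm (packet n a p))\<^sup>2 \<le> B\<^sup>2 + B\<^sup>2"
        unfolding spinor_norm_sq by (intro add_mono power_mono b) auto
      moreover have "(norm p)\<^sup>2 \<le> (norm a + 1)\<^sup>2" using False by (intro power_mono) auto
      ultimately show ?thesis
        unfolding real_norm_def abs_mult abs_power2 by (intro mult_mono) (auto simp: abs_of_nonneg)
    qed
  qed
qed

lemma packet_combination:
  fixes \<xi> :: "'m \<Rightarrow> complex" and pt :: "'m \<Rightarrow> plane" and n :: nat
  assumes I: "finite I"
  defines "X \<equiv> \<lambda>x. \<Sum>m\<in>I. \<xi> m *s packet_field n (pt m) x"
  shows "X \<in> L2" "AE p in lebesgue. fourier2 X p = (\<Sum>m\<in>I. \<xi> m *s packet n (pt m) p)"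
proof -
  have Xi: "(\<lambda>x. X x $ i) \<in> L2 \<and> fourier_rel (\<lambda>x. X x $ i) (\<lambda>p. (\<Sum>m\<in>I. \<xi> m *s packet n (pt m) p) $ i)" for i
    using I unfolding X_def
  proof (induction I rule: finite_induct)
    case empty
    show ?case by (simp add: L2_zero fourier_rel_zero)
  next
    case (insert m I)
    have f: "(\<lambda>x. packet_field n (pt m) x $ i) \<in> L2"
      using Plancherel_inverse(1)[OF packet_regular(1,2)] by (simp add: packet_field_def)
    have r: "fourier_rel (\<lambda>x. packet_field n (pt m) x $ i) (\<lambda>p. packet n (pt m) p $ i)"
      using fourier_rel_ifourier[OF packet_regular(1,2)] by (simp add: packet_field_def)
    show ?case
      using L2_add[OF L2_mult[OF f, of "\<xi> m"] conjunct1[OF insert.IH]]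
        fourier_rel_combo[OF r conjunct2[OF insert.IH] f conjunct1[OF insert.IH], of "\<xi> m"] insert.hyps
      by simp
  qed
  show X: "X \<in> L2" by (rule L2_spinorI) (use Xi in blast)
  show "AE p in lebesgue. fourier2 X p = (\<Sum>m\<in>I. \<xi> m *s packet n (pt m) p)"
    by (rule fourier2_eqI[OF X]) (use Xi in blast)
qed

lemma packet_field_H1: "packet_field n a \<in> H1"
  using packet_combination[of "{0::nat}" "\<lambda>_. 1" n "\<lambda>_. a"] packet_regular(3)[of n a]
  by (intro H1I_AE(1)[of "packet_field n a" "packet n a"]) (simp_all add: vec_eq_iff)


text \<open>For large n each mollifier lives where the quadratic bound on the trial energy holds,
  and there the squared mollifier meets \<open>(norm (p - pt m))\<^sup>2\<close>, the integrand of
  \<open>mollifier_square\<close>. \<open>C\<close> and \<open>n0\<close> do not depend on the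
  coefficients, as the compactness argument demands.\<close>

lemma packet_energy:
  fixes pt :: "nat \<Rightarrow> plane"
  assumes C2: "\<exists>U. min_set A \<subseteq> U \<and> C2_on U (\<lambda>k. cmod (A k))"
    and I: "finite I" and pt: "\<And>m. m \<in> I \<Longrightarrow> pt m \<in> min_set A"
  shows "\<exists>C n0. 0 \<le> C \<and> (\<forall>n\<ge>n0. \<forall>\<xi> X. (\<forall>m\<in>I. cmod (\<xi> m) \<le> 1) \<longrightarrow>
      X = (\<lambda>x. \<Sum>m\<in>I. \<xi> m *s packet_field n (pt m) x) \<longrightarrow> X \<in> H1 \<longrightarrow>
      Re (H_form A V X X) - kappa A * l2sq X \<le> C / real (Suc n) + (LINT x|lebesgue. V x * (norm (X x))\<^sup>2))"
proof -
  have "\<forall>m\<in>I. \<exists>C \<delta>. 0 \<le> C \<and> 0 < \<delta> \<and> (\<forall>q. norm (q - pt m) < \<delta> \<longrightarrow>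
      energy A q (trial_spinor A (pt m) q) \<le> C * (norm (q - pt m))\<^sup>2)"
    using trial_energy[OF C2 pt] by blast
  then obtain C \<delta> where C: "\<And>m. m \<in> I \<Longrightarrow> 0 \<le> C m" and \<delta>: "\<And>m. m \<in> I \<Longrightarrow> 0 < \<delta> m"
    and te: "\<And>m q. m \<in> I \<Longrightarrow> norm (q - pt m) < \<delta> m \<Longrightarrow> energy A q (trial_spinor A (pt m) q) \<le> C m * (norm (q - pt m))\<^sup>2"
    by metis
  \<comment> \<open>The 1 keeps the minimum meaningful for an empty \<open>I\<close>.\<close>
  define d where "d = Min (insert 1 (\<delta> ` I))"
  have d: "d > 0" "\<And>m. m \<in> I \<Longrightarrow> d \<le> \<delta> m" using I \<delta> by (auto simp: d_def)
  obtain n0 where n0: "(1/2::real) ^ n0 < d" using real_arch_pow_inv[OF d(1), of "1/2"] by auto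
  define B where "B = 2 ^ card I * (\<Sum>m\<in>I. C m)"
  have B0: "0 \<le> B" using C by (simp add: B_def sum_nonneg)
  have main: "Re (H_form A V X X) - kappa A * l2sq X \<le> B / real (Suc n) + (LINT x|lebesgue. V x * (norm (X x))\<^sup>2)"
    if n: "n \<ge> n0" and \<xi>: "\<And>m. m \<in> I \<Longrightarrow> cmod (\<xi> m) \<le> 1"
      and X: "X = (\<lambda>x. \<Sum>m\<in>I. \<xi> m *s packet_field n (pt m) x)" and XH: "X \<in> H1" for n \<xi> X
  proof -
    have fX: "AE p in lebesgue. fourier2 X p = (\<Sum>m\<in>I. \<xi> m *s packet n (pt m) p)"
      unfolding X by (rule packet_combination(2)[OF I])
    have pe: "energy A p (\<xi> m *s packet n (pt m) p) \<le> C m * ((norm (p - pt m))\<^sup>2 * (mollifier n (p - pt m))\<^sup>2)" if m: "m \<in> I" for m p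
    proof -
      let ?g = "mollifier n (p - pt m)"
      have "energy A p (\<xi> m *s packet n (pt m) p) = (cmod (\<xi> m))\<^sup>2 * (?g\<^sup>2 * energy A p (trial_spinor A (pt m) p))"
        unfolding packet_def energy_scale by (simp add: mollifier_nonneg)
      also have "\<dots> \<le> 1\<^sup>2 * (?g\<^sup>2 * energy A p (trial_spinor A (pt m) p))"
        using \<xi>[OF m] energy_nonneg by (intro mult_right_mono power_mono) auto
      also have "\<dots> \<le> ?g\<^sup>2 * (C m * (norm (p - pt m))\<^sup>2)"
      proof (cases "norm (p - pt m) < \<delta> m")
        case True
        then show ?thesis using te[OF m True] by (simp add: mult_left_mono)
      next
        case False
        have "(1/2::real) ^ Suc n \<le> (1/2) ^ n0" using n by (intro power_decreasing) auto
        then have "?g = 0" using False n0 d(2)[OF m] by (intro mollifier_support) simp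
        then show ?thesis by simp
      qed
      finally show ?thesis by (simp only: mult_ac)
    qed
    have i1: "integrable lebesgue (\<lambda>p. Re (cinner (fourier2 X p) (H0_symbol A p *v fourier2 X p)))"
      by (rule integrable_Re[OF H0_integrable[OF XH XH]])
    have i2: "integrable lebesgue (\<lambda>p. (norm (fourier2 X p))\<^sup>2)"
      by (rule L2_integrable[OF fourier2_L2[OF H1_L2[OF XH]]])
    have i3: "integrable lebesgue (\<lambda>p. energy A p (fourier2 X p))"
      unfolding energy_def using i1 i2 by simp
    have i4: "integrable lebesgue (\<lambda>p. 2 ^ card I * (\<Sum>m\<in>I. C m * ((norm (p - pt m))\<^sup>2 * (mollifier n (p - pt m))\<^sup>2)))"
      by (intro integrable_mult_right Bochner_Integration.integrable_sum mollifier_square(1))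
    have "(LINT p|lebesgue. energy A p (fourier2 X p))
        \<le> (LINT p|lebesgue. 2 ^ card I * (\<Sum>m\<in>I. C m * ((norm (p - pt m))\<^sup>2 * (mollifier n (p - pt m))\<^sup>2)))"
    proof (rule integral_mono_AE[OF i3 i4])
      show "AE p in lebesgue. energy A p (fourier2 X p)
          \<le> 2 ^ card I * (\<Sum>m\<in>I. C m * ((norm (p - pt m))\<^sup>2 * (mollifier n (p - pt m))\<^sup>2))"
        using fX
      proof eventually_elim
        case (elim p)
        have "energy A p (fourier2 X p) \<le> 2 ^ card I * (\<Sum>m\<in>I. energy A p (\<xi> m *s packet n (pt m) p))"
          unfolding elim by (rule energy_sum_le[OF I])
        also have "\<dots> \<le> 2 ^ card I * (\<Sum>m\<in>I. C m * ((norm (p - pt m))\<^sup>2 * (mollifier n (p - pt m))\<^sup>2))"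
          by (intro mult_left_mono sum_mono pe) auto
        finally show ?case .
      qed
    qed
    also have "\<dots> = 2 ^ card I * (\<Sum>m\<in>I. C m * (LINT p|lebesgue. (norm (p - pt m))\<^sup>2 * (mollifier n (p - pt m))\<^sup>2))"
      using mollifier_square(1) by (simp add: Bochner_Integration.integral_sum)
    also have "\<dots> \<le> 2 ^ card I * (\<Sum>m\<in>I. C m * (1 / real (Suc n)))"
      by (intro mult_left_mono sum_mono mollifier_square(2) C) auto
    also have "\<dots> = B / real (Suc n)" by (simp add: B_def sum_divide_distrib[symmetric])
    finally have K: "(LINT p|lebesgue. energy A p (fourier2 X p)) \<le> B / real (Suc n)" .
    have "(LINT p|lebesgue. energy A p (fourier2 X p))
       = (LINT p|lebesgue. Re (cinner (fourier2 X p) (H0_symbol A p *v fourier2 X p))) - kappa A * l2sq X"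
      unfolding energy_def fourier2_isometric[OF H1_L2[OF XH], symmetric] using i1 i2 by (simp add: l2sq_def)
    then show ?thesis using K H_form_self[OF XH] by linarith
  qed
  show ?thesis
    by (rule exI[of _ B], rule exI[of _ n0]) (use B0 main in blast)
qed

text \<open>The mollifier is a probability density concentrating at the origin, so the packets stay
  bounded and tend to plane waves. The limits need not lie in \<open>L2\<close>, but the potential
  energy passes to the limit with a multiple of |V| as majorant.\<close>

lemma packet_field_pointwise:
  shows "cmod (packet_field n a x $ i) \<le> 1"
    and "(\<lambda>n. packet_field n a x $ i) \<longlonglongrightarrow> exp (\<i> * of_real (x \<bullet> a)) * trial_spinor A a a $ i / (2 * of_real pi)"
proof -
  let ?F = "\<lambda>p. exp (\<i> * of_real (x \<bullet> p)) * trial_spinor A a p $ i"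
  have [measurable]: "(\<lambda>p. exp (\<i> * complex_of_real (x \<bullet> p))) \<in> borel_measurable lebesgue" by (rule wave_measurable)
  have m: "?F \<in> borel_measurable lebesgue" by measurable
  have b: "cmod (?F p) \<le> 1" for p using trial_spinor_bound[of A a p i] by (simp add: norm_mult)
  have c: "isCont ?F a" by (intro continuous_intros trial_spinor_isCont A_cont)
  note ai = mollifier_approx_identity[OF m b c]
  have eq: "packet_field n a x $ i = (LINT p|lebesgue. of_real (mollifier n (p - a)) * ?F p) / (2 * of_real pi)" for n
    by (simp add: packet_field_def ifourier_alt packet_component mult_ac)
  have "cmod (packet_field n a x $ i) = cmod (LINT p|lebesgue. of_real (mollifier n (p - a)) * ?F p) / (2 * pi)"
    unfolding eq by (simp add: norm_divide norm_mult)
  also have "\<dots> \<le> 1 / (2 * pi)" by (intro divide_right_mono ai(2)) auto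
  also have "\<dots> \<le> 1" using pi_gt3 by simp
  finally show "cmod (packet_field n a x $ i) \<le> 1" .
  show "(\<lambda>n. packet_field n a x $ i) \<longlonglongrightarrow> exp (\<i> * of_real (x \<bullet> a)) * trial_spinor A a a $ i / (2 * of_real pi)"
    unfolding eq by (intro tendsto_divide ai(3) tendsto_const) auto
qed

text \<open>A single n has to work for all coefficient vectors. If none did, normalised
  counterexamples for every n would have coefficients converging along a subsequence; kinetic energy
  above the threshold disappears in the limit, so the potential energy of a non-trivial sum of plane
  waves would be non-negative, against negative definiteness.\<close>

lemma packets_bind:
  fixes pt :: "nat \<Rightarrow> plane" and N :: nat
  assumes C2: "\<exists>U. min_set A \<subseteq> U \<and> C2_on U (\<lambda>k. cmod (A k))"
    and pt: "\<And>m. m \<in> {1..N} \<Longrightarrow> pt m \<in> min_set A"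
    and neg: "hermitian_neg_def N (\<lambda>m n. fourier (\<lambda>x. complex_of_real (V x)) (pt m - pt n))"
  shows "\<exists>n. \<forall>\<xi> X. (\<exists>m\<in>{1..N}. \<xi> m \<noteq> 0) \<longrightarrow> X = (\<lambda>x. \<Sum>m\<in>{1..N}. \<xi> m *s packet_field n (pt m) x) \<longrightarrow> X \<in> H1 \<longrightarrow>
       Re (H_form A V X X) < kappa A * l2sq X"
proof (rule ccontr)
  assume contra: "\<not> ?thesis"
  define I where "I = {1..N}"
  have I: "finite I" by (simp add: I_def)
  define X where "X n \<xi> = (\<lambda>x. \<Sum>m\<in>I. \<xi> m *s packet_field n (pt m) x)" for n and \<xi> :: "nat \<Rightarrow> complex"
  have "\<exists>\<eta>. (\<Sum>m\<in>I. cmod (\<eta> m)) = 1 \<and> X n \<eta> \<in> H1 \<and> 0 \<le> Re (H_form A V (X n \<eta>) (X n \<eta>)) - kappa A * l2sq (X n \<eta>)" for n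
  proof -
    obtain \<xi> where nz: "\<exists>m\<in>I. \<xi> m \<noteq> 0" and H: "X n \<xi> \<in> H1"
      and ge: "\<not> Re (H_form A V (X n \<xi>) (X n \<xi>)) < kappa A * l2sq (X n \<xi>)"
      using contra unfolding X_def I_def by blast
    \<comment> \<open>Normalisation by the sum of moduli: together with the bound 1 on packets it
      bounds every component of the combination by 1, hence the majorant
      \<open>2 * \<bar>V x\<bar>\<close> below.\<close>
    define s where "s = (\<Sum>m\<in>I. cmod (\<xi> m))"
    have s: "s > 0"
    proof -
      obtain m where m: "m \<in> I" "\<xi> m \<noteq> 0" using nz by blast
      have "cmod (\<xi> m) \<le> s" unfolding s_def by (rule member_le_sum[OF m(1) _ I]) simp
      then show ?thesis using m(2) by (smt (verit) zero_less_norm_iff)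
    qed
    define \<eta> where "\<eta> m = complex_of_real (1 / s) * \<xi> m" for m
    have 1: "(\<Sum>m\<in>I. cmod (\<eta> m)) = 1"
      using s by (simp add: \<eta>_def norm_mult norm_divide sum_divide_distrib[symmetric] s_def[symmetric])
    have sc: "X n \<eta> = fscale (of_real (1 / s)) (X n \<xi>)"
      by (rule ext) (simp add: X_def \<eta>_def fscale_def vec_eq_iff sum_distrib_left mult.assoc)
    have H': "X n \<eta> \<in> H1" unfolding sc by (rule spinor_fields.subspace_scale[OF H1_subspace H])
    have 2: "Re (H_form A V (X n \<eta>) (X n \<eta>)) = (1 / s)\<^sup>2 * Re (H_form A V (X n \<xi>) (X n \<xi>))"
      unfolding sc spinor_fields.herm_scale_scale[OF H1_subspace H_form_hermitian H] using s by (simp add: norm_divide)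
    have "Re (L2_inner (X n \<eta>) (X n \<eta>)) = (1 / s)\<^sup>2 * Re (L2_inner (X n \<xi>) (X n \<xi>))"
      unfolding sc spinor_fields.herm_scale_scale[OF H1_subspace L2_inner_hermitian H] using s by (simp add: norm_divide)
    then have 3: "l2sq (X n \<eta>) = (1 / s)\<^sup>2 * l2sq (X n \<xi>)"
      unfolding L2_inner_self[OF H1_L2[OF H]] L2_inner_self[OF H1_L2[OF H']] Re_complex_of_real .
    have "Re (H_form A V (X n \<eta>) (X n \<eta>)) - kappa A * l2sq (X n \<eta>)
        = (1 / s)\<^sup>2 * (Re (H_form A V (X n \<xi>) (X n \<xi>)) - kappa A * l2sq (X n \<xi>))"
      unfolding 2 3 by (simp add: right_diff_distrib)
    also have "\<dots> \<ge> 0" using ge by (intro mult_nonneg_nonneg) auto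
    finally show ?thesis using 1 H' by blast
  qed
  then obtain \<eta> where \<eta>: "\<And>n. (\<Sum>m\<in>I. cmod (\<eta> n m)) = 1" and XH: "\<And>n. X n (\<eta> n) \<in> H1"
    and ge: "\<And>n. 0 \<le> Re (H_form A V (X n (\<eta> n)) (X n (\<eta> n))) - kappa A * l2sq (X n (\<eta> n))" by metis
  have \<eta>1: "cmod (\<eta> n m) \<le> 1" if "m \<in> I" for n m
    unfolding \<eta>[of n, symmetric] by (rule member_le_sum[OF that _ I]) simp
  have "bounded (range (\<lambda>n. \<eta> n m))" if "m \<in> I" for m
    by (rule boundedI[of _ 1]) (use \<eta>1[OF that] in auto)
  then obtain r \<zeta> where r: "strict_mono (r :: nat \<Rightarrow> nat)" and \<zeta>: "\<And>m. m \<in> I \<Longrightarrow> (\<lambda>n. \<eta> (r n) m) \<longlonglongrightarrow> \<zeta> m"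
    using bounded_family_convergent_subseq[OF I, of \<eta>] by blast
  have "(\<lambda>n. \<Sum>m\<in>I. cmod (\<eta> (r n) m)) \<longlonglongrightarrow> (\<Sum>m\<in>I. cmod (\<zeta> m))"
    by (intro tendsto_sum tendsto_norm \<zeta>)
  \<comment> \<open>The normalisation survives the limit because \<open>I\<close> is finite; the
    limit coefficients are therefore not all zero.\<close>
  then have \<zeta>1: "(\<Sum>m\<in>I. cmod (\<zeta> m)) = 1" unfolding \<eta> by (simp add: LIMSEQ_const_iff)
  then obtain m0 where m0: "m0 \<in> I" "\<zeta> m0 \<noteq> 0"
    by (metis (no_types, lifting) norm_zero sum.neutral zero_neq_one)
  define b where "b i m = \<zeta> m * trial_spinor A (pt m) (pt m) $ i / (2 * of_real pi)" for i :: 2 and m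
  define P where "P i x = (\<Sum>m\<in>I. b i m * exp (\<i> * of_real (x \<bullet> pt m)))" for i and x :: plane
  have lim: "(\<lambda>n. X (r n) (\<eta> (r n)) x $ i) \<longlonglongrightarrow> P i x" for x i
  proof -
    have "(\<lambda>n. \<Sum>m\<in>I. \<eta> (r n) m * packet_field (r n) (pt m) x $ i)
        \<longlonglongrightarrow> (\<Sum>m\<in>I. \<zeta> m * (exp (\<i> * of_real (x \<bullet> pt m)) * trial_spinor A (pt m) (pt m) $ i / (2 * of_real pi)))"
      using LIMSEQ_subseq_LIMSEQ[OF packet_field_pointwise(2) r]
      by (intro tendsto_sum tendsto_mult \<zeta>) (auto simp: o_def)
    then show ?thesis by (simp add: X_def P_def b_def mult_ac)
  qed
  have bd: "cmod (X n (\<eta> n) x $ i) \<le> 1" for n x i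
  proof -
    have "cmod (X n (\<eta> n) x $ i) \<le> (\<Sum>m\<in>I. cmod (\<eta> n m) * cmod (packet_field n (pt m) x $ i))"
      unfolding X_def by (simp add: norm_mult[symmetric] norm_sum)
    also have "\<dots> \<le> (\<Sum>m\<in>I. cmod (\<eta> n m) * 1)" by (intro sum_mono mult_left_mono packet_field_pointwise(1)) auto
    finally show ?thesis using \<eta>[of n] by simp
  qed
  note [measurable] = L2_measurable[OF H1_L2[OF XH]]
  have Pi: "integrable lebesgue (\<lambda>x. V x * (cmod (P i x))\<^sup>2)" for i
    unfolding P_def by (rule exponential_sum_potential(1)[OF V I])
  have conv: "(\<lambda>n. LINT x|lebesgue. V x * (norm (X (r n) (\<eta> (r n)) x))\<^sup>2)
      \<longlonglongrightarrow> (LINT x|lebesgue. V x * (cmod (P 1 x))\<^sup>2 + V x * (cmod (P 2 x))\<^sup>2)"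
  proof (rule integral_dominated_convergence[OF _ _ integrable_mult_right[OF integrable_abs[OF V], of 2]])
    show "(\<lambda>x. V x * (cmod (P 1 x))\<^sup>2 + V x * (cmod (P 2 x))\<^sup>2) \<in> borel_measurable lebesgue"
      by (intro borel_measurable_integrable Bochner_Integration.integrable_add Pi)
    show "(\<lambda>x. V x * (norm (X (r n) (\<eta> (r n)) x))\<^sup>2) \<in> borel_measurable lebesgue" for n by measurable
    show "AE x in lebesgue. (\<lambda>n. V x * (norm (X (r n) (\<eta> (r n)) x))\<^sup>2) \<longlonglongrightarrow> V x * (cmod (P 1 x))\<^sup>2 + V x * (cmod (P 2 x))\<^sup>2"
      unfolding spinor_norm_sq distrib_left by (intro AE_I2 tendsto_intros lim)
    show "AE x in lebesgue. norm (V x * (norm (X (r n) (\<eta> (r n)) x))\<^sup>2) \<le> 2 * \<bar>V x\<bar>" for n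
    proof (rule AE_I2)
      fix x
      have "(norm (X (r n) (\<eta> (r n)) x))\<^sup>2 \<le> 1\<^sup>2 + 1\<^sup>2"
        unfolding spinor_norm_sq by (intro add_mono power_mono bd) auto
      then have "\<bar>V x\<bar> * (norm (X (r n) (\<eta> (r n)) x))\<^sup>2 \<le> \<bar>V x\<bar> * 2" by (intro mult_left_mono) auto
      then show "norm (V x * (norm (X (r n) (\<eta> (r n)) x))\<^sup>2) \<le> 2 * \<bar>V x\<bar>" by (simp add: abs_mult)
    qed
  qed
  let ?Q = "\<lambda>b. Re (\<Sum>m\<in>I. \<Sum>l\<in>I. cnj (b m) * fourier (\<lambda>x. complex_of_real (V x)) (pt m - pt l) * b l)"
  have Q_neg: "?Q b < 0" if "\<exists>m\<in>I. b m \<noteq> 0" for b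
    using neg that unfolding hermitian_neg_def_def I_def by blast
  \<comment> \<open>The limit coefficients of the first component contain the first entries of the
    trial spinors, which may all be 0; only the weak inequality can be claimed.\<close>
  have Q1: "?Q (b 1) \<le> 0"
  proof (cases "\<exists>m\<in>I. b 1 m \<noteq> 0")
    case True
    then show ?thesis using Q_neg[OF True] by simp
  next
    case False
    then have "(\<Sum>m\<in>I. \<Sum>l\<in>I. cnj (b 1 m) * fourier (\<lambda>x. complex_of_real (V x)) (pt m - pt l) * b 1 l) = 0"
      by (intro sum.neutral ballI) auto
    then show ?thesis by simp
  qed
  \<comment> \<open>The second entry of every trial spinor is 1, so a non-zero limit coefficient
    survives in the second component and makes its form strictly negative.\<close>
  have "b 2 m0 \<noteq> 0" using m0(2) by (simp add: b_def trial_spinor_components)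
  then have Q2: "?Q (b 2) < 0" using m0(1) by (intro Q_neg) blast
  have "(LINT x|lebesgue. V x * (cmod (P 1 x))\<^sup>2 + V x * (cmod (P 2 x))\<^sup>2) = 2 * pi * ?Q (b 1) + 2 * pi * ?Q (b 2)"
    using Pi exponential_sum_potential(2)[OF V I] unfolding P_def by simp
  also have "\<dots> < 0"
  proof -
    have "2 * pi * ?Q (b 1) \<le> 0" using Q1 by (intro mult_nonneg_nonpos) auto
    moreover have "2 * pi * ?Q (b 2) < 0" using Q2 by (intro mult_pos_neg) auto
    ultimately show ?thesis by linarith
  qed
  finally have lim_neg: "(LINT x|lebesgue. V x * (cmod (P 1 x))\<^sup>2 + V x * (cmod (P 2 x))\<^sup>2) < 0" .
  obtain C n0 where C: "0 \<le> C" and pe: "\<And>n \<xi> X. n \<ge> n0 \<Longrightarrow> (\<forall>m\<in>I. cmod (\<xi> m) \<le> 1) \<Longrightarrow>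
      X = (\<lambda>x. \<Sum>m\<in>I. \<xi> m *s packet_field n (pt m) x) \<Longrightarrow> X \<in> H1 \<Longrightarrow>
      Re (H_form A V X X) - kappa A * l2sq X \<le> C / real (Suc n) + (LINT x|lebesgue. V x * (norm (X x))\<^sup>2)"
    using packet_energy[OF C2 I, of pt] pt unfolding I_def by blast
  have C0: "(\<lambda>n. C / real (Suc (r n))) \<longlonglongrightarrow> 0"
    using LIMSEQ_subseq_LIMSEQ[OF LIMSEQ_Suc[OF lim_const_over_n[of C]] r] by (simp add: o_def)
  have "(\<lambda>n. C / real (Suc (r n)) + (LINT x|lebesgue. V x * (norm (X (r n) (\<eta> (r n)) x))\<^sup>2))
     \<longlonglongrightarrow> 0 + (LINT x|lebesgue. V x * (cmod (P 1 x))\<^sup>2 + V x * (cmod (P 2 x))\<^sup>2)"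
    by (intro tendsto_add C0 conv)
  moreover have "0 \<le> C / real (Suc (r n)) + (LINT x|lebesgue. V x * (norm (X (r n) (\<eta> (r n)) x))\<^sup>2)" if "n \<ge> n0" for n
  proof -
    have "n0 \<le> r n" using that seq_suble[OF r, of n] by simp
    from pe[OF this, of "\<eta> (r n)" "X (r n) (\<eta> (r n))"] \<eta>1 XH[of "r n"] ge[of "r n"]
    show ?thesis by (force simp: X_def)
  qed
  ultimately have "0 \<le> 0 + (LINT x|lebesgue. V x * (cmod (P 1 x))\<^sup>2 + V x * (cmod (P 2 x))\<^sup>2)"
    by (intro LIMSEQ_le_const) blast+
  then show False using lim_neg by simp
qed

end

section \<open>The bound on the number of eigenvalues\<close>

theorem theorem1:
  fixes A :: "real^2 \<Rightarrow> complex"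
    and V :: "real^2 \<Rightarrow> real"
    and r :: real
    and N :: nat
    and p :: "nat \<Rightarrow> real^2"
  assumes A_cont: "continuous_on UNIV A"
    and A_growth: "Limsup at_infinity (\<lambda>k. ereal (cmod (A k) / (norm k)\<^sup>2)) < 1"
    and A_C2: "\<exists>U. min_set A \<subseteq> U \<and> C2_on U (\<lambda>k. cmod (A k))"
    and V_L1: "integrable lebesgue V"
    and r_gt: "r > 1"
    and V_Lr: "integrable lebesgue (\<lambda>x. \<bar>V x\<bar> powr r)"
    and N_ge: "N \<ge> 1"
    and p_S: "\<And>m. m \<in> {1..N} \<Longrightarrow> p m \<in> min_set A"
    and neg: "hermitian_neg_def N (\<lambda>m n. fourier (\<lambda>x. complex_of_real (V x)) (p m - p n))"
  shows "enat N \<le> eigen_count_below (H_op A V) (kappa A)"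
proof -
  interpret spin_orbit V r A
    by unfold_locales (fact V_L1 r_gt V_Lr A_cont A_growth)+
  obtain n where n: "\<And>\<xi> X. (\<exists>m\<in>{1..N}. \<xi> m \<noteq> 0) \<Longrightarrow> X = (\<lambda>x. \<Sum>m\<in>{1..N}. \<xi> m *s packet_field n (p m) x) \<Longrightarrow> X \<in> H1 \<Longrightarrow>
       Re (H_form A V X X) < kappa A * l2sq X"
    using packets_bind[OF A_C2 p_S neg] by blast
  have "enat (card {1..N}) \<le> eigen_count_below (H_op A V) (kappa A)"
    by (rule eigen_count_ge[where \<phi> = "\<lambda>m. packet_field n (p m)"]) (simp, rule packet_field_H1, rule n)
  then show ?thesis by simp
qed

end
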